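(* Let $\mathbf{x}$ be an arbitrary vector in $\mathbb{C}^n$ and $\mathbf{y} = |\mathbf{A} \mathbf{x}|^2 \in \mathbb{R}^m$ be $m$ quadratic samples with $m\ge c_0 \cdot n\log n$, where $c_0$ is a sufficiently large numerical constant. Then the Wirtinger flow initial estimate $\mathbf{z}_0$ normalized to have squared Euclidean norm equal to $m^{-1} \sum_r y_r$, obeys \begin{align*} \text{dist}(\mathbf{z}_0,\mathbf{x}) \le \frac{1}{8}\|\mathbf{x}\|_2 \end{align*} with probability at least $1-10e^{-\gamma n}-{8}/{n^2}$ ($\gamma$ is a fixed positive numerical constant). Further, take a constant learning parameter sequence, $\mu_\tau= \mu$ for all $\tau = 1, 2, \ldots$ and assume $\mu \le c_1/n$ for some fixed numerical constant $c_1$. Then there is an event of probability at least $1-13e^{-\gamma n}-me^{-1.5m}-{8}/{n^2}$, such that on this event, starting from any initial solution $\mathbf{z}_0$ obeying $\text{dist}(\mathbf{z}_0,\mathbf{x}) \le \frac{1}{8}\|\mathbf{x}\|_2$, we have \begin{equation*} \text{dist}(\mathbf{z}_\tau,\mathbf{x})\le \frac{1}{8}\left(1-\frac{\mu}{4}\right)^{\tau/2} \cdot \|\mathbf{x}\|_2. \end{equation*}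
   Context: Gaussian model: the sampling vectors $\mathbf{a}_r\in\mathbb{C}^n$, $r=1,\dots,m$, are i.i.d. $\mathcal{N}(\mathbf{0},\mathbf{I}/2)+i\mathcal{N}(\mathbf{0},\mathbf{I}/2)$, independent of $\mathbf{x}$. $\mathbf{A}$ is the $m\times n$ matrix whose $r$th row is $\mathbf{a}_r^*$, so $y_r=|\mathbf{a}_r^*\mathbf{x}|^2$. The loss is $f(\mathbf{z})=\frac{1}{2m}\sum_{r=1}^m(y_r-|\mathbf{a}_r^*\mathbf{z}|^2)^2$ with (Wirtinger) gradient $\nabla f(\mathbf{z})=\frac1m\sum_{r=1}^m(|\mathbf{a}_r^*\mathbf{z}|^2-y_r)\mathbf{a}_r\mathbf{a}_r^*\mathbf{z}$. The Wirtinger flow initial estimate $\mathbf{z}_0$ is the leading eigenvector of $\mathbf{Y}=\frac1m\sum_{r=1}^m y_r\mathbf{a}_r\mathbf{a}_r^*$ (suitably normalized), and the Wirtinger flow iterates are $\mathbf{z}_{\tau+1}=\mathbf{z}_\tau-\frac{\mu_{\tau+1}}{\|\mathbf{z}_0\|_2^2}\nabla f(\mathbf{z}_\tau)$. The distance is $\text{dist}(\mathbf{z},\mathbf{x})=\min_{\phi\in[0,2\pi]}\|\mathbf{z}-e^{i\phi}\mathbf{x}\|_2$. *)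

theory Defs
  imports "HOL-Probability.Probability"
begin

text \<open>Vectors in C^n are represented as functions nat => complex; only the
  coordinates j < n matter. Index set of the real Gaussian coordinates of the
  sampling vectors: (r, j, k) with r < m, j < n, k in {0,1} (real / imaginary part).\<close>

definition gauss_index :: "nat \<Rightarrow> nat \<Rightarrow> (nat \<times> nat \<times> nat) set" where
  "gauss_index m n = {..<m} \<times> {..<n} \<times> {0, 1}"

definition gauss_space :: "nat \<Rightarrow> nat \<Rightarrow> (nat \<times> nat \<times> nat \<Rightarrow> real) measure" where
  "gauss_space m n = PiM (gauss_index m n) (\<lambda>_. density lborel (normal_density 0 (sqrt (1/2))))"

definition samp :: "(nat \<times> nat \<times> nat \<Rightarrow> real) \<Rightarrow> nat \<Rightarrow> nat \<Rightarrow> complex" where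
  "samp \<omega> r j = Complex (\<omega> (r, j, 0)) (\<omega> (r, j, 1))"

definition az :: "nat \<Rightarrow> (nat \<times> nat \<times> nat \<Rightarrow> real) \<Rightarrow> nat \<Rightarrow> (nat \<Rightarrow> complex) \<Rightarrow> complex" where
  "az n \<omega> r z = (\<Sum>j<n. cnj (samp \<omega> r j) * z j)"

definition meas :: "nat \<Rightarrow> (nat \<times> nat \<times> nat \<Rightarrow> real) \<Rightarrow> (nat \<Rightarrow> complex) \<Rightarrow> nat \<Rightarrow> real" where
  "meas n \<omega> x r = (cmod (az n \<omega> r x))\<^sup>2"

definition vnorm :: "nat \<Rightarrow> (nat \<Rightarrow> complex) \<Rightarrow> real" where
  "vnorm n z = sqrt (\<Sum>j<n. (cmod (z j))\<^sup>2)"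

definition pdist :: "nat \<Rightarrow> (nat \<Rightarrow> complex) \<Rightarrow> (nat \<Rightarrow> complex) \<Rightarrow> real" where
  "pdist n z x = (INF \<phi>\<in>{0..2*pi}. vnorm n (\<lambda>j. z j - cis \<phi> * x j))"

definition Ymat :: "nat \<Rightarrow> nat \<Rightarrow> (nat \<times> nat \<times> nat \<Rightarrow> real) \<Rightarrow> (nat \<Rightarrow> complex) \<Rightarrow> nat \<Rightarrow> nat \<Rightarrow> complex" where
  "Ymat m n \<omega> x j k = (\<Sum>r<m. of_real (meas n \<omega> x r) * samp \<omega> r j * cnj (samp \<omega> r k)) / of_nat m"

definition mat_vec :: "nat \<Rightarrow> (nat \<Rightarrow> nat \<Rightarrow> complex) \<Rightarrow> (nat \<Rightarrow> complex) \<Rightarrow> nat \<Rightarrow> complex" where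
  "mat_vec n B v j = (\<Sum>k<n. B j k * v k)"

definition leading_eigvec :: "nat \<Rightarrow> (nat \<Rightarrow> nat \<Rightarrow> complex) \<Rightarrow> (nat \<Rightarrow> complex) \<Rightarrow> bool" where
  "leading_eigvec n B v \<longleftrightarrow> vnorm n v = 1 \<and>
     (\<exists>lam::complex. (\<forall>j<n. mat_vec n B v j = lam * v j) \<and>
        (\<forall>\<mu> w. (\<exists>j<n. w j \<noteq> 0) \<and> (\<forall>j<n. mat_vec n B w j = \<mu> * w j) \<longrightarrow> Re \<mu> \<le> Re lam))"

text \<open>Wirtinger gradient of f(z) = 1/(2m) sum_r (y_r - |a_r^* z|^2)^2.\<close>
definition wgrad :: "nat \<Rightarrow> nat \<Rightarrow> (nat \<times> nat \<times> nat \<Rightarrow> real) \<Rightarrow> (nat \<Rightarrow> complex) \<Rightarrow> (nat \<Rightarrow> complex) \<Rightarrow> nat \<Rightarrow> complex" where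
  "wgrad m n \<omega> x z j = (\<Sum>r<m. of_real ((cmod (az n \<omega> r z))\<^sup>2 - meas n \<omega> x r) * samp \<omega> r j * az n \<omega> r z) / of_nat m"

fun wf_iter :: "nat \<Rightarrow> nat \<Rightarrow> (nat \<times> nat \<times> nat \<Rightarrow> real) \<Rightarrow> (nat \<Rightarrow> complex) \<Rightarrow> real \<Rightarrow> (nat \<Rightarrow> complex) \<Rightarrow> nat \<Rightarrow> (nat \<Rightarrow> complex)" where
  "wf_iter m n \<omega> x \<mu> z0 0 = z0"
| "wf_iter m n \<omega> x \<mu> z0 (Suc t) =
     (\<lambda>j. wf_iter m n \<omega> x \<mu> z0 t j - of_real (\<mu> / (vnorm n z0)\<^sup>2) * wgrad m n \<omega> x (wf_iter m n \<omega> x \<mu> z0 t) j)"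

end

theory Submission
  imports Defs
begin

text \<open>
  By homogeneity let \<open>x\<close> be a unit vector. With \<open>h = z - e\<^sup>i\<^sup>\<phi> x\<close>, \<open>u\<^sub>r = Re (h\<^sup>*a\<^sub>r a\<^sub>r\<^sup>*e\<^sup>i\<^sup>\<phi> x)\<close> and
  \<open>v\<^sub>r = |a\<^sub>r\<^sup>*h|\<^sup>2\<close> one has \<open>Re \<langle>h, \<nabla>f(z)\<rangle> = avg (2u + v)(u + v) = avg (3u/2 + v)\<^sup>2 - avg u\<^sup>2/4\<close>. The first average
  is one of nonnegative variables, which have good lower tails, so a union bound over a net of mesh \<open>1/n\<close>
  bounds it from below; the second is at most \<open>h\<^sup>*Yh/4\<close>. The Cauchy-Schwarz inequality gives
  \<open>|\<nabla>f(z)|\<^sup>2 \<le> O(n) avg (2u + v)\<^sup>2\<close> once \<open>avg |a\<^sub>r\<^sup>*g|\<^sup>4 = O(n)\<close> on the unit sphere, which is why steps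
  \<open>\<mu> \<le> c1/n\<close> contract the distance.

  For the initialization the Rayleigh quotient of the leading eigenvector \<open>v\<close> is at least \<open>x\<^sup>*Yx \<approx> 2\<close>, while
  \<open>v\<^sup>*Yv \<le> 1 + |x\<^sup>*v|\<^sup>2 + \<epsilon>\<close> for all unit \<open>v\<close>. The latter follows from a Chernoff bound after truncating
  \<open>|a\<^sub>r\<^sup>*x|\<^sup>2\<close> at a multiple of \<open>ln n\<close> and a net of constant mesh. As \<open>m\<close> may be arbitrarily large compared to
  \<open>n\<close>, truncation errors are controlled in mean by Markov's inequality and not by a maximum over \<open>r\<close>.
\<close>

section \<open>Vectors, averages and the descent step\<close>

text \<open>The obstacle is the tails: |a_r^*v|^4 has no exponential moments for v nonzero, so
  averages of degree four admit no exponential upper deviation bound that would survive a union over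
  a net. They are therefore bounded from above only after a truncation or a threshold on |a_r|, and
  otherwise from below. The second obstacle is the phase: multiplying x by a phase does not change
  the loss, so curvature is available only for directions g with Im (x^*g) = 0, which the optimal
  phase of each iterate provides. All randomness is packed into \<open>init_samples\<close> and
  \<open>regular_samples\<close>, which mention neither an iterate nor a step size; hence one event
  serves all starting points, all steps and all \<mu>. The fine mesh is dictated by the O(n) in the
  fourth-moment bound: an L2 error is of order sqrt n times the mesh. The size n^O(n) of that net
  and the truncation level ln n are the two places that consume n ln n samples. Eight bad events of
  probability at most 1/n^2 produce the term 8/n^2.\<close>

definition cip :: "nat \<Rightarrow> (nat \<Rightarrow> complex) \<Rightarrow> (nat \<Rightarrow> complex) \<Rightarrow> complex" where
  "cip n u v = (\<Sum>j<n. cnj (u j) * v j)"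

definition avg :: "nat \<Rightarrow> (nat \<Rightarrow> real) \<Rightarrow> real" where
  "avg m f = (\<Sum>r<m. f r) / real m"

lemma az_eq_cip: "az n \<omega> r z = cip n (samp \<omega> r) z"
  by (simp add: az_def cip_def)

lemma cip_cong: "(\<And>j. j < n \<Longrightarrow> u j = u' j) \<Longrightarrow> (\<And>j. j < n \<Longrightarrow> v j = v' j) \<Longrightarrow> cip n u v = cip n u' v'"
  unfolding cip_def by (intro sum.cong) auto

lemma vnorm_cong: "(\<And>j. j < n \<Longrightarrow> u j = u' j) \<Longrightarrow> vnorm n u = vnorm n u'"
  unfolding vnorm_def by (intro arg_cong[where f = sqrt] sum.cong) auto

lemma cip_add_right: "cip n u (\<lambda>j. v j + w j) = cip n u v + cip n u w"
  by (simp add: cip_def algebra_simps sum.distrib)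

lemma cip_diff_right: "cip n u (\<lambda>j. v j - w j) = cip n u v - cip n u w"
  by (simp add: cip_def algebra_simps sum_subtractf)

lemma cip_add_left: "cip n (\<lambda>j. v j + w j) u = cip n v u + cip n w u"
  by (simp add: cip_def algebra_simps sum.distrib)

lemma cip_diff_left: "cip n (\<lambda>j. v j - w j) u = cip n v u - cip n w u"
  by (simp add: cip_def algebra_simps sum_subtractf)

lemma cip_scale_right: "cip n u (\<lambda>j. c * v j) = c * cip n u v"
  by (simp add: cip_def sum_distrib_left algebra_simps)

lemma cip_scale_left: "cip n (\<lambda>j. c * u j) v = cnj c * cip n u v"
  by (simp add: cip_def sum_distrib_left algebra_simps)

lemma cnj_cip: "cnj (cip n u v) = cip n v u"
  by (simp add: cip_def mult.commute)

lemma vnorm_L2: "vnorm n v = L2_set (\<lambda>j. cmod (v j)) {..<n}"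
  by (simp add: vnorm_def L2_set_def)

lemma vnorm_nonneg [simp]: "0 \<le> vnorm n v"
  by (simp add: vnorm_def sum_nonneg)

lemma vnorm_sq: "(vnorm n v)\<^sup>2 = (\<Sum>j<n. (cmod (v j))\<^sup>2)"
  by (simp add: vnorm_def sum_nonneg)

lemma cip_self: "cip n v v = of_real ((vnorm n v)\<^sup>2)"
  by (simp add: cip_def vnorm_sq complex_norm_square mult.commute flip: of_real_power)

lemma vnorm_sq_cip: "(vnorm n v)\<^sup>2 = Re (cip n v v)"
  by (simp add: cip_self)

lemma vnorm_scale: "vnorm n (\<lambda>j. c * v j) = cmod c * vnorm n v"
  by (simp add: vnorm_L2 norm_mult L2_set_right_distrib)

lemma cip_Cauchy_Schwarz: "cmod (cip n u v) \<le> vnorm n u * vnorm n v"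
proof -
  have "cmod (cip n u v) \<le> (\<Sum>j<n. \<bar>cmod (u j)\<bar> * \<bar>cmod (v j)\<bar>)"
    unfolding cip_def by (rule order_trans[OF norm_sum]) (simp add: norm_mult)
  also have "\<dots> \<le> vnorm n u * vnorm n v"
    unfolding vnorm_L2 by (rule L2_set_mult_ineq)
  finally show ?thesis .
qed

lemma vnorm_triangle: "vnorm n (\<lambda>j. u j + v j) \<le> vnorm n u + vnorm n v"
proof -
  have "vnorm n (\<lambda>j. u j + v j) \<le> L2_set (\<lambda>j. cmod (u j) + cmod (v j)) {..<n}"
    unfolding vnorm_L2 by (intro L2_set_mono) (auto simp: norm_triangle_ineq)
  also have "\<dots> \<le> vnorm n u + vnorm n v"
    unfolding vnorm_L2 by (rule L2_set_triangle_ineq)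
  finally show ?thesis .
qed

lemma vnorm_diff_triangle: "vnorm n u \<le> vnorm n v + vnorm n (\<lambda>j. u j - v j)"
  using vnorm_triangle[of n v "\<lambda>j. u j - v j"] by simp

lemma vnorm_minus_commute: "vnorm n (\<lambda>j. u j - v j) = vnorm n (\<lambda>j. v j - u j)"
  by (simp add: vnorm_def norm_minus_commute)

lemma vnorm_eq_0D: "vnorm n v = 0 \<Longrightarrow> j < n \<Longrightarrow> v j = 0"
  by (simp add: vnorm_def sum_nonneg_eq_0_iff)

lemma vnorm_diff_sq:
  "(vnorm n (\<lambda>j. u j - v j))\<^sup>2 = (vnorm n u)\<^sup>2 + (vnorm n v)\<^sup>2 - 2 * Re (cip n u v)"
proof -
  have "Re (cip n v u) = Re (cip n u v)"
    using cnj_cip[of n u v] by (metis cnj.simps(1))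
  then show ?thesis
    by (simp add: vnorm_sq_cip cip_diff_left cip_diff_right)
qed

section \<open>Averages over the sampling vectors\<close>

lemma avg_nonneg: "(\<And>r. r < m \<Longrightarrow> 0 \<le> f r) \<Longrightarrow> 0 \<le> avg m f"
  unfolding avg_def by (intro divide_nonneg_nonneg sum_nonneg) auto

lemma avg_mono: "(\<And>r. r < m \<Longrightarrow> f r \<le> g r) \<Longrightarrow> avg m f \<le> avg m g"
  unfolding avg_def by (intro divide_right_mono sum_mono) auto

lemma avg_add: "avg m (\<lambda>r. f r + g r) = avg m f + avg m g"
  by (simp add: avg_def sum.distrib add_divide_distrib)

lemma avg_diff: "avg m (\<lambda>r. f r - g r) = avg m f - avg m g"
  by (simp add: avg_def sum_subtractf diff_divide_distrib)

lemma avg_cmult: "avg m (\<lambda>r. c * f r) = c * avg m f"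
  by (simp add: avg_def sum_distrib_left)

lemma avg_const: "m > 0 \<Longrightarrow> avg m (\<lambda>r. c) = c"
  by (simp add: avg_def)

lemma sqrt_avg_L2: "sqrt (avg m (\<lambda>r. (f r)\<^sup>2)) = L2_set f {..<m} / sqrt (real m)"
  by (simp add: avg_def L2_set_def real_sqrt_divide)

lemma avg_Cauchy_Schwarz:
  "\<bar>avg m (\<lambda>r. f r * g r)\<bar> \<le> sqrt (avg m (\<lambda>r. (f r)\<^sup>2)) * sqrt (avg m (\<lambda>r. (g r)\<^sup>2))"
proof -
  have "\<bar>\<Sum>r<m. f r * g r\<bar> \<le> (\<Sum>r<m. \<bar>f r\<bar> * \<bar>g r\<bar>)"
    by (rule order_trans[OF sum_abs]) (simp add: abs_mult)
  also have "\<dots> \<le> L2_set f {..<m} * L2_set g {..<m}"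
    by (rule L2_set_mult_ineq)
  finally show ?thesis
    by (simp add: sqrt_avg_L2) (simp add: avg_def divide_right_mono)
qed

lemma sqrt_avg_triangle:
  "sqrt (avg m (\<lambda>r. (f r + g r)\<^sup>2)) \<le> sqrt (avg m (\<lambda>r. (f r)\<^sup>2)) + sqrt (avg m (\<lambda>r. (g r)\<^sup>2))"
  unfolding sqrt_avg_L2 add_divide_distrib[symmetric]
  by (intro divide_right_mono L2_set_triangle_ineq) simp

lemma sqrt_avg_mono_abs:
  "(\<And>r. r < m \<Longrightarrow> \<bar>f r\<bar> \<le> g r) \<Longrightarrow> sqrt (avg m (\<lambda>r. (f r)\<^sup>2)) \<le> sqrt (avg m (\<lambda>r. (g r)\<^sup>2))"
  by (intro real_sqrt_le_mono avg_mono) (metis abs_ge_self abs_le_square_iff order_trans)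

section \<open>Quadratic form and gradient in terms of the samples\<close>

lemma az_add: "az n \<omega> r (\<lambda>j. v j + w j) = az n \<omega> r v + az n \<omega> r w"
  and az_diff: "az n \<omega> r (\<lambda>j. v j - w j) = az n \<omega> r v - az n \<omega> r w"
  and az_scale: "az n \<omega> r (\<lambda>j. c * v j) = c * az n \<omega> r v"
  by (simp_all add: az_eq_cip cip_add_right cip_diff_right cip_scale_right)

text \<open>The quadratic form v^*Yv as an average of scalars; \<open>Re_cip_Ymat\<close> ties it to
  \<open>Ymat\<close>.\<close>

definition Yform :: "nat \<Rightarrow> nat \<Rightarrow> (nat \<times> nat \<times> nat \<Rightarrow> real) \<Rightarrow> (nat \<Rightarrow> complex) \<Rightarrow> (nat \<Rightarrow> complex) \<Rightarrow> real" where
  "Yform m n \<omega> x v = avg m (\<lambda>r. meas n \<omega> x r * (cmod (az n \<omega> r v))\<^sup>2)"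

text \<open>Testing the gradient against a vector replaces coordinates by averages of scalars: the
  error vector yields the decrease, the gradient itself yields its norm. The equation for
  \<open>w\<close> lets the identity rewrite under the abbreviation used in
  \<open>descent_step\<close>.\<close>

lemma wgrad_cip:
  assumes "w = az n \<omega>"
  shows "cip n v (wgrad m n \<omega> x z) =
    (\<Sum>r<m. of_real ((cmod (w r z))\<^sup>2 - meas n \<omega> x r) * cnj (w r v) * w r z) / of_nat m"
proof -
  have "cip n v (wgrad m n \<omega> x z) =
    (\<Sum>j<n. \<Sum>r<m. of_real ((cmod (w r z))\<^sup>2 - meas n \<omega> x r) * (cnj (v j) * samp \<omega> r j) * w r z) / of_nat m"
    unfolding cip_def wgrad_def assms
    by (simp add: sum_divide_distrib sum_distrib_left mult_ac)
  also have "\<dots> = (\<Sum>r<m. of_real ((cmod (w r z))\<^sup>2 - meas n \<omega> x r) * (\<Sum>j<n. cnj (v j) * samp \<omega> r j) * w r z) / of_nat m"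
    by (subst sum.swap) (simp add: sum_distrib_left sum_distrib_right)
  also have "(\<Sum>r<m. of_real ((cmod (w r z))\<^sup>2 - meas n \<omega> x r) * (\<Sum>j<n. cnj (v j) * samp \<omega> r j) * w r z) =
     (\<Sum>r<m. of_real ((cmod (w r z))\<^sup>2 - meas n \<omega> x r) * cnj (w r v) * w r z)"
    unfolding assms az_eq_cip by (simp add: cip_def mult.commute)
  finally show ?thesis .
qed

lemma Re_sum_avg: "Re ((\<Sum>r<m. of_real (f r) * g r) / of_nat m) = avg m (\<lambda>r. f r * Re (g r))"
  by (simp add: avg_def Re_divide_of_nat)

lemma cmod_add_sq: "(cmod (a + b))\<^sup>2 = (cmod a)\<^sup>2 + 2 * Re (cnj b * a) + (cmod b)\<^sup>2"
  unfolding cmod_power2 by (simp add: power2_eq_square algebra_simps)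

text \<open>Meant for a squared gradient norm \<open>G\<close> that reappears under the root after
  Cauchy-Schwarz.\<close>

lemma le_if_le_sqrt:
  fixes G q :: real
  assumes "G \<le> sqrt (q * G)" "G \<ge> 0" "q \<ge> 0"
  shows "G \<le> q"
proof (cases "G = 0")
  case False
  have "G\<^sup>2 \<le> (sqrt (q * G))\<^sup>2" using assms by (intro power_mono) auto
  also have "\<dots> = q * G" using assms by simp
  finally have "G * G \<le> q * G" by (simp add: power2_eq_square)
  then show ?thesis using False assms by (metis less_le mult_right_le_imp_le)
qed (use assms in simp)

text \<open>Expanding the square gives \<open>s - \<eta> * (2 * Re (cip n h D) - \<eta> * (vnorm n
  D)\<^sup>2)\<close>. The quantity \<open>q\<close> mediates: the inner product exceeds
  \<open>0.25 * s\<close> by \<open>0.02 * q\<close>, and the bound on \<open>\<mu>\<close> makes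
  the gradient term at most \<open>0.04 * q\<close>. \<open>N\<close> stands for the norm of the
  starting point; \<open>im\<close> says that \<open>h\<close> has no component along the phase
  orbit of \<open>x\<close>.\<close>

lemma descent_step:
  fixes x z :: "nat \<Rightarrow> complex"
  assumes x1: "vnorm n x = 1" and n: "n > 0"
    and Y: "\<And>v. Yform m n \<omega> x v \<le> 2.1 * (vnorm n v)\<^sup>2"
    and S: "\<And>v w. avg m (\<lambda>r. (cmod (az n \<omega> r v))\<^sup>2 * (cmod (az n \<omega> r w))\<^sup>2) \<le> K * real n * (vnorm n v)\<^sup>2 * (vnorm n w)\<^sup>2"
    and L: "\<And>g \<sigma>. vnorm n g = 1 \<Longrightarrow> Im (cip n x g) = 0 \<Longrightarrow> 0 \<le> \<sigma> \<Longrightarrow> \<sigma> \<le> 1/8 \<Longrightarrow>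
       0.9 \<le> avg m (\<lambda>r. (3/2 * Re (cnj (az n \<omega> r g) * az n \<omega> r x) + \<sigma> * (cmod (az n \<omega> r g))\<^sup>2)\<^sup>2)"
    and h: "h = (\<lambda>j. z j - cis \<phi> * x j)" and hn: "vnorm n h \<le> 1/8"
    and im: "Im (cip n (\<lambda>j. cis \<phi> * x j) h) = 0"
    and K: "K > 0" and mu: "0 < \<mu>" "\<mu> \<le> 1 / (50 * K * real n)"
    and N: "7/8 \<le> N" "N \<le> 9/8"
  shows "(vnorm n (\<lambda>j. h j - of_real (\<mu> / N\<^sup>2) * wgrad m n \<omega> x z j))\<^sup>2 \<le> (1 - \<mu>/4) * (vnorm n h)\<^sup>2"
proof -
  define w where "w = az n \<omega>"
  define u where "u r = Re (cnj (w r h) * (cis \<phi> * w r x))" for r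
  define v where "v r = (cmod (w r h))\<^sup>2" for r
  define D where "D = wgrad m n \<omega> x z"
  define s where "s = (vnorm n h)\<^sup>2"
  define q where "q = avg m (\<lambda>r. (2 * u r + v r)\<^sup>2)"
  define \<eta> where "\<eta> = \<mu> / N\<^sup>2"
  have wz: "w r z = cis \<phi> * w r x + w r h" for r
    unfolding w_def h by (simp add: az_diff az_scale)
  have diff: "(cmod (w r z))\<^sup>2 - meas n \<omega> x r = 2 * u r + v r" for r
    unfolding wz cmod_add_sq u_def v_def meas_def by (simp add: norm_mult w_def)
  have g1: "Re (cip n h D) = avg m (\<lambda>r. (2 * u r + v r) * (u r + v r))"
  proof -
    have "Re (cip n h D) = avg m (\<lambda>r. (2 * u r + v r) * Re (cnj (w r h) * w r z))"
      unfolding D_def wgrad_cip[OF w_def] diff mult.assoc Re_sum_avg ..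
    moreover have "Re (cnj (w r h) * w r z) = u r + v r" for r
      unfolding wz u_def v_def cmod_power2 by (simp add: power2_eq_square algebra_simps)
    ultimately show ?thesis by simp
  qed
  have zn: "vnorm n z \<le> 9/8"
  proof -
    have "vnorm n z \<le> vnorm n (\<lambda>j. cis \<phi> * x j) + vnorm n h"
      unfolding h by (rule vnorm_diff_triangle)
    then show ?thesis using hn x1 by (simp add: vnorm_scale)
  qed
  have q0: "q \<ge> 0" unfolding q_def by (intro avg_nonneg) simp
  \<comment> \<open>The gradient is tested against itself, so its norm occurs on both sides; 81/64
    bounds the squared norm of \<open>z\<close>.\<close>
  have g2: "(vnorm n D)\<^sup>2 \<le> q * (K * n * (81/64))"
  proof -
    let ?G = "(vnorm n D)\<^sup>2"
    have "?G = Re (cip n D D)" by (rule vnorm_sq_cip)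
    also have "\<dots> = avg m (\<lambda>r. (2 * u r + v r) * Re (cnj (w r D) * w r z))"
      unfolding D_def wgrad_cip[OF w_def] diff mult.assoc Re_sum_avg ..
    also have "\<dots> \<le> sqrt q * sqrt (avg m (\<lambda>r. (Re (cnj (w r D) * w r z))\<^sup>2))"
      unfolding q_def by (rule order_trans[OF abs_ge_self avg_Cauchy_Schwarz])
    also have "\<dots> \<le> sqrt q * sqrt (K * n * ?G * (81/64))"
    proof (intro mult_left_mono real_sqrt_le_mono)
      have "avg m (\<lambda>r. (Re (cnj (w r D) * w r z))\<^sup>2) \<le> avg m (\<lambda>r. (cmod (w r D))\<^sup>2 * (cmod (w r z))\<^sup>2)"
      proof (intro avg_mono)
        fix r
        have "\<bar>Re (cnj (w r D) * w r z)\<bar> \<le> cmod (w r D) * cmod (w r z)"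
          using abs_Re_le_cmod[of "cnj (w r D) * w r z"] by (simp add: norm_mult)
        then show "(Re (cnj (w r D) * w r z))\<^sup>2 \<le> (cmod (w r D))\<^sup>2 * (cmod (w r z))\<^sup>2"
          by (metis abs_ge_zero power2_abs power_mono power_mult_distrib)
      qed
      also have "\<dots> \<le> K * n * ?G * (vnorm n z)\<^sup>2" unfolding w_def by (rule S)
      also have "\<dots> \<le> K * n * ?G * (81/64)"
      proof (intro mult_left_mono)
        show "(vnorm n z)\<^sup>2 \<le> 81/64" using power_mono[OF zn, of 2] by (simp add: power2_eq_square)
      qed (use K in auto)
      finally show "avg m (\<lambda>r. (Re (cnj (w r D) * w r z))\<^sup>2) \<le> K * n * ?G * (81/64)" .
    qed (use q0 in auto)
    finally have "?G \<le> sqrt (q * (K * n * (81/64)) * ?G)"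
      by (simp add: real_sqrt_mult[symmetric] mult_ac)
    then show ?thesis
      by (rule le_if_le_sqrt) (use q0 K in auto)
  qed
  have main: "0.25 * s + 0.02 * q \<le> avg m (\<lambda>r. (2 * u r + v r) * (u r + v r))"
  proof (cases "vnorm n h = 0")
    case True
    have "w r h = 0" for r
      unfolding w_def az_def using vnorm_eq_0D[OF True] by simp
    then show ?thesis using True by (simp add: u_def v_def s_def q_def avg_def)
  next
    case False
    define \<sigma> where "\<sigma> = vnorm n h"
    have sp: "\<sigma> > 0" using False unfolding \<sigma>_def by (simp add: less_le)
    \<comment> \<open>Removing phase and length from \<open>h\<close> brings it into the form of
      \<open>L\<close> with \<open>\<sigma>\<close> the norm of \<open>h\<close>; the square there
      is \<open>1/s\<close> times the one needed here.\<close>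
    define g where "g = (\<lambda>j. (cnj (cis \<phi>) * of_real (1/\<sigma>)) * h j)"
    have g1: "vnorm n g = 1" unfolding g_def vnorm_scale using sp
      by (simp add: norm_mult norm_divide \<sigma>_def)
    have "cip n (\<lambda>j. cis \<phi> * x j) h = of_real \<sigma> * cip n x g"
      unfolding g_def cip_scale_left cip_scale_right using sp by simp
    then have "Im (cip n x g) = 0" using im sp by simp
    from L[OF g1 this] have Lg: "0.9 \<le> avg m (\<lambda>r. (3/2 * Re (cnj (w r g) * w r x) + \<sigma> * (cmod (w r g))\<^sup>2)\<^sup>2)"
      using sp hn by (simp add: \<sigma>_def w_def)
    have wg: "w r g = (cnj (cis \<phi>) * of_real (1/\<sigma>)) * w r h" for r
      unfolding w_def g_def by (rule az_scale)
    have e1: "Re (cnj (w r g) * w r x) = u r / \<sigma>" for r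
      unfolding wg u_def by (simp add: field_simps)
    have e2: "(cmod (w r g))\<^sup>2 = v r / \<sigma>\<^sup>2" for r
      unfolding wg v_def using sp by (simp add: norm_mult norm_divide power_divide power_mult_distrib)
    have "(3/2 * Re (cnj (w r g) * w r x) + \<sigma> * (cmod (w r g))\<^sup>2)\<^sup>2 = (1/s) * (3/2 * u r + v r)\<^sup>2" for r
      unfolding e1 e2 s_def using sp unfolding \<sigma>_def[symmetric] by (simp add: field_simps power2_eq_square)
    with Lg have "0.9 \<le> 1/s * avg m (\<lambda>r. (3/2 * u r + v r)\<^sup>2)" by (simp only: avg_cmult)
    then have a1: "0.9 * s \<le> avg m (\<lambda>r. (3/2 * u r + v r)\<^sup>2)"
      using sp by (simp add: s_def \<sigma>_def[symmetric] field_simps)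
    have "avg m (\<lambda>r. (u r)\<^sup>2) \<le> avg m (\<lambda>r. meas n \<omega> x r * (cmod (w r h))\<^sup>2)"
    proof (intro avg_mono)
      fix r
      have "\<bar>u r\<bar> \<le> cmod (w r x) * cmod (w r h)"
        using abs_Re_le_cmod[of "cnj (w r h) * (cis \<phi> * w r x)"] unfolding u_def
        by (simp add: norm_mult mult.commute)
      then have "(u r)\<^sup>2 \<le> (cmod (w r x) * cmod (w r h))\<^sup>2"
        by (metis abs_ge_zero power2_abs power_mono)
      then show "(u r)\<^sup>2 \<le> meas n \<omega> x r * (cmod (w r h))\<^sup>2"
        by (simp add: meas_def w_def power_mult_distrib)
    qed
    also have "\<dots> \<le> 2.1 * s" using Y[of h] unfolding Yform_def w_def s_def .
    finally have a2: "avg m (\<lambda>r. (u r)\<^sup>2) \<le> 2.1 * s" .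
    \<comment> \<open>Completing the square, \<open>(2u + v)(u + v) = (3u/2 + v)\<^sup>2 - u\<^sup>2/4\<close>, leaves only the term in
      \<open>u\<^sup>2\<close> to be bounded from above; a small part of the square absorbs \<open>q\<close>.\<close>
    have "0.96 * avg m (\<lambda>r. (3/2 * u r + v r)\<^sup>2) - 0.26 * avg m (\<lambda>r. (u r)\<^sup>2) + 0.02 * q
       = avg m (\<lambda>r. 0.96 * (3/2 * u r + v r)\<^sup>2 - 0.26 * (u r)\<^sup>2 + 0.02 * (2 * u r + v r)\<^sup>2)"
      unfolding q_def avg_add avg_diff avg_cmult ..
    also have "\<dots> \<le> avg m (\<lambda>r. (2 * u r + v r) * (u r + v r))"
    proof (intro avg_mono)
      fix r
      have "0 \<le> 0.02 * (u r + v r)\<^sup>2" by simp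
      also have "0.02 * (u r + v r)\<^sup>2 = (2 * u r + v r) * (u r + v r) - (0.96 * (3/2 * u r + v r)\<^sup>2 - 0.26 * (u r)\<^sup>2 + 0.02 * (2 * u r + v r)\<^sup>2)"
        by (simp add: power2_eq_square algebra_simps)
      finally show "0.96 * (3/2 * u r + v r)\<^sup>2 - 0.26 * (u r)\<^sup>2 + 0.02 * (2 * u r + v r)\<^sup>2 \<le> (2 * u r + v r) * (u r + v r)"
        by (simp only: diff_ge_0_iff_ge)
    qed
    moreover have "0 \<le> s" by (simp add: s_def)
    \<comment> \<open>0.96 * 0.9 - 0.26 * 2.1 = 0.318, which exceeds 0.25.\<close>
    ultimately show ?thesis using a1 a2 by (simp add: field_simps)
  qed
  have N2: "49/64 \<le> N\<^sup>2" "N\<^sup>2 \<le> 81/64"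
    using power_mono[OF N(1), of 2] power_mono[OF N(2), of 2] N(1) by (auto simp: power2_eq_square)
  have "N\<^sup>2 > 0" using N2 by linarith
  then have eta: "\<eta> > 0" using mu unfolding \<eta>_def by simp
  have muK: "\<mu> * (K * n) \<le> 1/50" using mu K n by (simp add: field_simps)
  have "\<eta> * (vnorm n D)\<^sup>2 \<le> \<eta> * (q * (K * n * (81/64)))"
    using g2 eta by (intro mult_left_mono) auto
  also have "\<dots> = q * (81/64) * (\<mu> * (K * n)) / N\<^sup>2" by (simp add: \<eta>_def mult_ac)
  also have "\<dots> \<le> q * (81/64) * (1/50) / (49/64)"
    using muK q0 N2 mu K by (intro frac_le mult_left_mono) auto
  also have "\<dots> \<le> 0.04 * q" using q0 by simp
  finally have g3: "\<eta> * (vnorm n D)\<^sup>2 \<le> 0.04 * q" .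
  \<comment> \<open>The decrease is \<open>s/2\<close> per unit of \<open>\<eta>\<close>, and
    \<open>\<eta>\<close> is at least \<open>\<mu>/2\<close> because \<open>N\<^sup>2\<close> is at
    most 2; this is the origin of the rate \<open>\<mu>/4\<close>.\<close>
  have mueta: "\<mu>/4 \<le> \<eta> * 0.5"
  proof -
    have "N\<^sup>2 > 0" using N2 by linarith
    moreover have "\<mu> * N\<^sup>2 \<le> \<mu> * 2" using N2 mu by (intro mult_left_mono) auto
    ultimately show ?thesis unfolding \<eta>_def by (simp add: field_simps)
  qed
  have "Re (cip n h (\<lambda>j. of_real \<eta> * D j)) = \<eta> * Re (cip n h D)" by (simp add: cip_scale_right)
  moreover have "(vnorm n (\<lambda>j. of_real \<eta> * D j))\<^sup>2 = \<eta> * (\<eta> * (vnorm n D)\<^sup>2)"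
    by (simp add: vnorm_scale power_mult_distrib power2_eq_square)
  ultimately have "(vnorm n (\<lambda>j. h j - of_real \<eta> * D j))\<^sup>2 = s - \<eta> * (2 * Re (cip n h D) - \<eta> * (vnorm n D)\<^sup>2)"
    unfolding vnorm_diff_sq s_def by (simp add: algebra_simps)
  also have "\<dots> \<le> s - \<eta> * (0.5 * s)"
    using main g3 eta unfolding g1 by simp
  also have "\<dots> \<le> s - \<mu>/4 * s"
    using mult_right_mono[OF mueta, of s] by (simp add: s_def)
  also have "\<dots> = (1 - \<mu>/4) * s" by (simp add: left_diff_distrib)
  finally show ?thesis unfolding \<eta>_def D_def s_def .
qed

section \<open>Distance modulo phase and spectral initialization\<close>

lemma vnorm_add_sq:
  "(vnorm n (\<lambda>j. u j + v j))\<^sup>2 = (vnorm n u)\<^sup>2 + (vnorm n v)\<^sup>2 + 2 * Re (cip n v u)"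
proof -
  have "Re (cip n v u) = Re (cip n u v)"
    using cnj_cip[of n u v] by (metis cnj.simps(1))
  then show ?thesis
    by (simp add: vnorm_sq_cip cip_add_left cip_add_right)
qed

lemma vnorm_phase_diff_sq:
  "(vnorm n (\<lambda>j. z j - cis \<psi> * x j))\<^sup>2 = (vnorm n z)\<^sup>2 + (vnorm n x)\<^sup>2 - 2 * Re (cip n (\<lambda>j. cis \<psi> * x j) z)"
  unfolding vnorm_minus_commute[of n z] vnorm_diff_sq by (simp add: vnorm_scale)

text \<open>Only the cross term of the squared distance depends on the phase. Its real part is at
  most |x^*z|, with equality when the rotated product is real and nonnegative.\<close>

lemma vnorm_phase_diff_minimal:
  assumes "cip n (\<lambda>j. cis \<phi> * x j) z = of_real (cmod (cip n x z))"
  shows "vnorm n (\<lambda>j. z j - cis \<phi> * x j) \<le> vnorm n (\<lambda>j. z j - cis \<psi> * x j)"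
proof (rule power2_le_imp_le)
  have "Re (cip n (\<lambda>j. cis \<psi> * x j) z) \<le> cmod (cip n (\<lambda>j. cis \<psi> * x j) z)" by (rule complex_Re_le_cmod)
  also have "\<dots> = cmod (cip n x z)" by (simp add: cip_scale_left norm_mult)
  finally show "(vnorm n (\<lambda>j. z j - cis \<phi> * x j))\<^sup>2 \<le> (vnorm n (\<lambda>j. z j - cis \<psi> * x j))\<^sup>2"
    unfolding vnorm_phase_diff_sq assms by simp
qed simp

text \<open>The argument of x^*z, taken with values in [0, 2 pi), turns the infimum into a minimum.
  The last property is what makes the imaginary part in \<open>descent_step\<close> vanish.\<close>

lemma pdist_attained:
  obtains \<phi> where "\<phi> \<in> {0..2*pi}" "pdist n z x = vnorm n (\<lambda>j. z j - cis \<phi> * x j)"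
    "cip n (\<lambda>j. cis \<phi> * x j) z = of_real (cmod (cip n x z))"
proof -
  define \<phi> where "\<phi> = Arg2pi (cip n x z)"
  have \<phi>: "\<phi> \<in> {0..2*pi}"
    unfolding \<phi>_def using Arg2pi_ge_0[of "cip n x z"] Arg2pi_lt_2pi[of "cip n x z"] by simp
  have polar: "cip n x z = of_real (cmod (cip n x z)) * cis \<phi>"
    unfolding \<phi>_def cis_conv_exp by (subst Arg2pi_eq) (simp add: mult.commute)
  have c: "cip n (\<lambda>j. cis \<phi> * x j) z = of_real (cmod (cip n x z))"
    unfolding cip_scale_left by (subst polar) (simp add: cis_cnj cis_mult)
  have "pdist n z x = vnorm n (\<lambda>j. z j - cis \<phi> * x j)"
    unfolding pdist_def by (rule cInf_eq_minimum) (use vnorm_phase_diff_minimal[OF c] \<phi> in auto)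
  with that \<phi> c show ?thesis by blast
qed

lemma pdist_le: "pdist n z x \<le> vnorm n (\<lambda>j. z j - cis \<psi> * x j)"
  by (metis pdist_attained vnorm_phase_diff_minimal)

lemma pdist_sq: "(pdist n z x)\<^sup>2 = (vnorm n z)\<^sup>2 + (vnorm n x)\<^sup>2 - 2 * cmod (cip n x z)"
proof -
  obtain \<phi> where \<phi>: "pdist n z x = vnorm n (\<lambda>j. z j - cis \<phi> * x j)"
    "cip n (\<lambda>j. cis \<phi> * x j) z = of_real (cmod (cip n x z))" by (rule pdist_attained)
  show ?thesis unfolding \<phi>(1) vnorm_phase_diff_sq \<phi>(2) by simp
qed

lemma pdist_nonneg: "0 \<le> pdist n z x"
  by (metis pdist_attained vnorm_nonneg)

text \<open>Exactly the hypotheses \<open>Y\<close>, \<open>S\<close> and \<open>L\<close> of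
  \<open>descent_step\<close>. The condition on the imaginary part excludes the direction i x, in
  which a change of phase moves x.\<close>

definition regular_samples :: "nat \<Rightarrow> nat \<Rightarrow> (nat \<times> nat \<times> nat \<Rightarrow> real) \<Rightarrow> (nat \<Rightarrow> complex) \<Rightarrow> real \<Rightarrow> bool" where
  "regular_samples m n \<omega> x K \<longleftrightarrow>
     (\<forall>v. Yform m n \<omega> x v \<le> 2.1 * (vnorm n v)\<^sup>2) \<and>
     (\<forall>v w. avg m (\<lambda>r. (cmod (az n \<omega> r v))\<^sup>2 * (cmod (az n \<omega> r w))\<^sup>2) \<le> K * real n * (vnorm n v)\<^sup>2 * (vnorm n w)\<^sup>2) \<and>
     (\<forall>g \<sigma>. vnorm n g = 1 \<longrightarrow> Im (cip n x g) = 0 \<longrightarrow> 0 \<le> \<sigma> \<longrightarrow> \<sigma> \<le> 1/8 \<longrightarrow>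
       0.9 \<le> avg m (\<lambda>r. (3/2 * Re (cnj (az n \<omega> r g) * az n \<omega> r x) + \<sigma> * (cmod (az n \<omega> r g))\<^sup>2)\<^sup>2))"

text \<open>For a unit signal the expected values are 1 + |x^*v|^2 for the form at a unit v, hence 2
  at x, and 1 for the mean measurement. The tolerances are dictated by
  \<open>spectral_init_unit\<close>.\<close>

definition init_samples :: "nat \<Rightarrow> nat \<Rightarrow> (nat \<times> nat \<times> nat \<Rightarrow> real) \<Rightarrow> (nat \<Rightarrow> complex) \<Rightarrow> bool" where
  "init_samples m n \<omega> x \<longleftrightarrow>
     (\<forall>v. vnorm n v = 1 \<longrightarrow> Yform m n \<omega> x v \<le> 1 + (cmod (cip n x v))\<^sup>2 + 0.01) \<and>
     1.997 \<le> Yform m n \<omega> x x \<and> 0.999 \<le> avg m (meas n \<omega> x) \<and> avg m (meas n \<omega> x) \<le> 1.001"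

text \<open>Every step is normalized by the norm of the starting point, which lies in [7/8, 9/8];
  the optimal phase is chosen anew at each iterate.\<close>

lemma wf_iter_converges_unit:
  assumes x1: "vnorm n x = 1" and n: "n > 0"
    and reg: "regular_samples m n \<omega> x K"
    and K: "K > 0" and mu: "0 < \<mu>" "\<mu> \<le> 1 / (50 * K * real n)" "\<mu> \<le> 1"
    and z0: "pdist n z0 x \<le> 1/8"
  shows "pdist n (wf_iter m n \<omega> x \<mu> z0 \<tau>) x \<le> 1/8 * (1 - \<mu>/4) powr (real \<tau> / 2)"
proof -
  define N where "N = vnorm n z0"
  have "7/8 \<le> N \<and> N \<le> 9/8"
  proof -
    obtain \<phi> where \<phi>: "pdist n z0 x = vnorm n (\<lambda>j. z0 j - cis \<phi> * x j)" by (rule pdist_attained)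
    have "vnorm n z0 \<le> vnorm n (\<lambda>j. cis \<phi> * x j) + vnorm n (\<lambda>j. z0 j - cis \<phi> * x j)"
      by (rule vnorm_diff_triangle)
    moreover have "vnorm n (\<lambda>j. cis \<phi> * x j) \<le> vnorm n z0 + vnorm n (\<lambda>j. cis \<phi> * x j - z0 j)"
      by (rule vnorm_diff_triangle)
    ultimately show ?thesis using z0 x1
      unfolding N_def \<phi> vnorm_minus_commute[of n "\<lambda>j. cis \<phi> * x j"] by (simp add: vnorm_scale)
  qed
  then have N: "7/8 \<le> N" "N \<le> 9/8" by auto
  let ?z = "wf_iter m n \<omega> x \<mu> z0"
  have rho: "0 < 1 - \<mu>/4" "1 - \<mu>/4 \<le> 1" using mu by auto
  have step: "(pdist n (?z (Suc t)) x)\<^sup>2 \<le> (1 - \<mu>/4) * (pdist n (?z t) x)\<^sup>2" if "pdist n (?z t) x \<le> 1/8" for t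
  proof -
    obtain \<phi> where \<phi>: "pdist n (?z t) x = vnorm n (\<lambda>j. ?z t j - cis \<phi> * x j)"
      "cip n (\<lambda>j. cis \<phi> * x j) (?z t) = of_real (cmod (cip n x (?z t)))" by (rule pdist_attained)
    define h where "h = (\<lambda>j. ?z t j - cis \<phi> * x j)"
    have "Im (cip n (\<lambda>j. cis \<phi> * x j) h) = 0"
      unfolding h_def cip_diff_right \<phi>(2) cip_self by simp
    moreover have "vnorm n h \<le> 1/8" using that \<phi>(1) h_def by simp
    ultimately have contr: "(vnorm n (\<lambda>j. h j - of_real (\<mu> / N\<^sup>2) * wgrad m n \<omega> x (?z t) j))\<^sup>2 \<le> (1 - \<mu>/4) * (vnorm n h)\<^sup>2"
      using reg unfolding regular_samples_def
      by (intro descent_step[OF x1 n _ _ _ h_def _ _ K mu(1,2) N]) auto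
    \<comment> \<open>The phase that is optimal for the current iterate is merely a candidate for
      the next one, which suffices for an upper bound.\<close>
    have "pdist n (?z (Suc t)) x \<le> vnorm n (\<lambda>j. h j - of_real (\<mu> / N\<^sup>2) * wgrad m n \<omega> x (?z t) j)"
    proof -
      have "(\<lambda>j. h j - of_real (\<mu> / N\<^sup>2) * wgrad m n \<omega> x (?z t) j) = (\<lambda>j. ?z (Suc t) j - cis \<phi> * x j)"
        unfolding h_def N_def wf_iter.simps by (intro ext) simp
      then show ?thesis by (simp only: pdist_le)
    qed
    from power_mono[OF this pdist_nonneg, of 2]
    have "(pdist n (?z (Suc t)) x)\<^sup>2 \<le> (vnorm n (\<lambda>j. h j - of_real (\<mu> / N\<^sup>2) * wgrad m n \<omega> x (?z t) j))\<^sup>2"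
      .
    also note contr
    finally show ?thesis unfolding \<phi>(1) h_def .
  qed
  \<comment> \<open>The radius 1/8 is carried along because the contraction holds only inside that
    ball; squares keep half-integer powers out of the induction.\<close>
  have "(pdist n (?z t) x)\<^sup>2 \<le> (1/8)\<^sup>2 * (1 - \<mu>/4) ^ t \<and> pdist n (?z t) x \<le> 1/8" for t
  proof (induction t)
    case (Suc t)
    have "(pdist n (?z (Suc t)) x)\<^sup>2 \<le> (1 - \<mu>/4) * (pdist n (?z t) x)\<^sup>2"
      using step Suc by blast
    also have "\<dots> \<le> (1 - \<mu>/4) * ((1/8)\<^sup>2 * (1 - \<mu>/4) ^ t)"
      using Suc rho by (intro mult_left_mono) auto
    finally have 1: "(pdist n (?z (Suc t)) x)\<^sup>2 \<le> (1/8)\<^sup>2 * (1 - \<mu>/4) ^ Suc t" by (simp only: power_Suc mult_ac)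
    also have "\<dots> \<le> (1/8)\<^sup>2 * 1" using rho by (intro mult_left_mono power_le_one) auto
    finally have "(pdist n (?z (Suc t)) x)\<^sup>2 \<le> (1/8)\<^sup>2" by (simp only: mult_1_right)
    then have "pdist n (?z (Suc t)) x \<le> 1/8" by (rule power2_le_imp_le) simp
    with 1 show ?case by blast
  qed (use z0 power_mono[OF z0 pdist_nonneg, of 2] in simp)
  then have "(pdist n (?z \<tau>) x)\<^sup>2 \<le> (1/8)\<^sup>2 * (1 - \<mu>/4) ^ \<tau>" by blast
  also have "\<dots> = (1/8 * (1 - \<mu>/4) powr (real \<tau> / 2))\<^sup>2"
  proof -
    have "((1 - \<mu>/4) powr (real \<tau> / 2))\<^sup>2 = (1 - \<mu>/4) ^ \<tau>"
      using rho by (simp add: power2_eq_square powr_add[symmetric] powr_realpow)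
    then show ?thesis by (simp only: power_mult_distrib)
  qed
  finally show ?thesis by (rule power2_le_imp_le) simp
qed

section \<open>Homogeneity: reduction to a unit signal\<close>

lemma pdist_scale:
  assumes "c > 0" shows "pdist n (\<lambda>j. of_real c * z j) (\<lambda>j. of_real c * x j) = c * pdist n z x"
proof (rule power2_eq_imp_eq)
  have "cmod (cip n (\<lambda>j. of_real c * x j) (\<lambda>j. of_real c * z j)) = c\<^sup>2 * cmod (cip n x z)"
    using assms by (simp add: cip_scale_left cip_scale_right norm_mult power2_eq_square)
  then show "(pdist n (\<lambda>j. of_real c * z j) (\<lambda>j. of_real c * x j))\<^sup>2 = (c * pdist n z x)\<^sup>2"
    unfolding power_mult_distrib pdist_sq using assms
    by (simp add: vnorm_scale power_mult_distrib algebra_simps)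
qed (use assms pdist_nonneg in auto)

lemma meas_scale: "meas n \<omega> (\<lambda>j. of_real c * x j) r = c\<^sup>2 * meas n \<omega> x r"
  by (simp add: meas_def az_scale norm_mult power_mult_distrib)

lemma wgrad_scale:
  "wgrad m n \<omega> (\<lambda>j. of_real c * x j) (\<lambda>j. of_real c * z j) j = of_real (c ^ 3) * wgrad m n \<omega> x z j"
proof -
  have "complex_of_real ((cmod (of_real c * az n \<omega> r z))\<^sup>2 - c\<^sup>2 * meas n \<omega> x r) * samp \<omega> r j * (of_real c * az n \<omega> r z)
     = of_real (c ^ 3) * (of_real ((cmod (az n \<omega> r z))\<^sup>2 - meas n \<omega> x r) * samp \<omega> r j * az n \<omega> r z)" for r
  proof -
    have "(cmod (of_real c * az n \<omega> r z))\<^sup>2 - c\<^sup>2 * meas n \<omega> x r = c\<^sup>2 * ((cmod (az n \<omega> r z))\<^sup>2 - meas n \<omega> x r)"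
      by (simp add: norm_mult power_mult_distrib algebra_simps)
    then show ?thesis by (simp only: of_real_mult of_real_power power2_eq_square power3_eq_cube mult_ac)
  qed
  then show ?thesis unfolding wgrad_def az_scale meas_scale by (simp only: sum_distrib_left times_divide_eq_right)
qed

text \<open>The gradient has degree 3 and the normalized step size degree -2, so the iteration
  commutes with positive scaling.\<close>

lemma wf_iter_scale:
  assumes "c > 0"
  shows "wf_iter m n \<omega> (\<lambda>j. of_real c * x j) \<mu> (\<lambda>j. of_real c * z0 j) t = (\<lambda>j. of_real c * wf_iter m n \<omega> x \<mu> z0 t j)"
proof (induction t)
  case (Suc t)
  have "vnorm n (\<lambda>j. of_real c * z0 j) = c * vnorm n z0" using assms by (simp add: vnorm_scale)
  moreover have "complex_of_real (\<mu> / (c * N)\<^sup>2) * (of_real (c ^ 3) * w) = of_real c * (of_real (\<mu> / N\<^sup>2) * w)" for N w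
    \<comment> \<open>For \<open>N = 0\<close> both sides vanish, division by zero being
      zero.\<close>
    using assms by (cases "N = 0") (simp_all add: field_simps power2_eq_square power3_eq_cube)
  ultimately show ?case
    by (simp only: wf_iter.simps Suc wgrad_scale right_diff_distrib)
qed simp

lemma Ymat_scale: "Ymat m n \<omega> (\<lambda>j. of_real c * x j) j k = of_real (c\<^sup>2) * Ymat m n \<omega> x j k"
  by (simp add: Ymat_def meas_scale sum_distrib_left mult_ac)

text \<open>All eigenvalues are multiplied by c^2 > 0, which preserves the order of their real
  parts.\<close>

lemma leading_eigvec_Ymat_scale:
  assumes "leading_eigvec n (Ymat m n \<omega> (\<lambda>j. of_real c * x j)) v" "c > 0"
  shows "leading_eigvec n (Ymat m n \<omega> x) v"
proof -
  have mv: "mat_vec n (Ymat m n \<omega> (\<lambda>j. of_real c * x j)) w j = of_real (c\<^sup>2) * mat_vec n (Ymat m n \<omega> x) w j" for w j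
    by (simp add: mat_vec_def Ymat_scale sum_distrib_left mult_ac)
  obtain lam where lam: "\<forall>j<n. of_real (c\<^sup>2) * mat_vec n (Ymat m n \<omega> x) v j = lam * v j"
    "\<forall>\<mu> w. (\<exists>j<n. w j \<noteq> 0) \<and> (\<forall>j<n. of_real (c\<^sup>2) * mat_vec n (Ymat m n \<omega> x) w j = \<mu> * w j) \<longrightarrow> Re \<mu> \<le> Re lam"
    using assms(1) unfolding leading_eigvec_def mv by blast
  have "\<forall>j<n. mat_vec n (Ymat m n \<omega> x) v j = lam / of_real (c\<^sup>2) * v j"
    using lam(1) assms(2) by (simp add: field_simps)
  moreover have "Re \<mu> \<le> Re (lam / of_real (c\<^sup>2))"
    if "\<exists>j<n. w j \<noteq> 0" "\<forall>j<n. mat_vec n (Ymat m n \<omega> x) w j = \<mu> * w j" for \<mu> w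
  proof -
    have "Re (of_real (c\<^sup>2) * \<mu>) \<le> Re lam"
      using that by (intro lam(2)[rule_format, of w] conjI) auto
    then show ?thesis using assms(2) unfolding Re_divide_of_real by (simp add: field_simps)
  qed
  ultimately show ?thesis
    using assms(1) unfolding leading_eigvec_def by blast
qed

section \<open>The Rayleigh quotient of the spectral matrix\<close>

lemma cip_Ymat:
  "cip n w (mat_vec n (Ymat m n \<omega> x) v) = (\<Sum>r<m. of_real (meas n \<omega> x r) * (cnj (az n \<omega> r w) * az n \<omega> r v)) / of_nat m"
proof -
  have mv: "mat_vec n (Ymat m n \<omega> x) v j = (\<Sum>r<m. of_real (meas n \<omega> x r) * samp \<omega> r j * az n \<omega> r v) / of_nat m" for j
    unfolding mat_vec_def Ymat_def az_def
    by (simp add: sum_divide_distrib sum_distrib_left sum_distrib_right mult_ac) (rule sum.swap)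
  have "cip n w (mat_vec n (Ymat m n \<omega> x) v)
     = (\<Sum>j<n. \<Sum>r<m. of_real (meas n \<omega> x r) * (cnj (w j) * samp \<omega> r j) * az n \<omega> r v) / of_nat m"
    unfolding cip_def mv by (simp add: sum_divide_distrib sum_distrib_left mult_ac)
  also have "\<dots> = (\<Sum>r<m. of_real (meas n \<omega> x r) * (\<Sum>j<n. cnj (w j) * samp \<omega> r j) * az n \<omega> r v) / of_nat m"
    by (subst sum.swap) (simp add: sum_distrib_left sum_distrib_right)
  also have "(\<Sum>r<m. of_real (meas n \<omega> x r) * (\<Sum>j<n. cnj (w j) * samp \<omega> r j) * az n \<omega> r v) =
     (\<Sum>r<m. of_real (meas n \<omega> x r) * (cnj (az n \<omega> r w) * az n \<omega> r v))"
    unfolding az_eq_cip by (simp add: cip_def mult.commute mult.left_commute)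
  finally show ?thesis .
qed

lemma Re_cip_Ymat: "Re (cip n v (mat_vec n (Ymat m n \<omega> x) v)) = Yform m n \<omega> x v"
proof -
  have "Re (cnj a * a) = (cmod a)\<^sup>2" for a
    unfolding cmod_power2 by (simp add: power2_eq_square)
  then show ?thesis unfolding cip_Ymat Re_sum_avg Yform_def by simp
qed

lemma Yform_scale: "Yform m n \<omega> x (\<lambda>j. c * v j) = (cmod c)\<^sup>2 * Yform m n \<omega> x v"
  by (simp add: Yform_def az_scale norm_mult power_mult_distrib avg_cmult[symmetric] mult_ac)

lemma Yform_vnorm_0: "vnorm n v = 0 \<Longrightarrow> Yform m n \<omega> x v = 0"
  using vnorm_eq_0D[of n v] by (simp add: Yform_def az_def avg_def)

lemma continuous_on_coord: "continuous_on S (\<lambda>v::nat \<Rightarrow> complex. v j)"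
  by (rule continuous_on_subset[OF continuous_on_product_coordinates]) auto

text \<open>Coordinates from n on are invisible to \<open>vnorm\<close>; fixing them to 0 makes the
  sphere a closed subset of a product of disks and points, which is compact in the product
  topology.\<close>

lemma compact_unit_sphere: "compact {v. vnorm n v = 1 \<and> (\<forall>j\<ge>n. v j = 0)}"
proof -
  let ?B = "PiE UNIV (\<lambda>j. if j < n then cball (0::complex) 1 else {0})"
  have "compactin (product_topology (\<lambda>i. euclidean) UNIV) ?B"
    unfolding compactin_PiE by (auto simp: compact_cball)
  then have "compact ?B" by (simp add: euclidean_product_topology)
  moreover have "closed {v. vnorm n v = 1}"
    unfolding vnorm_def by (intro closed_Collect_eq continuous_intros continuous_on_coord)
  ultimately have "compact (?B \<inter> {v. vnorm n v = 1})" by (rule compact_Int_closed)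
  moreover have "?B \<inter> {v. vnorm n v = 1} = {v. vnorm n v = 1 \<and> (\<forall>j\<ge>n. v j = 0)}"
  proof -
    have "cmod (v j) \<le> 1" if "vnorm n v = 1" "j < n" for v j
    proof -
      have "(cmod (v j))\<^sup>2 \<le> (vnorm n v)\<^sup>2"
        unfolding vnorm_sq using that by (intro member_le_sum) auto
      then show ?thesis using that by (simp add: abs_square_le_1)
    qed
    then show ?thesis by (force simp: PiE_iff not_less split: if_splits)
  qed
  ultimately show ?thesis by simp
qed

text \<open>A continuous function attains its supremum on the compact sphere, and homogeneity
  extends the comparison to all vectors. \<open>tr\<close> clears the coordinates that neither the
  norm nor the form sees.\<close>

lemma Rayleigh_maximizer:
  assumes "vnorm n x0 = 1"
  obtains v where "vnorm n v = 1" "\<And>w. Yform m n \<omega> x w \<le> Yform m n \<omega> x v * (vnorm n w)\<^sup>2"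
proof -
  let ?S = "{v. vnorm n v = 1 \<and> (\<forall>j\<ge>n. v j = 0)}"
  define tr :: "(nat \<Rightarrow> complex) \<Rightarrow> nat \<Rightarrow> complex" where "tr w = (\<lambda>j. if j < n then w j else 0)" for w
  have tr: "vnorm n (tr w) = vnorm n w" "Yform m n \<omega> x (tr w) = Yform m n \<omega> x w" for w
    by (auto simp: tr_def Yform_def az_def intro!: vnorm_cong)
  have "tr x0 \<in> ?S" using assms tr by (auto simp: tr_def)
  then have ne: "?S \<noteq> {}" by blast
  have "continuous_on ?S (Yform m n \<omega> x)"
    unfolding Yform_def avg_def az_def by (cases "m = 0") (auto intro!: continuous_intros continuous_on_coord)
  from continuous_attains_sup[OF compact_unit_sphere ne this]
  obtain v where v: "v \<in> ?S" "\<And>w. w \<in> ?S \<Longrightarrow> Yform m n \<omega> x w \<le> Yform m n \<omega> x v" by blast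
  show ?thesis
  proof
    show "vnorm n v = 1" using v(1) by simp
    fix w
    show "Yform m n \<omega> x w \<le> Yform m n \<omega> x v * (vnorm n w)\<^sup>2"
    proof (cases "vnorm n w = 0")
      case True
      then show ?thesis by (simp add: Yform_vnorm_0)
    next
      case False
      then have pos: "vnorm n w > 0" by (simp add: less_le)
      define g where "g = (\<lambda>j. complex_of_real (1 / vnorm n w) * w j)"
      have "vnorm n g = 1" unfolding g_def vnorm_scale using pos by (simp add: norm_divide)
      then have "tr g \<in> ?S" using tr by (auto simp: tr_def)
      from v(2)[OF this] have "Yform m n \<omega> x g \<le> Yform m n \<omega> x v" by (simp add: tr)
      then show ?thesis unfolding g_def Yform_scale using pos by (simp add: norm_divide field_simps)
    qed
  qed
qed

text \<open>Second-order expansion along a line, for the variational argument at a maximizer of the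
  Rayleigh quotient.\<close>

lemma Yform_add:
  "Yform m n \<omega> x (\<lambda>j. v j + of_real s * w j) =
     Yform m n \<omega> x v + 2 * s * Re (cip n w (mat_vec n (Ymat m n \<omega> x) v)) + s\<^sup>2 * Yform m n \<omega> x w"
proof -
  have "meas n \<omega> x r * (cmod (az n \<omega> r v + of_real s * az n \<omega> r w))\<^sup>2
     = meas n \<omega> x r * (cmod (az n \<omega> r v))\<^sup>2 + 2 * s * (meas n \<omega> x r * Re (cnj (az n \<omega> r w) * az n \<omega> r v))
       + s\<^sup>2 * (meas n \<omega> x r * (cmod (az n \<omega> r w))\<^sup>2)" for r
    unfolding cmod_power2 by (simp add: power2_eq_square algebra_simps)
  then show ?thesis
    unfolding Yform_def az_add az_scale cip_Ymat Re_sum_avg by (simp only: avg_add avg_cmult)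
qed

text \<open>\<open>leading_eigvec\<close> compares eigenvalues only, so the maximal Rayleigh
  quotient \<open>\<rho>\<close> must first be recognized as an eigenvalue. Then
  \<open>\<rho>\<close> is at most the real part of the leading one, which is the form at
  \<open>v\<close>.\<close>

lemma leading_eigenvalue_ge_Rayleigh:
  assumes "leading_eigvec n (Ymat m n \<omega> x) v" and w: "vnorm n w = 1"
  shows "Yform m n \<omega> x w \<le> Yform m n \<omega> x v"
proof -
  let ?A = "mat_vec n (Ymat m n \<omega> x)"
  obtain lam where v1: "vnorm n v = 1" and lam: "\<forall>j<n. ?A v j = lam * v j"
    "\<And>\<mu> w. (\<exists>j<n. w j \<noteq> 0) \<Longrightarrow> (\<forall>j<n. ?A w j = \<mu> * w j) \<Longrightarrow> Re \<mu> \<le> Re lam"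
    using assms(1) unfolding leading_eigvec_def by blast
  obtain u where u: "vnorm n u = 1" "\<And>w. Yform m n \<omega> x w \<le> Yform m n \<omega> x u * (vnorm n w)\<^sup>2"
    using Rayleigh_maximizer[OF w] by metis
  define \<rho> where "\<rho> = Yform m n \<omega> x u"
  define d where "d = (\<lambda>j. of_real \<rho> * u j - ?A u j)"
  \<comment> \<open>The form \<open>\<rho> |w|\<^sup>2 - Y(w)\<close> is nonnegative and vanishes at \<open>u\<close>, so its gradient \<open>d\<close> vanishes there.\<close>
  have quad: "0 \<le> 2 * s * (vnorm n d)\<^sup>2 + s\<^sup>2 * (\<rho> * (vnorm n d)\<^sup>2 - Yform m n \<omega> x d)" for s
  proof -
    have "Yform m n \<omega> x (\<lambda>j. u j + of_real s * d j) \<le> \<rho> * (vnorm n (\<lambda>j. u j + of_real s * d j))\<^sup>2"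
      unfolding \<rho>_def by (rule u(2))
    moreover have "(vnorm n (\<lambda>j. u j + of_real s * d j))\<^sup>2 = 1 + 2 * s * Re (cip n d u) + s\<^sup>2 * (vnorm n d)\<^sup>2"
      unfolding vnorm_add_sq using u(1)
      by (simp add: vnorm_scale power_mult_distrib cip_scale_left)
    moreover have "Re (cip n d (?A u)) = \<rho> * Re (cip n d u) - (vnorm n d)\<^sup>2"
    proof -
      have "cip n d d = of_real \<rho> * cip n d u - cip n d (?A u)"
        by (subst (2) d_def) (simp add: cip_diff_right cip_scale_right)
      then show ?thesis using vnorm_sq_cip[of n d] by simp
    qed
    ultimately show ?thesis unfolding Yform_add \<rho>_def[symmetric] by (simp add: algebra_simps)
  qed
  have "vnorm n d = 0"
  proof (rule ccontr)
    assume "vnorm n d \<noteq> 0"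
    then have a: "(vnorm n d)\<^sup>2 > 0" by simp
    \<comment> \<open>\<open>b\<close> is positive and dominates the quadratic coefficient. At the
      negative \<open>s\<close> chosen next, the linear term is twice as large as the bound on the
      quadratic one.\<close>
    define b where "b = \<bar>\<rho> * (vnorm n d)\<^sup>2 - Yform m n \<omega> x d\<bar> + 1"
    define s where "s = - ((vnorm n d)\<^sup>2 / b)"
    have b: "b > 0" unfolding b_def by linarith
    have "s\<^sup>2 * (\<rho> * (vnorm n d)\<^sup>2 - Yform m n \<omega> x d) \<le> s\<^sup>2 * b"
      unfolding b_def by (intro mult_left_mono) auto
    also have "s\<^sup>2 * b = - s * (vnorm n d)\<^sup>2" unfolding s_def using b by (simp add: power2_eq_square)
    finally have "0 \<le> s * (vnorm n d)\<^sup>2" using quad[of s] by linarith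
    moreover have "s < 0" unfolding s_def using a b by simp
    ultimately show False using a by (simp add: zero_le_mult_iff)
  qed
  then have "\<forall>j<n. ?A u j = of_real \<rho> * u j"
    using vnorm_eq_0D[of n d] by (simp add: d_def)
  moreover have "\<exists>j<n. u j \<noteq> 0" using u(1) by (rule_tac ccontr) (simp add: vnorm_def)
  ultimately have "\<rho> \<le> Re lam" using lam(2)[of u "of_real \<rho>"] by simp
  moreover have "Yform m n \<omega> x v = Re lam"
  proof -
    have "cip n v (?A v) = cip n v (\<lambda>j. lam * v j)" using lam(1) by (intro cip_cong) auto
    then show ?thesis using Re_cip_Ymat[of n v m \<omega> x] v1 by (simp add: cip_scale_right cip_self)
  qed
  ultimately show ?thesis using u(2)[of w] w unfolding \<rho>_def by simp
qed

text \<open>Comparison with x gives |x^*v|^2 >= 1.997 - 1.01 = 0.987. The squared distance is then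
  at most 2.001 - 2 * 0.9994 * 0.9934, barely below 1/64.\<close>

lemma spectral_init_unit:
  assumes x1: "vnorm n x = 1" and I: "init_samples m n \<omega> x"
    and v: "leading_eigvec n (Ymat m n \<omega> x) v"
  shows "pdist n (\<lambda>j. of_real (sqrt ((\<Sum>r<m. meas n \<omega> x r) / real m)) * v j) x \<le> 1/8"
proof -
  have v1: "vnorm n v = 1" using v by (simp add: leading_eigvec_def)
  define c where "c = cmod (cip n x v)"
  define l where "l = sqrt (avg m (meas n \<omega> x))"
  have "1.997 \<le> Yform m n \<omega> x x" using I by (simp add: init_samples_def)
  also have "\<dots> \<le> Yform m n \<omega> x v" by (rule leading_eigenvalue_ge_Rayleigh[OF v x1])
  also have "\<dots> \<le> 1 + c\<^sup>2 + 0.01" using I v1 by (simp add: init_samples_def c_def)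
  finally have c2: "0.987 \<le> c\<^sup>2" by (simp add: field_simps)
  have c: "0.9934 \<le> c"
    by (rule power2_le_imp_le) (use c2 in \<open>auto simp: c_def power2_eq_square\<close>)
  have l2: "0.999 \<le> l\<^sup>2" "l\<^sup>2 \<le> 1.001" and l0: "l \<ge> 0"
    using I unfolding init_samples_def l_def by auto
  have l: "0.9994 \<le> l"
    by (rule power2_le_imp_le) (use l2 l0 in \<open>auto simp: power2_eq_square\<close>)
  have "0.9994 * 0.9934 \<le> l * c" using l c by (intro mult_mono) auto
  moreover have "cmod (cip n x (\<lambda>j. of_real l * v j)) = l * c"
    using l0 by (simp add: cip_scale_right norm_mult c_def)
  moreover have "vnorm n (\<lambda>j. of_real l * v j) = l" using l0 v1 by (simp add: vnorm_scale)
  ultimately have "(pdist n (\<lambda>j. of_real l * v j) x)\<^sup>2 \<le> (1/8)\<^sup>2"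
    unfolding pdist_sq using l2 x1 by (simp add: power2_eq_square)
  then have "pdist n (\<lambda>j. of_real l * v j) x \<le> 1/8"
    by (rule power2_le_imp_le) simp
  then show ?thesis by (simp add: l_def avg_def)
qed

section \<open>Nets and uniform bounds\<close>

text \<open>Every counted point has scaled weight at least 1, so the count is dominated by the sum
  of the weights over the whole box, which factors over the coordinates.\<close>

lemma card_le_weighted_prod:
  fixes W :: "'b \<Rightarrow> real"
  assumes C: "finite C" and K: "K \<subseteq> PiE {..<n::nat} (\<lambda>_. C)"
    and W: "\<And>c. c \<in> C \<Longrightarrow> 0 \<le> W c" and A: "A \<ge> 0"
    and wt: "\<And>k. k \<in> K \<Longrightarrow> 1 \<le> A * (\<Prod>j<n. W (k j))"
  shows "real (card K) \<le> A * (\<Sum>c\<in>C. W c) ^ n"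
proof -
  have fin: "finite (PiE {..<n} (\<lambda>_. C))" using C by (intro finite_PiE) auto
  have "real (card K) = (\<Sum>k\<in>K. 1)" by simp
  also have "\<dots> \<le> (\<Sum>k\<in>K. A * (\<Prod>j<n. W (k j)))" by (intro sum_mono wt)
  also have "\<dots> \<le> (\<Sum>k\<in>PiE {..<n} (\<lambda>_. C). A * (\<Prod>j<n. W (k j)))"
  proof (intro sum_mono2 fin K)
    fix k assume "k \<in> PiE {..<n} (\<lambda>_. C) - K"
    then show "0 \<le> A * (\<Prod>j<n. W (k j))"
      using A W by (intro mult_nonneg_nonneg prod_nonneg) (auto simp: PiE_mem)
  qed
  also have "\<dots> = A * (\<Prod>j<n. \<Sum>c\<in>C. W c)"
    unfolding sum_distrib_left[symmetric] using C by (subst prod_sum_PiE) auto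
  finally show ?thesis by simp
qed

text \<open>Rounding toward zero keeps grid points inside the unit ball, at the price of an error up
  to 1 instead of 1/2.\<close>

definition round0 :: "real \<Rightarrow> int" where
  "round0 y = (if 0 \<le> y then \<lfloor>y\<rfloor> else - \<lfloor>- y\<rfloor>)"

lemma round0_abs_le: "\<bar>real_of_int (round0 y)\<bar> \<le> \<bar>y\<bar>"
  and round0_dist: "\<bar>y - real_of_int (round0 y)\<bar> \<le> 1"
proof -
  have a: "0 \<le> real_of_int \<lfloor>z\<rfloor>" "real_of_int \<lfloor>z\<rfloor> \<le> z" "z - real_of_int \<lfloor>z\<rfloor> \<le> 1" if "0 \<le> z" for z :: real
    using that by (simp, linarith+)
  show "\<bar>real_of_int (round0 y)\<bar> \<le> \<bar>y\<bar>"
    using a[of y] a[of "-y"] by (cases "0 \<le> y") (auto simp: round0_def)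
  show "\<bar>y - real_of_int (round0 y)\<bar> \<le> 1"
    unfolding round0_def abs_le_iff
    using of_int_floor_le[of y] of_int_floor_le[of "-y"] real_of_int_floor_add_one_ge[of y] real_of_int_floor_add_one_ge[of "-y"]
    by (cases "0 \<le> y") (simp_all only: if_True if_False of_int_minus, linarith+)
qed

text \<open>The full two-sided geometric series has sum 3; this yields the factor 9 = 3 * 3 per
  complex coordinate in \<open>net_exists\<close>.\<close>

lemma sum_half_power_abs: "(\<Sum>a\<in>{- int D..int D}. (1/2) ^ nat \<bar>a\<bar>) \<le> (3::real)"
proof -
  have "(\<Sum>a\<in>{- int D..int D}. (1/2) ^ nat \<bar>a\<bar>) = 3 - 2 * (1/2::real) ^ D"
  proof (induction D)
    case (Suc D)
    have "{- int (Suc D)..int (Suc D)} = insert (int (Suc D)) (insert (- int (Suc D)) {- int D..int D})"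
      by auto
    then show ?case by (simp add: Suc nat_add_distrib)
  qed simp
  then show ?thesis by simp
qed

text \<open>The net consists of the points of a grid of mesh \<open>\<delta>\<close> in the unit
  ball. The first count, by the bounding box, suits very small \<open>\<delta>\<close>; at
  \<open>\<delta>\<close> of order 1/sqrt n it would cost a factor n^n, whereas the second count is
  then merely exponential in n.\<close>

lemma net_exists:
  fixes \<delta> :: real
  assumes d: "\<delta> > 0"
  obtains N where "finite N" "\<And>v. v \<in> N \<Longrightarrow> vnorm n v \<le> 1"
    "\<And>v. vnorm n v \<le> 1 \<Longrightarrow> \<exists>v'\<in>N. vnorm n (\<lambda>j. v j - v' j) \<le> \<delta> * sqrt (2 * real n)"
    "real (card N) \<le> (2 / \<delta> + 1) ^ (2 * n)"
    "real (card N) \<le> 2 powr (1 / \<delta>\<^sup>2) * 9 ^ n"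
proof -
  define D where "D = nat \<lfloor>1 / \<delta>\<rfloor>"
  define C where "C = {- int D..int D} \<times> {- int D..int D}"
  define lat where "lat k = (\<lambda>j. of_real \<delta> * Complex (real_of_int (fst (k j))) (real_of_int (snd (k j))))" for k :: "nat \<Rightarrow> int \<times> int"
  define K where "K = {k \<in> PiE {..<n} (\<lambda>_. C). vnorm n (lat k) \<le> 1}"
  have Dle: "real D \<le> 1 / \<delta>" unfolding D_def using d by simp
  have finC: "finite C" by (simp add: C_def)
  have finK: "finite K" unfolding K_def
    by (rule finite_subset[of _ "PiE {..<n} (\<lambda>_. C)"]) (use finC in \<open>auto intro: finite_PiE\<close>)
  have cardN: "real (card (lat ` K)) \<le> real (card K)" using card_image_le[OF finK] by simp
  show ?thesis
  proof (rule that[of "lat ` K"])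
    show "finite (lat ` K)" using finK by simp
    show "vnorm n v \<le> 1" if "v \<in> lat ` K" for v using that by (auto simp: K_def)
    show "\<exists>v'\<in>lat ` K. vnorm n (\<lambda>j. v j - v' j) \<le> \<delta> * sqrt (2 * real n)" if v: "vnorm n v \<le> 1" for v
    proof -
      define k where "k = (\<lambda>j. if j < n then (round0 (Re (v j) / \<delta>), round0 (Im (v j) / \<delta>)) else undefined)"
      have s1: "(cmod (lat k j))\<^sup>2 \<le> (cmod (v j))\<^sup>2" and s2: "(cmod (v j - lat k j))\<^sup>2 \<le> 2 * \<delta>\<^sup>2"
        and s3: "k j \<in> C" if "j < n" for j
      proof -
        have ab: "\<bar>\<delta> * real_of_int (round0 (y / \<delta>))\<bar> \<le> \<bar>y\<bar>" "\<bar>y - \<delta> * real_of_int (round0 (y / \<delta>))\<bar> \<le> \<delta>" for y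
        proof -
          have "\<delta> * \<bar>real_of_int (round0 (y / \<delta>))\<bar> \<le> \<delta> * \<bar>y / \<delta>\<bar>"
            using d by (intro mult_left_mono round0_abs_le) auto
          then show "\<bar>\<delta> * real_of_int (round0 (y / \<delta>))\<bar> \<le> \<bar>y\<bar>" using d by (simp add: abs_mult)
          have "\<delta> * \<bar>y / \<delta> - real_of_int (round0 (y / \<delta>))\<bar> \<le> \<delta> * 1"
            using d by (intro mult_left_mono round0_dist) auto
          moreover have "\<delta> * \<bar>y / \<delta> - real_of_int (round0 (y / \<delta>))\<bar> = \<bar>\<delta> * (y / \<delta> - real_of_int (round0 (y / \<delta>)))\<bar>"
            using d by (simp add: abs_mult)
          ultimately show "\<bar>y - \<delta> * real_of_int (round0 (y / \<delta>))\<bar> \<le> \<delta>" using d by (simp add: right_diff_distrib)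
        qed
        have re: "Re (lat k j) = \<delta> * real_of_int (round0 (Re (v j) / \<delta>))" and im: "Im (lat k j) = \<delta> * real_of_int (round0 (Im (v j) / \<delta>))"
          using that by (auto simp: lat_def k_def)
        show "(cmod (lat k j))\<^sup>2 \<le> (cmod (v j))\<^sup>2"
          unfolding cmod_power2 re im using ab(1) by (intro add_mono) (simp_all only: abs_le_square_iff)
        have "\<bar>Re (v j - lat k j)\<bar> \<le> \<delta>" "\<bar>Im (v j - lat k j)\<bar> \<le> \<delta>"
          unfolding minus_complex.sel re im using ab(2) by auto
        then have "(Re (v j - lat k j))\<^sup>2 \<le> \<delta>\<^sup>2" "(Im (v j - lat k j))\<^sup>2 \<le> \<delta>\<^sup>2"
          using d by (simp_all only: abs_le_square_iff[symmetric] abs_of_pos)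
        then show "(cmod (v j - lat k j))\<^sup>2 \<le> 2 * \<delta>\<^sup>2" unfolding cmod_power2 by simp
        have "(cmod (v j))\<^sup>2 \<le> (vnorm n v)\<^sup>2"
          unfolding vnorm_sq using that by (intro member_le_sum) auto
        also have "\<dots> \<le> 1" using v by (simp add: abs_square_le_1)
        finally have "cmod (v j) \<le> 1" by (simp add: abs_square_le_1)
        then have c1: "\<bar>Re (v j)\<bar> \<le> 1" "\<bar>Im (v j)\<bar> \<le> 1"
          using abs_Re_le_cmod[of "v j"] abs_Im_le_cmod[of "v j"] by linarith+
        have "round0 (y / \<delta>) \<in> {- int D..int D}" if "\<bar>y\<bar> \<le> 1" for y
        proof -
          have "\<bar>real_of_int (round0 (y / \<delta>))\<bar> \<le> \<bar>y / \<delta>\<bar>" by (rule round0_abs_le)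
          also have "\<dots> \<le> 1 / \<delta>" using that d by (simp add: field_simps)
          finally have "real_of_int \<bar>round0 (y / \<delta>)\<bar> \<le> 1 / \<delta>" by simp
          then have "\<bar>round0 (y / \<delta>)\<bar> \<le> \<lfloor>1 / \<delta>\<rfloor>" by (simp only: le_floor_iff)
          moreover have "0 \<le> \<lfloor>1 / \<delta>\<rfloor>" using d by simp
          ultimately show ?thesis unfolding D_def by auto
        qed
        then show "k j \<in> C" using c1 that unfolding C_def k_def by simp
      qed
      have "(vnorm n (lat k))\<^sup>2 \<le> (vnorm n v)\<^sup>2" unfolding vnorm_sq using s1 by (intro sum_mono) auto
      then have "vnorm n (lat k) \<le> 1" using v power2_le_imp_le[of "vnorm n (lat k)" "vnorm n v"] by simp
      moreover have "k \<in> PiE {..<n} (\<lambda>_. C)"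
      proof (rule PiE_I)
        show "k j \<in> C" if "j \<in> {..<n}" for j using that by (intro s3) simp
        show "k j = undefined" if "j \<notin> {..<n}" for j using that by (simp add: k_def)
      qed
      ultimately have "lat k \<in> lat ` K" by (auto simp: K_def)
      moreover have "vnorm n (\<lambda>j. v j - lat k j) \<le> \<delta> * sqrt (2 * real n)"
      proof (rule power2_le_imp_le)
        have "(vnorm n (\<lambda>j. v j - lat k j))\<^sup>2 \<le> (\<Sum>j<n. 2 * \<delta>\<^sup>2)"
          unfolding vnorm_sq using s2 by (intro sum_mono) auto
        then show "(vnorm n (\<lambda>j. v j - lat k j))\<^sup>2 \<le> (\<delta> * sqrt (2 * real n))\<^sup>2"
          by (simp add: power_mult_distrib mult_ac)
      qed (use d in simp)
      ultimately show ?thesis by blast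
    qed
    have "real (card K) \<le> 1 * (\<Sum>c\<in>C. 1) ^ n"
      by (rule card_le_weighted_prod[OF finC]) (auto simp: K_def)
    also have "(\<Sum>c\<in>C. 1::real) = (2 * real D + 1) ^ 2"
      by (simp add: C_def power2_eq_square)
    also have "1 * ((2 * real D + 1) ^ 2) ^ n \<le> (2 / \<delta> + 1) ^ (2 * n)"
      unfolding power_mult[symmetric] mult_1 using Dle by (intro power_mono) auto
    finally show "real (card (lat ` K)) \<le> (2 / \<delta> + 1) ^ (2 * n)" using cardN by linarith
    define R where "R = nat \<lfloor>1 / \<delta>\<^sup>2\<rfloor>"
    \<comment> \<open>A grid point \<open>\<delta> k\<close> of the unit ball has \<open>\<Sum>|k\<^sub>i| \<le> \<Sum>k\<^sub>i\<^sup>2 \<le> 1/\<delta>\<^sup>2\<close>, so the weights \<open>2\<^sup>-\<^sup>|\<^sup>k\<^sup>|\<close> count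
      such points without a volume argument.\<close>
    define W where "W c = (1/2::real) ^ nat \<bar>fst c\<bar> * (1/2) ^ nat \<bar>snd c\<bar>" for c :: "int \<times> int"
    have "real (card K) \<le> 2 ^ R * (\<Sum>c\<in>C. W c) ^ n"
    proof (rule card_le_weighted_prod[OF finC])
      fix k assume k: "k \<in> K"
      define T where "T = (\<Sum>j<n. nat \<bar>fst (k j)\<bar> + nat \<bar>snd (k j)\<bar>)"
      have sq: "real (nat \<bar>a\<bar>) \<le> (real_of_int a)\<^sup>2" for a :: int
      proof -
        have "\<bar>a\<bar> * 1 \<le> \<bar>a\<bar> * \<bar>a\<bar>" 
        proof (cases "a = 0")
          case False
          then have "1 \<le> \<bar>a\<bar>" by linarith
          then show ?thesis by (rule mult_left_mono) simp
        qed simp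
        then have "\<bar>a\<bar> \<le> a\<^sup>2" by (simp add: power2_eq_square)
        then have "real_of_int \<bar>a\<bar> \<le> real_of_int (a\<^sup>2)" by (simp only: of_int_le_iff)
        then show ?thesis by simp
      qed
      have "real T \<le> (\<Sum>j<n. (real_of_int (fst (k j)))\<^sup>2 + (real_of_int (snd (k j)))\<^sup>2)"
        unfolding T_def of_nat_sum of_nat_add by (intro sum_mono add_mono sq)
      also have "\<dots> = (1 / \<delta>\<^sup>2) * (vnorm n (lat k))\<^sup>2"
        unfolding vnorm_sq lat_def cmod_power2 sum_distrib_left
        by (intro sum.cong refl) (use d in \<open>simp add: power_mult_distrib distrib_left\<close>)
      also have "\<dots> \<le> (1 / \<delta>\<^sup>2) * 1"
        using k by (intro mult_left_mono) (auto simp: K_def abs_square_le_1)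
      finally have "T \<le> R" unfolding R_def by (simp add: le_nat_floor)
      have "(\<Prod>j<n. W (k j)) = (1/2) ^ T"
        unfolding W_def T_def by (simp add: power_sum power_add)
      then have "2 ^ R * (\<Prod>j<n. W (k j)) = 2 ^ (R - T)" using \<open>T \<le> R\<close> by (simp add: power_diff power_one_over)
      then show "1 \<le> 2 ^ R * (\<Prod>j<n. W (k j))" by simp
    qed (auto simp: K_def W_def)
    also have "(\<Sum>c\<in>C. W c) = (\<Sum>a\<in>{- int D..int D}. (1/2) ^ nat \<bar>a\<bar>) * (\<Sum>a\<in>{- int D..int D}. (1/2) ^ nat \<bar>a\<bar>)"
      unfolding C_def W_def sum_product sum.cartesian_product by (simp add: case_prod_beta)
    also have "2 ^ R * ((\<Sum>a\<in>{- int D..int D}. (1/2) ^ nat \<bar>a\<bar>) * (\<Sum>a\<in>{- int D..int D}. (1/2) ^ nat \<bar>a\<bar>)) ^ n \<le> 2 ^ R * ((3 * 3) ^ n :: real)"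
      using sum_half_power_abs by (intro mult_left_mono power_mono mult_mono sum_nonneg mult_nonneg_nonneg) auto
    also have "(2::real) ^ R \<le> 2 powr (1 / \<delta>\<^sup>2)"
      unfolding R_def by (subst powr_realpow[symmetric]) (auto intro!: powr_mono)
    finally have "real (card K) \<le> 2 powr (1 / \<delta>\<^sup>2) * (3 * 3) ^ n" by simp
    then show "real (card (lat ` K)) \<le> 2 powr (1 / \<delta>\<^sup>2) * 9 ^ n" using cardN by simp
  qed
qed

section \<open>Weighted quadratic forms and the passage from a net to the sphere\<close>

definition wform :: "nat \<Rightarrow> nat \<Rightarrow> (nat \<times> nat \<times> nat \<Rightarrow> real) \<Rightarrow> (nat \<Rightarrow> real) \<Rightarrow> (nat \<Rightarrow> complex) \<Rightarrow> real" where
  "wform m n \<omega> \<phi> v = avg m (\<lambda>r. \<phi> r * (cmod (az n \<omega> r v))\<^sup>2)"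

lemma wform_nonneg: "(\<And>r. 0 \<le> \<phi> r) \<Longrightarrow> 0 \<le> wform m n \<omega> \<phi> v"
  unfolding wform_def by (intro avg_nonneg) simp

lemma wform_scale: "wform m n \<omega> \<phi> (\<lambda>j. c * v j) = (cmod c)\<^sup>2 * wform m n \<omega> \<phi> v"
  by (simp add: wform_def az_scale norm_mult power_mult_distrib avg_cmult[symmetric] mult_ac)

text \<open>The root of the form is a Euclidean seminorm, that of the entries sqrt (phi_r) |a_r^*v|.
  The weights \<open>meas n \<omega> x\<close> and 1 give \<open>Yform\<close> and the second
  moment.\<close>

lemma sqrt_wform_triangle:
  assumes "\<And>r. 0 \<le> \<phi> r"
  shows "sqrt (wform m n \<omega> \<phi> v) \<le> sqrt (wform m n \<omega> \<phi> v') + sqrt (wform m n \<omega> \<phi> (\<lambda>j. v j - v' j))"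
proof -
  have e: "wform m n \<omega> \<phi> u = avg m (\<lambda>r. (sqrt (\<phi> r) * cmod (az n \<omega> r u))\<^sup>2)" for u
    unfolding wform_def using assms by (simp add: power_mult_distrib)
  have "sqrt (avg m (\<lambda>r. (sqrt (\<phi> r) * cmod (az n \<omega> r v))\<^sup>2)) \<le>
     sqrt (avg m (\<lambda>r. (sqrt (\<phi> r) * cmod (az n \<omega> r v') + sqrt (\<phi> r) * cmod (az n \<omega> r (\<lambda>j. v j - v' j)))\<^sup>2))"
  proof (intro sqrt_avg_mono_abs)
    fix r
    have "cmod (az n \<omega> r v) \<le> cmod (az n \<omega> r v') + cmod (az n \<omega> r (\<lambda>j. v j - v' j))"
      unfolding az_diff by (metis add.commute diff_add_cancel norm_triangle_ineq)
    from mult_left_mono[OF this, of "sqrt (\<phi> r)"]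
    show "\<bar>sqrt (\<phi> r) * cmod (az n \<omega> r v)\<bar> \<le> sqrt (\<phi> r) * cmod (az n \<omega> r v') + sqrt (\<phi> r) * cmod (az n \<omega> r (\<lambda>j. v j - v' j))"
      using assms by (simp add: abs_mult distrib_left)
  qed
  also note sqrt_avg_triangle
  finally show ?thesis unfolding e .
qed

lemma unit_scaling:
  assumes "vnorm n v \<noteq> 0"
  shows "vnorm n (\<lambda>j. complex_of_real (1 / vnorm n v) * v j) = 1"
  unfolding vnorm_scale using assms by (simp add: norm_divide)

lemma wform_le_unit:
  assumes "\<And>v. vnorm n v = 1 \<Longrightarrow> wform m n \<omega> \<phi> v \<le> B"
  shows "wform m n \<omega> \<phi> v \<le> B * (vnorm n v)\<^sup>2"
proof (cases "vnorm n v = 0")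
  case True
  then show ?thesis using vnorm_eq_0D[of n v] by (simp add: wform_def az_def avg_def)
next
  case False
  then have "vnorm n v > 0" by (simp add: less_le)
  then show ?thesis using assms[OF unit_scaling[OF False]]
    unfolding wform_scale by (simp add: norm_divide field_simps power_divide)
qed

text \<open>With \<open>s\<close> the supremum over the sphere, approximation by a net point gives
  \<open>s \<le> B + s * \<epsilon>\<close>, which is solved for \<open>s\<close>.\<close>

lemma wform_net_sup:
  assumes phi: "\<And>r. 0 \<le> \<phi> r" and e: "0 \<le> \<epsilon>" "\<epsilon> < 1"
    and net: "\<And>v. vnorm n v \<le> 1 \<Longrightarrow> \<exists>v'\<in>N. vnorm n (\<lambda>j. v j - v' j) \<le> \<epsilon>"
    and B: "\<And>v'. v' \<in> N \<Longrightarrow> sqrt (wform m n \<omega> \<phi> v') \<le> B"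
    and v: "vnorm n v = 1"
  shows "sqrt (wform m n \<omega> \<phi> v) \<le> B / (1 - \<epsilon>)"
proof -
  let ?F = "\<lambda>v. sqrt (wform m n \<omega> \<phi> v)"
  let ?S = "{v. vnorm n v = 1}"
  define s where "s = (SUP v\<in>?S. ?F v)"
  \<comment> \<open>Absorbing \<open>s * \<epsilon>\<close> requires a finite supremum; any bound,
    even one depending on the samples, will do.\<close>
  have bdd: "bdd_above (?F ` ?S)"
  proof (rule bdd_aboveI2)
    fix v assume v: "v \<in> ?S"
    have "wform m n \<omega> \<phi> v \<le> avg m (\<lambda>r. \<phi> r * (vnorm n (samp \<omega> r))\<^sup>2)"
      unfolding wform_def
    proof (intro avg_mono mult_left_mono phi power_mono)
      show "cmod (az n \<omega> r v) \<le> vnorm n (samp \<omega> r)" for r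
        using cip_Cauchy_Schwarz[of n "samp \<omega> r" v] v by (simp add: az_eq_cip)
    qed auto
    then show "?F v \<le> sqrt (avg m (\<lambda>r. \<phi> r * (vnorm n (samp \<omega> r))\<^sup>2))" by simp
  qed
  have up: "?F v \<le> s" if "vnorm n v = 1" for v
    unfolding s_def using that by (intro cSUP_upper bdd) auto
  then have s0: "0 \<le> s" using v wform_nonneg[OF phi, where m = m and n = n and \<omega> = \<omega> and v = v] by (meson order_trans real_sqrt_ge_zero)
  have up': "?F v \<le> s * vnorm n v" for v
  proof -
    have "wform m n \<omega> \<phi> v \<le> s\<^sup>2 * (vnorm n v)\<^sup>2"
    proof (rule wform_le_unit)
      show "wform m n \<omega> \<phi> v \<le> s\<^sup>2" if "vnorm n v = 1" for v
        using up[OF that] by (rule sqrt_le_D)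
    qed
    then have "?F v \<le> sqrt ((s * vnorm n v)\<^sup>2)" by (simp add: power_mult_distrib)
    then show ?thesis using s0 by simp
  qed
  have "?F v \<le> B + s * \<epsilon>" if v: "vnorm n v = 1" for v
  proof -
    obtain v' where v': "v' \<in> N" "vnorm n (\<lambda>j. v j - v' j) \<le> \<epsilon>" using net[of v] v by auto
    have "?F v \<le> ?F v' + ?F (\<lambda>j. v j - v' j)" by (rule sqrt_wform_triangle[OF phi])
    also have "?F (\<lambda>j. v j - v' j) \<le> s * vnorm n (\<lambda>j. v j - v' j)" by (rule up')
    also have "\<dots> \<le> s * \<epsilon>" using v' s0 by (intro mult_left_mono)
    finally show ?thesis using B[OF v'(1)] by simp
  qed
  then have "s \<le> B + s * \<epsilon>" unfolding s_def using v by (intro cSUP_least) auto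
  then have "s \<le> B / (1 - \<epsilon>)" using e by (simp add: field_simps)
  then show ?thesis using up[OF v] by simp
qed

lemma Yform_wform: "Yform m n \<omega> x v = wform m n \<omega> (meas n \<omega> x) v"
  by (simp add: Yform_def wform_def)

lemma meas_nonneg: "0 \<le> meas n \<omega> x r"
  by (simp add: meas_def)

text \<open>Two passes through the net: crude absorption bounds the form by 4 on the sphere, and
  with this bound the root of the form changes by at most 2/2000 between v and its net point.
  Squaring back costs 1.5/500 + 10^-6.\<close>

lemma Yform_net:
  assumes x1: "vnorm n x = 1"
    and N1: "\<And>v. v \<in> N \<Longrightarrow> vnorm n v \<le> 1"
    and net: "\<And>v. vnorm n v \<le> 1 \<Longrightarrow> \<exists>v'\<in>N. vnorm n (\<lambda>j. v j - v' j) \<le> 1/2000"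
    and B: "\<And>v'. v' \<in> N \<Longrightarrow> Yform m n \<omega> x v' \<le> 1 + (cmod (cip n x v'))\<^sup>2 + 0.002"
    and v: "vnorm n v = 1"
  shows "Yform m n \<omega> x v \<le> 1 + (cmod (cip n x v))\<^sup>2 + 0.01"
proof -
  let ?F = "\<lambda>v. sqrt (Yform m n \<omega> x v)"
  have c1: "cmod (cip n x v) \<le> 1" if "vnorm n v \<le> 1" for v
    using cip_Cauchy_Schwarz[of n x v] that x1 by simp
  have N2: "?F v' \<le> 3/2" if "v' \<in> N" for v'
  proof -
    have "(cmod (cip n x v'))\<^sup>2 \<le> 1" using c1[OF N1[OF that]] by (simp add: abs_square_le_1)
    then have "Yform m n \<omega> x v' \<le> (3/2)\<^sup>2" using B[OF that] by (simp add: power2_eq_square)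
    then show ?thesis by (intro real_le_lsqrt) auto
  qed
  have F2: "?F w \<le> 2" if "vnorm n w = 1" for w
    using wform_net_sup[OF meas_nonneg _ _ net N2[unfolded Yform_wform] that] by (simp add: Yform_wform)
  have Y4: "Yform m n \<omega> x w \<le> 4" if "vnorm n w = 1" for w
    using sqrt_le_D[OF F2[OF that]] by simp
  obtain v' where v': "v' \<in> N" "vnorm n (\<lambda>j. v j - v' j) \<le> 1/2000" using net[of v] v by auto
  define c where "c = cmod (cip n x v)"
  have c: "0 \<le> c" "c \<le> 1" using c1[of v] v by (auto simp: c_def)
  have "cmod (cip n x v') \<le> c + 1/2000"
  proof -
    have "cip n x v' = cip n x v - cip n x (\<lambda>j. v j - v' j)" by (simp add: cip_diff_right)
    then have "cmod (cip n x v') \<le> c + cmod (cip n x (\<lambda>j. v j - v' j))" unfolding c_def by (metis norm_triangle_ineq4)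
    then show ?thesis using cip_Cauchy_Schwarz[of n x "\<lambda>j. v j - v' j"] v'(2) x1 by simp
  qed
  then have "(cmod (cip n x v'))\<^sup>2 \<le> (c + 1/2000)\<^sup>2" by (intro power_mono) auto
  also have "\<dots> \<le> c\<^sup>2 + 0.00101" using c by (simp add: power2_eq_square algebra_simps)
  finally have Yv': "Yform m n \<omega> x v' \<le> 1 + c\<^sup>2 + 0.00301" using B[OF v'(1)] by simp
  have "?F v \<le> ?F v' + ?F (\<lambda>j. v j - v' j)" unfolding Yform_wform by (rule sqrt_wform_triangle[OF meas_nonneg])
  also have "?F (\<lambda>j. v j - v' j) \<le> 1/1000"
  proof -
    have "Yform m n \<omega> x (\<lambda>j. v j - v' j) \<le> 4 * (vnorm n (\<lambda>j. v j - v' j))\<^sup>2"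
      using Y4 unfolding Yform_wform by (intro wform_le_unit) auto
    also have "\<dots> \<le> 4 * (1/2000)\<^sup>2" using v'(2) by (intro mult_left_mono power_mono) auto
    finally have "Yform m n \<omega> x (\<lambda>j. v j - v' j) \<le> (1/1000)\<^sup>2" by (simp add: power2_eq_square)
    then show ?thesis by (intro real_le_lsqrt) auto
  qed
  finally have "?F v \<le> ?F v' + 1/1000" by simp
  then have "(?F v)\<^sup>2 \<le> (?F v' + 1/1000)\<^sup>2"
    by (intro power_mono) (auto simp: Yform_wform intro!: wform_nonneg meas_nonneg)
  moreover have "(?F v)\<^sup>2 = Yform m n \<omega> x v" "(?F v')\<^sup>2 = Yform m n \<omega> x v'"
    by (auto simp: Yform_wform intro!: wform_nonneg meas_nonneg)
  ultimately have "Yform m n \<omega> x v \<le> Yform m n \<omega> x v' + ?F v' / 500 + 1/1000000"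
    by (simp only: power2_sum) (simp add: power2_eq_square)
  then show ?thesis using Yv' N2[OF v'(1)] unfolding c_def by simp
qed

text \<open>Rows with |a_r|^2 at most 8n contribute at most 8n times a second moment, which is at
  most 4; the other rows contribute at most 1 by \<open>tail\<close>. The total is 32n + 1 <=
  33n.\<close>

lemma fourth_moment_from_net:
  assumes n: "n > 0"
    and net: "\<And>v. vnorm n v \<le> 1 \<Longrightarrow> \<exists>v'\<in>N. vnorm n (\<lambda>j. v j - v' j) \<le> 1/2000"
    and B: "\<And>v'. v' \<in> N \<Longrightarrow> avg m (\<lambda>r. (cmod (az n \<omega> r v'))\<^sup>2) \<le> 2"
    and tail: "avg m (\<lambda>r. if (vnorm n (samp \<omega> r))\<^sup>2 > 8 * real n then (vnorm n (samp \<omega> r)) ^ 4 else 0) \<le> 1"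
  shows "avg m (\<lambda>r. (cmod (az n \<omega> r v))\<^sup>2 * (cmod (az n \<omega> r w))\<^sup>2) \<le> 33 * real n * (vnorm n v)\<^sup>2 * (vnorm n w)\<^sup>2"
proof -
  have W: "wform m n \<omega> (\<lambda>_. 1) u = avg m (\<lambda>r. (cmod (az n \<omega> r u))\<^sup>2)" for u by (simp add: wform_def)
  have N2: "sqrt (wform m n \<omega> (\<lambda>_. 1) v') \<le> 3/2" if "v' \<in> N" for v'
  proof -
    have "wform m n \<omega> (\<lambda>_. 1) v' \<le> (3/2)\<^sup>2" using B[OF that] by (simp add: W power2_eq_square)
    then show ?thesis by (intro real_le_lsqrt) auto
  qed
  have 4: "avg m (\<lambda>r. (cmod (az n \<omega> r u))\<^sup>2) \<le> 4" if "vnorm n u = 1" for u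
  proof -
    have "sqrt (wform m n \<omega> (\<lambda>_. 1) u) \<le> 2" using wform_net_sup[OF _ _ _ net N2 that] by simp
    then have "wform m n \<omega> (\<lambda>_. 1) u \<le> 2\<^sup>2" by (rule sqrt_le_D)
    then show ?thesis unfolding W by simp
  qed
  have unit: "avg m (\<lambda>r. (cmod (az n \<omega> r v))\<^sup>2 * (cmod (az n \<omega> r w))\<^sup>2) \<le> 33 * real n"
    if v: "vnorm n v = 1" and w: "vnorm n w = 1" for v w
  proof -
    have "avg m (\<lambda>r. (cmod (az n \<omega> r v))\<^sup>2 * (cmod (az n \<omega> r w))\<^sup>2)
       \<le> avg m (\<lambda>r. 8 * real n * (cmod (az n \<omega> r w))\<^sup>2 + (if (vnorm n (samp \<omega> r))\<^sup>2 > 8 * real n then (vnorm n (samp \<omega> r)) ^ 4 else 0))"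
    proof (intro avg_mono)
      fix r
      let ?a = "vnorm n (samp \<omega> r)"
      have a: "(cmod (az n \<omega> r u))\<^sup>2 \<le> ?a\<^sup>2" if "vnorm n u = 1" for u
        using cip_Cauchy_Schwarz[of n "samp \<omega> r" u] that by (intro power_mono) (auto simp: az_eq_cip)
      show "(cmod (az n \<omega> r v))\<^sup>2 * (cmod (az n \<omega> r w))\<^sup>2 \<le> 8 * real n * (cmod (az n \<omega> r w))\<^sup>2 + (if ?a\<^sup>2 > 8 * real n then ?a ^ 4 else 0)"
      proof (cases "?a\<^sup>2 > 8 * real n")
        case True
        have "(cmod (az n \<omega> r v))\<^sup>2 * (cmod (az n \<omega> r w))\<^sup>2 \<le> ?a\<^sup>2 * ?a\<^sup>2"
          using a v w by (intro mult_mono) auto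
        then have "(cmod (az n \<omega> r v))\<^sup>2 * (cmod (az n \<omega> r w))\<^sup>2 \<le> ?a ^ 4" by (simp add: power_add[symmetric])
        then show ?thesis using True by (simp add: add_increasing)
      next
        case False
        have "(cmod (az n \<omega> r v))\<^sup>2 * (cmod (az n \<omega> r w))\<^sup>2 \<le> 8 * real n * (cmod (az n \<omega> r w))\<^sup>2"
        proof (rule mult_right_mono)
          show "(cmod (az n \<omega> r v))\<^sup>2 \<le> 8 * real n" using a[OF v] False by linarith
        qed simp
        then show ?thesis using False by simp
      qed
    qed
    also have "\<dots> \<le> 8 * real n * 4 + 1"
      unfolding avg_add avg_cmult using 4[OF w] tail by (intro add_mono mult_left_mono) auto
    finally show ?thesis using n by simp
  qed
  show ?thesis
  proof (cases "vnorm n v = 0 \<or> vnorm n w = 0")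
    case True
    then show ?thesis using vnorm_eq_0D[of n v] vnorm_eq_0D[of n w] by (auto simp: az_def avg_def)
  next
    case False
    then have v: "vnorm n v > 0" and w: "vnorm n w > 0" by (auto simp: less_le)
    have sc: "(cmod (az n \<omega> r (\<lambda>j. complex_of_real (1 / vnorm n v) * v j)))\<^sup>2 * (cmod (az n \<omega> r (\<lambda>j. complex_of_real (1 / vnorm n w) * w j)))\<^sup>2
       = 1 / ((vnorm n v)\<^sup>2 * (vnorm n w)\<^sup>2) * ((cmod (az n \<omega> r v))\<^sup>2 * (cmod (az n \<omega> r w))\<^sup>2)" for r
      unfolding az_scale by (simp add: norm_divide power_divide norm_mult power_mult_distrib)
    have "1 / ((vnorm n v)\<^sup>2 * (vnorm n w)\<^sup>2) * avg m (\<lambda>r. (cmod (az n \<omega> r v))\<^sup>2 * (cmod (az n \<omega> r w))\<^sup>2) \<le> 33 * real n"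
      unfolding avg_cmult[symmetric] sc[symmetric] using False by (intro unit unit_scaling) auto
    then show ?thesis using v w by (simp add: field_simps)
  qed
qed

text \<open>Both the direction and the radius \<open>\<sigma>\<close> are discretized. In the L2
  seminorm of averages the errors \<open>e1\<close>, \<open>e2\<close>, \<open>e3\<close> are at
  most 0.001, 0.01 and 0.015, so the bound 1 at the net leaves 0.95^2 > 0.9. Since \<open>S\<close>
  carries a factor n, the mean square of \<open>e3\<close> is of order n times the squared mesh;
  mesh 1/n makes it O(1/n).\<close>

lemma curvature_from_net:
  assumes x1: "vnorm n x = 1" and n: "n \<ge> 10000"
    and N1: "\<And>v. v \<in> N \<Longrightarrow> vnorm n v \<le> 1"
    and net: "\<And>v. vnorm n v \<le> 1 \<Longrightarrow> \<exists>v'\<in>N. vnorm n (\<lambda>j. v j - v' j) \<le> 1 / real n"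
    and Y: "\<And>v. Yform m n \<omega> x v \<le> 2.1 * (vnorm n v)\<^sup>2"
    and S: "\<And>v w. avg m (\<lambda>r. (cmod (az n \<omega> r v))\<^sup>2 * (cmod (az n \<omega> r w))\<^sup>2) \<le> 33 * real n * (vnorm n v)\<^sup>2 * (vnorm n w)\<^sup>2"
    and L: "\<And>g k. g \<in> N \<Longrightarrow> k \<le> n \<Longrightarrow>
       9/8 * (vnorm n g)\<^sup>2 - 9/8 * (Im (cip n x g))\<^sup>2 - 1/24 - 1/100 \<le>
       avg m (\<lambda>r. (3/2 * Re (cnj (az n \<omega> r g) * az n \<omega> r x) + (real k / (8 * real n)) * (cmod (az n \<omega> r g))\<^sup>2)\<^sup>2)"
    and g: "vnorm n g = 1" and im: "Im (cip n x g) = 0" and s: "0 \<le> \<sigma>" "\<sigma> \<le> 1/8"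
  shows "0.9 \<le> avg m (\<lambda>r. (3/2 * Re (cnj (az n \<omega> r g) * az n \<omega> r x) + \<sigma> * (cmod (az n \<omega> r g))\<^sup>2)\<^sup>2)"
proof -
  define p where "p g r = Re (cnj (az n \<omega> r g) * az n \<omega> r x)" for g r
  define t where "t g r = (cmod (az n \<omega> r g))\<^sup>2" for g r
  have npos: "real n > 0" using n by simp
  obtain g' where g': "g' \<in> N" "vnorm n (\<lambda>j. g j - g' j) \<le> 1 / real n" using net[of g] g by auto
  \<comment> \<open>The points k/(8n) with k at most n fill [0, 1/8] with spacing 1/(8n).\<close>
  define k where "k = nat \<lfloor>8 * real n * \<sigma>\<rfloor>"
  define \<sigma>' where "\<sigma>' = real k / (8 * real n)"
  have kn: "k \<le> n"
  proof -
    have "8 * real n * \<sigma> \<le> 8 * real n * (1/8)" using s by (intro mult_left_mono) auto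
    then have "\<lfloor>8 * real n * \<sigma>\<rfloor> \<le> int n" by linarith
    then show ?thesis unfolding k_def by simp
  qed
  have "real k \<le> 8 * real n * \<sigma>" "8 * real n * \<sigma> - 1 \<le> real k"
    unfolding k_def using s npos by auto
  then have sig: "\<bar>\<sigma>' - \<sigma>\<bar> \<le> 1 / (8 * real n)"
  proof -
    have "\<sigma>' - \<sigma> = (real k - 8 * real n * \<sigma>) / (8 * real n)"
      unfolding \<sigma>'_def using npos by (simp add: diff_divide_distrib)
    then show ?thesis using \<open>real k \<le> _\<close> \<open>_ \<le> real k\<close> npos
      by (simp add: abs_divide divide_right_mono)
  qed
  have ninv: "1 / real n \<le> 1/10000" using n by (simp add: field_simps)
  define d where "d = (\<lambda>j. g j - g' j)"
  have d: "vnorm n d \<le> 1 / real n" using g'(2) d_def by simp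
  have d2: "(vnorm n d)\<^sup>2 \<le> (1 / real n)\<^sup>2" using d by (intro power_mono) auto
  have L': "1 \<le> avg m (\<lambda>r. (3/2 * p g' r + \<sigma>' * t g' r)\<^sup>2)"
  proof -
    have "1 \<le> vnorm n g' + vnorm n d" unfolding d_def using vnorm_diff_triangle[of n g g'] g by simp
    then have "0.999 \<le> vnorm n g'" using d ninv by simp
    then have a: "0.999\<^sup>2 \<le> (vnorm n g')\<^sup>2" by (intro power_mono) auto
    \<comment> \<open>Net points miss the phase condition slightly, which is why \<open>L\<close>
      retains the imaginary part.\<close>
    have "Im (cip n x g') = - Im (cip n x d)" unfolding d_def cip_diff_right using im by simp
    then have "\<bar>Im (cip n x g')\<bar> \<le> cmod (cip n x d)" using abs_Im_le_cmod[of "cip n x d"] by simp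
    also have "\<dots> \<le> 1/1000" using cip_Cauchy_Schwarz[of n x d] x1 d ninv by simp
    finally have "\<bar>Im (cip n x g')\<bar>\<^sup>2 \<le> (1/1000)\<^sup>2" by (intro power_mono) auto
    then have b: "(Im (cip n x g'))\<^sup>2 \<le> (1/1000)\<^sup>2" by simp
    show ?thesis using L[OF g'(1) kn] a b unfolding p_def t_def \<sigma>'_def by (simp add: power2_eq_square)
  qed
  define e1 where "e1 r = - (3/2 * p d r)" for r
  define e2 where "e2 r = (\<sigma>' - \<sigma>) * t g' r" for r
  define e3 where "e3 r = \<sigma> * (t g' r - t g r)" for r
  have pd: "p d r = p g r - p g' r" for r
    unfolding p_def d_def az_diff by (simp add: algebra_simps)
  have b1: "sqrt (avg m (\<lambda>r. (e1 r)\<^sup>2)) \<le> 0.001"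
  proof -
    have "avg m (\<lambda>r. (e1 r)\<^sup>2) \<le> avg m (\<lambda>r. 9/4 * (meas n \<omega> x r * (cmod (az n \<omega> r d))\<^sup>2))"
    proof (intro avg_mono)
      fix r
      have "\<bar>p d r\<bar> \<le> cmod (az n \<omega> r x) * cmod (az n \<omega> r d)"
        unfolding p_def using abs_Re_le_cmod[of "cnj (az n \<omega> r d) * az n \<omega> r x"] by (simp add: norm_mult mult.commute)
      then have "\<bar>p d r\<bar>\<^sup>2 \<le> (cmod (az n \<omega> r x) * cmod (az n \<omega> r d))\<^sup>2" by (intro power_mono) auto
      then show "(e1 r)\<^sup>2 \<le> 9/4 * (meas n \<omega> x r * (cmod (az n \<omega> r d))\<^sup>2)"
        by (simp add: e1_def meas_def power_mult_distrib power_divide)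
    qed
    also have "\<dots> = 9/4 * Yform m n \<omega> x d" unfolding avg_cmult Yform_def ..
    also have "\<dots> \<le> 9/4 * (2.1 * (1/10000)\<^sup>2)"
    proof -
      have "(vnorm n d)\<^sup>2 \<le> (1/10000)\<^sup>2" using d ninv by (intro power_mono) auto
      then show ?thesis using Y[of d] by linarith
    qed
    also have "\<dots> \<le> 0.001\<^sup>2" by (simp add: power2_eq_square)
    finally show ?thesis by (intro real_le_lsqrt) auto
  qed
  have b2: "sqrt (avg m (\<lambda>r. (e2 r)\<^sup>2)) \<le> 0.01"
  proof -
    have "avg m (\<lambda>r. (e2 r)\<^sup>2) = (\<sigma>' - \<sigma>)\<^sup>2 * avg m (\<lambda>r. (cmod (az n \<omega> r g'))\<^sup>2 * (cmod (az n \<omega> r g'))\<^sup>2)"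
      unfolding e2_def t_def avg_cmult[symmetric] by (simp add: power2_eq_square mult_ac)
    also have "\<dots> \<le> (1 / (8 * real n))\<^sup>2 * (33 * real n * 1 * 1)"
    proof (intro mult_mono)
      show "(\<sigma>' - \<sigma>)\<^sup>2 \<le> (1 / (8 * real n))\<^sup>2"
        using power_mono[OF sig abs_ge_zero, of 2] by simp
      have "(vnorm n g')\<^sup>2 \<le> 1" using N1[OF g'(1)] by (simp add: abs_square_le_1)
      then have "33 * real n * (vnorm n g')\<^sup>2 * (vnorm n g')\<^sup>2 \<le> 33 * real n * 1 * 1"
        by (intro mult_mono) auto
      then show "avg m (\<lambda>r. (cmod (az n \<omega> r g'))\<^sup>2 * (cmod (az n \<omega> r g'))\<^sup>2) \<le> 33 * real n * 1 * 1"
        using S[of g' g'] by linarith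
    qed (auto intro!: avg_nonneg)
    also have "\<dots> = 33/64 * (1 / real n)" using npos by (simp add: power2_eq_square)
    also have "\<dots> \<le> 0.01\<^sup>2" using ninv by (simp add: power2_eq_square)
    finally show ?thesis by (intro real_le_lsqrt) auto
  qed
  have b3: "sqrt (avg m (\<lambda>r. (e3 r)\<^sup>2)) \<le> 0.015"
  proof -
    have "avg m (\<lambda>r. (e3 r)\<^sup>2) \<le> avg m (\<lambda>r. (1/64) * ((cmod (az n \<omega> r d))\<^sup>2 * (cmod (az n \<omega> r (\<lambda>j. g j + g' j)))\<^sup>2))"
    proof (intro avg_mono)
      fix r
      \<comment> \<open>The polarized difference of squares exposes the small factor
        \<open>d\<close>, so that \<open>S\<close> applies to \<open>d\<close> and
        \<open>g + g'\<close>.\<close>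
      have "t g r - t g' r = Re (cnj (az n \<omega> r d) * az n \<omega> r (\<lambda>j. g j + g' j))"
        unfolding t_def d_def az_diff az_add cmod_power2 by (simp add: power2_eq_square algebra_simps)
      then have "\<bar>t g' r - t g r\<bar> \<le> cmod (az n \<omega> r d) * cmod (az n \<omega> r (\<lambda>j. g j + g' j))"
        using abs_Re_le_cmod[of "cnj (az n \<omega> r d) * az n \<omega> r (\<lambda>j. g j + g' j)"] by (simp add: norm_mult abs_minus_commute)
      then have "\<bar>e3 r\<bar> \<le> 1/8 * (cmod (az n \<omega> r d) * cmod (az n \<omega> r (\<lambda>j. g j + g' j)))"
        unfolding e3_def abs_mult using s by (intro mult_mono) auto
      then have "\<bar>e3 r\<bar>\<^sup>2 \<le> (1/8 * (cmod (az n \<omega> r d) * cmod (az n \<omega> r (\<lambda>j. g j + g' j))))\<^sup>2"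
        by (intro power_mono) auto
      then show "(e3 r)\<^sup>2 \<le> (1/64) * ((cmod (az n \<omega> r d))\<^sup>2 * (cmod (az n \<omega> r (\<lambda>j. g j + g' j)))\<^sup>2)"
        by (simp add: power_mult_distrib power_divide)
    qed
    also have "\<dots> \<le> (1/64) * (33 * real n * (1 / real n)\<^sup>2 * 2\<^sup>2)"
    proof -
      have "vnorm n (\<lambda>j. g j + g' j) \<le> 2" using vnorm_triangle[of n g g'] g N1[OF g'(1)] by simp
      then have "(vnorm n (\<lambda>j. g j + g' j))\<^sup>2 \<le> 2\<^sup>2" by (intro power_mono) auto
      then have "33 * real n * (vnorm n d)\<^sup>2 * (vnorm n (\<lambda>j. g j + g' j))\<^sup>2 \<le> 33 * real n * (1 / real n)\<^sup>2 * 2\<^sup>2"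
        using d2 by (intro mult_mono) auto
      then show ?thesis using S[of d "\<lambda>j. g j + g' j"] unfolding avg_cmult by simp
    qed
    also have "\<dots> = 33/16 * (1 / real n)" using npos by (simp add: power2_eq_square)
    also have "\<dots> \<le> 0.015\<^sup>2" using ninv by (simp add: power2_eq_square)
    finally show ?thesis by (intro real_le_lsqrt) auto
  qed
  define L where "L = avg m (\<lambda>r. (3/2 * p g r + \<sigma> * t g r)\<^sup>2)"
  have split: "3/2 * p g' r + \<sigma>' * t g' r = (3/2 * p g r + \<sigma> * t g r) + (e1 r + (e2 r + e3 r))" for r
    unfolding e1_def e2_def e3_def pd by (simp add: field_simps)
  have "1 \<le> sqrt (avg m (\<lambda>r. (3/2 * p g' r + \<sigma>' * t g' r)\<^sup>2))" using L' by simp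
  also have "\<dots> \<le> sqrt L + sqrt (avg m (\<lambda>r. (e1 r + (e2 r + e3 r))\<^sup>2))"
    unfolding split L_def by (rule sqrt_avg_triangle)
  also have "sqrt (avg m (\<lambda>r. (e1 r + (e2 r + e3 r))\<^sup>2)) \<le> sqrt (avg m (\<lambda>r. (e1 r)\<^sup>2)) + sqrt (avg m (\<lambda>r. (e2 r + e3 r)\<^sup>2))"
    by (rule sqrt_avg_triangle)
  also have "sqrt (avg m (\<lambda>r. (e2 r + e3 r)\<^sup>2)) \<le> sqrt (avg m (\<lambda>r. (e2 r)\<^sup>2)) + sqrt (avg m (\<lambda>r. (e3 r)\<^sup>2))"
    by (rule sqrt_avg_triangle)
  finally have "0.95 \<le> sqrt L" using b1 b2 b3 by simp
  then have "0.95\<^sup>2 \<le> (sqrt L)\<^sup>2" by (intro power_mono) auto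
  moreover have "L \<ge> 0" unfolding L_def by (intro avg_nonneg) simp
  ultimately have "0.9 \<le> L" by (simp add: power2_eq_square)
  then show ?thesis unfolding L_def p_def t_def .
qed

section \<open>Concentration and the Gaussian model\<close>

text \<open>The exponential weight sees only the positive part of y, so that
  \<open>mgf_bound\<close> admits variables with a heavy lower tail.\<close>

lemma exp_le_quadratic:
  fixes y :: real
  shows "exp y \<le> 1 + y + y\<^sup>2 / 2 * exp (max y 0)"
proof (cases "0 \<le> y")
  case True
  obtain t where t: "\<bar>t\<bar> \<le> \<bar>y\<bar>" "exp y = (\<Sum>m<2. y ^ m / fact m) + exp t / fact 2 * y ^ 2"
    using Maclaurin_exp_le[of y 2] by blast
  have "exp t * y\<^sup>2 \<le> exp y * y\<^sup>2" using t(1) True by (intro mult_right_mono) auto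
  then show ?thesis using True t(2) by (simp add: numeral_2_eq_2 max_def mult.commute)
next
  case False
  define u where "u = - y"
  have u: "u > 0" using False u_def by simp
  have q: "1 + u + u\<^sup>2 / 2 \<le> exp u" using u by (intro exp_lower_Taylor_quadratic) simp
  have p: "0 < 1 - u + u\<^sup>2 / 2" 
  proof -
    have "0 < (1 - u)\<^sup>2 / 2 + 1/2" by (simp add: add_nonneg_pos)
    also have "\<dots> = 1 - u + u\<^sup>2 / 2" by (simp add: power2_eq_square field_simps)
    finally show ?thesis .
  qed
  \<comment> \<open>For negative y the bound on exp (-u) comes from the Taylor bound on exp u by
    passing to reciprocals.\<close>
  have "1 \<le> (1 - u + u\<^sup>2 / 2) * (1 + u + u\<^sup>2 / 2)"
  proof -
    have "(1 - u + u\<^sup>2 / 2) * (1 + u + u\<^sup>2 / 2) = 1 + (u\<^sup>2)\<^sup>2 / 4"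
      by (simp add: power2_eq_square field_simps)
    then show ?thesis by simp
  qed
  also have "\<dots> \<le> (1 - u + u\<^sup>2 / 2) * exp u" using q p by (intro mult_left_mono) auto
  finally have "exp (- u) \<le> 1 - u + u\<^sup>2 / 2" by (simp add: exp_minus field_simps)
  then show ?thesis using False by (simp add: u_def)
qed

text \<open>The bound is one-sided: \<open>D\<close> controls the square of \<open>Z\<close>
  weighted by an exponential of its positive part. The negative of a nonnegative variable thus needs
  only a second moment.\<close>

lemma (in prob_space) mgf_bound:
  fixes Z D :: "'a \<Rightarrow> real"
  assumes Z: "integrable M Z" "expectation Z \<le> A"
    and D: "integrable M D" "expectation D \<le> C"
    and le: "\<And>\<omega>. \<omega> \<in> space M \<Longrightarrow> (Z \<omega>)\<^sup>2 * exp (\<theta> * max (Z \<omega>) 0) \<le> D \<omega>" and l: "0 \<le> \<theta>"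
  shows "integrable M (\<lambda>\<omega>. exp (\<theta> * Z \<omega>))"
    and "expectation (\<lambda>\<omega>. exp (\<theta> * Z \<omega>)) \<le> exp (\<theta> * A + \<theta>\<^sup>2 * C / 2)"
proof -
  let ?b = "\<lambda>\<omega>. 1 + \<theta> * Z \<omega> + \<theta>\<^sup>2 / 2 * D \<omega>"
  have b: "exp (\<theta> * Z \<omega>) \<le> ?b \<omega>" if "\<omega> \<in> space M" for \<omega>
  proof -
    have "exp (\<theta> * Z \<omega>) \<le> 1 + \<theta> * Z \<omega> + (\<theta> * Z \<omega>)\<^sup>2 / 2 * exp (max (\<theta> * Z \<omega>) 0)" by (rule exp_le_quadratic)
    also have "max (\<theta> * Z \<omega>) 0 = \<theta> * max (Z \<omega>) 0" using l by (auto simp: max_def mult_le_0_iff zero_le_mult_iff)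
    also have "(\<theta> * Z \<omega>)\<^sup>2 / 2 * exp (\<theta> * max (Z \<omega>) 0) = \<theta>\<^sup>2 / 2 * ((Z \<omega>)\<^sup>2 * exp (\<theta> * max (Z \<omega>) 0))"
      by (simp add: power_mult_distrib)
    also have "\<dots> \<le> \<theta>\<^sup>2 / 2 * D \<omega>" using le[OF that] by (intro mult_left_mono) auto
    finally show ?thesis by simp
  qed
  have ib: "integrable M ?b" using Z D by simp
  show int: "integrable M (\<lambda>\<omega>. exp (\<theta> * Z \<omega>))"
  proof (rule Bochner_Integration.integrable_bound[OF ib])
    show "AE \<omega> in M. norm (exp (\<theta> * Z \<omega>)) \<le> norm (?b \<omega>)"
      using b by (intro AE_I2) (force intro: order_trans[OF _ abs_ge_self])
  qed (use Z in measurable)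
  have "expectation (\<lambda>\<omega>. exp (\<theta> * Z \<omega>)) \<le> expectation ?b"
    by (rule integral_mono[OF int ib b])
  also have "\<dots> = 1 + \<theta> * expectation Z + \<theta>\<^sup>2 / 2 * expectation D" using Z D by (simp add: prob_space)
  also have "\<dots> \<le> 1 + (\<theta> * A + \<theta>\<^sup>2 * C / 2)"
    using mult_left_mono[OF Z(2) l] mult_left_mono[OF D(2), of "\<theta>\<^sup>2 / 2"] by simp
  also have "\<dots> \<le> exp (\<theta> * A + \<theta>\<^sup>2 * C / 2)" by (rule exp_ge_add_one_self)
  finally show "expectation (\<lambda>\<omega>. exp (\<theta> * Z \<omega>)) \<le> exp (\<theta> * A + \<theta>\<^sup>2 * C / 2)" .
qed

text \<open>The condition \<open>\<theta> * C \<le> d\<close> makes the quadratic term of the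
  exponent at most half the linear one. The choice of \<open>\<theta>\<close> is left to the caller,
  as it must respect the upper tail of \<open>Z\<close>.\<close>

lemma (in prob_space) chernoff_avg:
  fixes Z D :: "nat \<Rightarrow> 'a \<Rightarrow> real"
  assumes ind: "indep_vars (\<lambda>_. borel) Z {..<m}"
    and Z: "\<And>r. r < m \<Longrightarrow> integrable M (Z r)" "\<And>r. r < m \<Longrightarrow> expectation (Z r) \<le> A"
    and D: "\<And>r. r < m \<Longrightarrow> integrable M (D r)" "\<And>r. r < m \<Longrightarrow> expectation (D r) \<le> C"
    and le: "\<And>r \<omega>. r < m \<Longrightarrow> \<omega> \<in> space M \<Longrightarrow> (Z r \<omega>)\<^sup>2 * exp (\<theta> * max (Z r \<omega>) 0) \<le> D r \<omega>" and l: "0 < \<theta>"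
    and lC: "\<theta> * C \<le> d" and m: "m > 0"
  shows "{\<omega> \<in> space M. A + d \<le> avg m (\<lambda>r. Z r \<omega>)} \<in> events"
    and "prob {\<omega> \<in> space M. A + d \<le> avg m (\<lambda>r. Z r \<omega>)} \<le> exp (- (real m * \<theta> * d / 2))"
proof -
  have meas[measurable]: "Z r \<in> borel_measurable M" if "r < m" for r using Z(1)[OF that] by simp
  let ?E = "{\<omega> \<in> space M. A + d \<le> avg m (\<lambda>r. Z r \<omega>)}"
  let ?P = "\<lambda>\<omega>. \<Prod>r<m. exp (\<theta> * Z r \<omega>)"
  have "(\<lambda>\<omega>. avg m (\<lambda>r. Z r \<omega>)) \<in> borel_measurable M" unfolding avg_def
    by (intro borel_measurable_divide borel_measurable_sum) (auto intro: meas)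
  then show "?E \<in> events" by measurable
  have ind': "indep_vars (\<lambda>_. borel) (\<lambda>r \<omega>. exp (\<theta> * Z r \<omega>)) {..<m}"
    using indep_vars_compose2[OF ind, of "\<lambda>_ z. exp (\<theta> * z)" "\<lambda>_. borel"] by simp
  have int: "integrable M (\<lambda>\<omega>. exp (\<theta> * Z r \<omega>))" and
    mgf: "expectation (\<lambda>\<omega>. exp (\<theta> * Z r \<omega>)) \<le> exp (\<theta> * A + \<theta>\<^sup>2 * C / 2)" if "r < m" for r
    using mgf_bound[OF Z[OF that] D[OF that] le[OF that]] l by auto
  have intP: "integrable M ?P"
    using indep_vars_integrable[OF _ ind'] int by simp
  have "?E = {\<omega> \<in> space M. exp (\<theta> * (real m * (A + d))) \<le> ?P \<omega>}"
  proof -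
    have "A + d \<le> avg m (\<lambda>r. Z r \<omega>) \<longleftrightarrow> exp (\<theta> * (real m * (A + d))) \<le> ?P \<omega>" for \<omega>
    proof -
      have "?P \<omega> = exp (\<theta> * (\<Sum>r<m. Z r \<omega>))" by (simp add: exp_sum sum_distrib_left)
      moreover have "A + d \<le> avg m (\<lambda>r. Z r \<omega>) \<longleftrightarrow> real m * (A + d) \<le> (\<Sum>r<m. Z r \<omega>)"
        using m by (simp add: avg_def field_simps)
      ultimately show ?thesis using l by simp
    qed
    then show ?thesis by auto
  qed
  also have "prob \<dots> \<le> expectation ?P / exp (\<theta> * (real m * (A + d)))"
    by (rule integral_Markov_inequality_measure[OF intP, of "{}"]) (auto intro!: prod_nonneg)
  also have "expectation ?P = (\<Prod>r<m. expectation (\<lambda>\<omega>. exp (\<theta> * Z r \<omega>)))"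
    using indep_vars_lebesgue_integral[OF _ ind'] int by simp
  also have "\<dots> \<le> (\<Prod>r<m. exp (\<theta> * A + \<theta>\<^sup>2 * C / 2))"
    using mgf by (intro prod_mono) (auto intro!: integral_nonneg)
  also have "\<dots> = exp (real m * (\<theta> * A + \<theta>\<^sup>2 * C / 2))" by (simp add: exp_of_nat_mult)
  also have "\<dots> / exp (\<theta> * (real m * (A + d))) = exp (real m * (\<theta> * A + \<theta>\<^sup>2 * C / 2) - \<theta> * (real m * (A + d)))"
    by (simp add: exp_diff)
  also have "\<dots> \<le> exp (- (real m * \<theta> * d / 2))"
  proof -
    have "real m * \<theta> * (\<theta> * C) \<le> real m * \<theta> * d" using l lC by (intro mult_left_mono) auto
    then show ?thesis by (simp add: algebra_simps power2_eq_square)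
  qed
  finally show "prob ?E \<le> exp (- (real m * \<theta> * d / 2))" by (simp add: divide_right_mono)
qed

text \<open>For contributions whose mean is already tiny: the bound is free of m, so it holds for
  arbitrarily many samples.\<close>

lemma (in prob_space) markov_avg:
  fixes Z :: "nat \<Rightarrow> 'a \<Rightarrow> real"
  assumes Z: "\<And>r. r < m \<Longrightarrow> integrable M (Z r)" "\<And>r. r < m \<Longrightarrow> expectation (Z r) \<le> A"
    and nn: "\<And>r \<omega>. r < m \<Longrightarrow> 0 \<le> Z r \<omega>" and m: "m > 0" and d: "d > 0"
  shows "{\<omega> \<in> space M. d \<le> avg m (\<lambda>r. Z r \<omega>)} \<in> events"
    and "prob {\<omega> \<in> space M. d \<le> avg m (\<lambda>r. Z r \<omega>)} \<le> A / d"
proof -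
  let ?a = "\<lambda>\<omega>. avg m (\<lambda>r. Z r \<omega>)"
  have int: "integrable M ?a" unfolding avg_def using m Z(1)
    by (intro integrable_divide Bochner_Integration.integrable_sum) auto
  show "{\<omega> \<in> space M. d \<le> ?a \<omega>} \<in> events" using int by measurable
  have "prob {\<omega> \<in> space M. d \<le> ?a \<omega>} \<le> expectation ?a / d"
    by (rule integral_Markov_inequality_measure[OF int, of "{}"]) (use nn d in \<open>auto intro!: avg_nonneg\<close>)
  also have "expectation ?a = avg m (\<lambda>r. expectation (Z r))"
    unfolding avg_def using Z(1) by simp
  also have "\<dots> \<le> avg m (\<lambda>r. A)" by (intro avg_mono Z)
  also have "\<dots> = A" using m by (rule avg_const)
  finally show "prob {\<omega> \<in> space M. d \<le> ?a \<omega>} \<le> A / d" using d by (simp add: divide_right_mono)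
qed

section \<open>The Gaussian product space and linear forms on it\<close>

abbreviation gauss :: "real measure" where
  "gauss \<equiv> density lborel (normal_density 0 (sqrt (1/2)))"

lemma prob_space_gauss: "prob_space gauss"
  by (rule prob_space_normal_density) simp

lemma prob_space_gauss_space: "prob_space (gauss_space m n)"
  unfolding gauss_space_def by (intro prob_space_PiM prob_space_gauss)

lemma finite_gauss_index: "finite (gauss_index m n)"
  by (simp add: gauss_index_def)

lemma sets_gauss_space: "sets (gauss_space m n) = sets (PiM (gauss_index m n) (\<lambda>_. borel))"
  unfolding gauss_space_def by (intro sets_PiM_cong) auto

lemma space_gauss_space: "space (gauss_space m n) = PiE (gauss_index m n) (\<lambda>_. UNIV)"
  unfolding gauss_space_def by (simp add: space_PiM)

lemma coord_distr:
  assumes "i \<in> gauss_index m n"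
  shows "distr (gauss_space m n) borel (\<lambda>\<omega>. \<omega> i) = gauss"
proof -
  have "distr (gauss_space m n) gauss (\<lambda>\<omega>. \<omega> i) = gauss"
    unfolding gauss_space_def by (intro distr_PiM_component prob_space_gauss assms)
  moreover have "distr (gauss_space m n) gauss (\<lambda>\<omega>. \<omega> i) = distr (gauss_space m n) borel (\<lambda>\<omega>. \<omega> i)"
    by (intro distr_cong) auto
  ultimately show ?thesis by simp
qed

lemma measurable_coord: "i \<in> gauss_index m n \<Longrightarrow> (\<lambda>\<omega>. \<omega> i) \<in> borel_measurable (gauss_space m n)"
  unfolding measurable_cong_sets[OF sets_gauss_space refl] by (rule measurable_component_singleton)

lemma coord_distributed:
  assumes "i \<in> gauss_index m n"
  shows "distributed (gauss_space m n) lborel (\<lambda>\<omega>. \<omega> i) (normal_density 0 (sqrt (1/2)))"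
  unfolding distributed_def
proof (intro conjI)
  have "distr (gauss_space m n) lborel (\<lambda>\<omega>. \<omega> i) = distr (gauss_space m n) borel (\<lambda>\<omega>. \<omega> i)"
    by (intro distr_cong) auto
  then show "distr (gauss_space m n) lborel (\<lambda>\<omega>. \<omega> i) = gauss"
    using coord_distr[OF assms] by simp
  show "(\<lambda>\<omega>. \<omega> i) \<in> gauss_space m n \<rightarrow>\<^sub>M lborel"
    using measurable_coord[OF assms] by simp
qed simp

text \<open>The law of the identity is the product of its marginals; restriction to the index set
  changes nothing because points of the space are extensional.\<close>

lemma coord_indep: "prob_space.indep_vars (gauss_space m n) (\<lambda>_. borel) (\<lambda>i \<omega>. \<omega> i) (gauss_index m n)"
proof -
  interpret prob_space "gauss_space m n" by (rule prob_space_gauss_space)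
  show ?thesis
  proof (cases "gauss_index m n = {}")
    case True
    then show ?thesis by (simp add: indep_vars_def indep_sets_def)
  next
    case False
    show ?thesis
    proof (subst indep_vars_iff_distr_eq_PiM'[OF False])
      show "random_variable borel (\<lambda>\<omega>. \<omega> i)" if "i \<in> gauss_index m n" for i
        using that by (rule measurable_coord)
      have "distr (gauss_space m n) (PiM (gauss_index m n) (\<lambda>_. borel)) (\<lambda>x. \<lambda>i\<in>gauss_index m n. x i)
         = distr (gauss_space m n) (gauss_space m n) (\<lambda>x. x)"
        by (rule distr_cong) (auto simp: sets_gauss_space space_gauss_space intro!: PiE_restrict)
      also have "\<dots> = gauss_space m n" by (rule distr_id)
      also have "\<dots> = PiM (gauss_index m n) (\<lambda>i. distr (gauss_space m n) borel (\<lambda>\<omega>. \<omega> i))"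
        unfolding gauss_space_def[of m n] 
        by (intro PiM_cong refl) (simp add: coord_distr flip: gauss_space_def)
      finally show "distr (gauss_space m n) (PiM (gauss_index m n) (\<lambda>_. borel)) (\<lambda>x. \<lambda>i\<in>gauss_index m n. x i)
         = PiM (gauss_index m n) (\<lambda>i. distr (gauss_space m n) borel (\<lambda>\<omega>. \<omega> i))" .
    qed
  qed
qed

lemma linear_distributed:
  assumes J: "J \<subseteq> gauss_index m n" and s: "(\<Sum>i\<in>J. (c i)\<^sup>2) > 0"
  shows "distributed (gauss_space m n) lborel (\<lambda>\<omega>. \<Sum>i\<in>J. c i * \<omega> i)
    (normal_density 0 (sqrt ((\<Sum>i\<in>J. (c i)\<^sup>2) / 2)))"
proof -
  interpret prob_space "gauss_space m n" by (rule prob_space_gauss_space)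
  \<comment> \<open>Zero coefficients are dropped because the summands of
    \<open>sum_indep_normal\<close> need positive deviations.\<close>
  define I where "I = {i \<in> J. c i \<noteq> 0}"
  have finJ: "finite J" using J finite_gauss_index by (rule finite_subset)
  have finI: "finite I" using finJ by (simp add: I_def)
  have eqI: "(\<Sum>i\<in>J. f i) = (\<Sum>i\<in>I. f i)" if "\<And>i. c i = 0 \<Longrightarrow> f i = 0" for f :: "_ \<Rightarrow> real"
    using finJ that by (intro sum.mono_neutral_right) (auto simp: I_def)
  have "I \<noteq> {}" using s eqI[of "\<lambda>i. (c i)\<^sup>2"] by auto
  have "distributed (gauss_space m n) lborel (\<lambda>\<omega>. \<Sum>i\<in>I. c i * \<omega> i)
    (normal_density (\<Sum>i\<in>I. 0) (sqrt (\<Sum>i\<in>I. (\<bar>c i\<bar> * sqrt (1/2))\<^sup>2)))"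
  proof (rule sum_indep_normal[OF finI \<open>I \<noteq> {}\<close>])
    have "indep_vars (\<lambda>_. borel) (\<lambda>i \<omega>. \<omega> i) I"
      using coord_indep by (rule indep_vars_subset) (use J in \<open>auto simp: I_def\<close>)
    then show "indep_vars (\<lambda>_. borel) (\<lambda>i \<omega>. c i * \<omega> i) I"
      by (rule indep_vars_compose2[where Y = "\<lambda>i y. c i * y"]) simp
    fix i assume i: "i \<in> I"
    then show "0 < \<bar>c i\<bar> * sqrt (1/2)" by (simp add: I_def)
    have "distributed (gauss_space m n) lborel (\<lambda>\<omega>. 0 + c i * \<omega> i) (normal_density (0 + c i * 0) (\<bar>c i\<bar> * sqrt (1/2)))"
      using i J by (intro normal_density_affine coord_distributed) (auto simp: I_def)
    then show "distributed (gauss_space m n) lborel (\<lambda>\<omega>. c i * \<omega> i) (normal_density 0 (\<bar>c i\<bar> * sqrt (1/2)))"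
      by simp
  qed
  moreover have "(\<Sum>i\<in>I. (\<bar>c i\<bar> * sqrt (1/2))\<^sup>2) = (\<Sum>i\<in>J. (c i)\<^sup>2) / 2"
    using eqI[of "\<lambda>i. (c i)\<^sup>2"] by (simp add: power_mult_distrib sum_divide_distrib power_divide)
  moreover have "(\<lambda>\<omega>. \<Sum>i\<in>I. c i * \<omega> i) = (\<lambda>\<omega>. \<Sum>i\<in>J. c i * \<omega> i)"
    using eqI by (intro ext) (simp add: eqI[symmetric])
  ultimately show ?thesis by simp
qed

text \<open>Multiplying the normal density by exp (x^2 / (4 \<sigma>^2)) gives sqrt 2 times the
  normal density of deviation sqrt 2 * \<sigma>, so this exponential moment is exactly sqrt 2. For
  \<sigma>^2 at most 1/2 the exponent x^2/2 is smaller.\<close>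

lemma (in prob_space) normal_facts:
  assumes X: "distributed M lborel X (normal_density 0 \<sigma>)" and s: "\<sigma> > 0"
  shows "has_bochner_integral M (\<lambda>\<omega>. (X \<omega>) ^ 2) (\<sigma>\<^sup>2)"
    and "has_bochner_integral M (\<lambda>\<omega>. (X \<omega>) ^ 4) (3 * \<sigma> ^ 4)"
    and "\<sigma>\<^sup>2 \<le> 1/2 \<Longrightarrow> integrable M (\<lambda>\<omega>. exp ((X \<omega>)\<^sup>2 / 2))"
    and "\<sigma>\<^sup>2 \<le> 1/2 \<Longrightarrow> expectation (\<lambda>\<omega>. exp ((X \<omega>)\<^sup>2 / 2)) \<le> sqrt 2"
proof -
  have rv[measurable]: "X \<in> borel_measurable M" using distributed_measurable[OF X] by simp
  have tr: "has_bochner_integral M (\<lambda>\<omega>. g (X \<omega>)) c"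
    if "has_bochner_integral lborel (\<lambda>x. normal_density 0 \<sigma> x * g x) c" "g \<in> borel_measurable borel" for g :: "real \<Rightarrow> real" and c
  proof -
    have "has_bochner_integral (density lborel (normal_density 0 \<sigma>)) g c"
      using that by (intro has_bochner_integral_density) (auto simp: mult.commute)
    then have "has_bochner_integral (distr M lborel X) g c" using X by (simp add: distributed_distr_eq_density)
    then show ?thesis using that(2) rv
      by (simp add: has_bochner_integral_iff integrable_distr_eq integral_distr)
  qed
  show "has_bochner_integral M (\<lambda>\<omega>. (X \<omega>) ^ 2) (\<sigma>\<^sup>2)"
  proof (intro tr)
    have "fact (2 * 1) / ((2 / \<sigma>\<^sup>2) ^ 1 * fact 1) = \<sigma>\<^sup>2"
      using s by (simp add: fact_numeral)
    then show "has_bochner_integral lborel (\<lambda>x. normal_density 0 \<sigma> x * x ^ 2) (\<sigma>\<^sup>2)"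
      using normal_moment_even[OF s, of 0 1] by simp
  qed simp
  show "has_bochner_integral M (\<lambda>\<omega>. (X \<omega>) ^ 4) (3 * \<sigma> ^ 4)"
  proof (intro tr)
    have "fact (2 * 2) / ((2 / \<sigma>\<^sup>2) ^ 2 * fact 2) = 3 * \<sigma> ^ 4"
      using s by (simp add: fact_numeral field_simps power2_eq_square power4_eq_xxxx)
    then show "has_bochner_integral lborel (\<lambda>x. normal_density 0 \<sigma> x * x ^ 4) (3 * \<sigma> ^ 4)"
      using normal_moment_even[OF s, of 0 2] by simp
  qed simp
  assume s2: "\<sigma>\<^sup>2 \<le> 1/2"
  have e: "has_bochner_integral M (\<lambda>\<omega>. exp ((X \<omega>)\<^sup>2 / (4 * \<sigma>\<^sup>2))) (sqrt 2)"
  proof (intro tr)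
    have "normal_density 0 \<sigma> x * exp (x\<^sup>2 / (4 * \<sigma>\<^sup>2)) = sqrt 2 * normal_density 0 (sqrt 2 * \<sigma>) x" for x
    proof -
      have "- (x\<^sup>2) / (2 * \<sigma>\<^sup>2) + x\<^sup>2 / (4 * \<sigma>\<^sup>2) = - (x\<^sup>2) / (2 * (sqrt 2 * \<sigma>)\<^sup>2)"
        using s by (simp add: field_simps power_mult_distrib)
      then have "exp (- (x\<^sup>2) / (2 * \<sigma>\<^sup>2)) * exp (x\<^sup>2 / (4 * \<sigma>\<^sup>2)) = exp (- (x\<^sup>2) / (2 * (sqrt 2 * \<sigma>)\<^sup>2))"
        by (simp only: exp_add[symmetric])
      moreover have "1 / sqrt (2 * pi * \<sigma>\<^sup>2) = sqrt 2 * (1 / sqrt (2 * pi * (sqrt 2 * \<sigma>)\<^sup>2))"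
      proof -
        have "1 / sqrt 2 = sqrt 2 / 2" by (simp add: field_simps)
        then show ?thesis using s by (simp add: power_mult_distrib real_sqrt_mult field_simps)
      qed
      ultimately show ?thesis unfolding normal_density_def diff_zero
        by (simp only: mult.assoc)
    qed
    moreover have "has_bochner_integral lborel (\<lambda>x. sqrt 2 * normal_density 0 (sqrt 2 * \<sigma>) x) (sqrt 2 * 1)"
      using s by (intro has_bochner_integral_mult_right) (auto simp: has_bochner_integral_iff)
    ultimately show "has_bochner_integral lborel (\<lambda>x. normal_density 0 \<sigma> x * exp (x\<^sup>2 / (4 * \<sigma>\<^sup>2))) (sqrt 2)"
      by simp
  qed simp
  have le: "exp ((X \<omega>)\<^sup>2 / 2) \<le> exp ((X \<omega>)\<^sup>2 / (4 * \<sigma>\<^sup>2))" for \<omega>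
    unfolding exp_le_cancel_iff using s s2 by (intro divide_left_mono) auto
  show int: "integrable M (\<lambda>\<omega>. exp ((X \<omega>)\<^sup>2 / 2))"
    by (rule Bochner_Integration.integrable_bound[OF integrable.intros[OF e]]) (use le in auto)
  have "expectation (\<lambda>\<omega>. exp ((X \<omega>)\<^sup>2 / 2)) \<le> expectation (\<lambda>\<omega>. exp ((X \<omega>)\<^sup>2 / (4 * \<sigma>\<^sup>2)))"
    using le by (intro integral_mono int integrable.intros[OF e]) auto
  then show "expectation (\<lambda>\<omega>. exp ((X \<omega>)\<^sup>2 / 2)) \<le> sqrt 2"
    using has_bochner_integral_integral_eq[OF e] by simp
qed

text \<open>Extends \<open>normal_facts\<close> to the vanishing form, which has no density. The
  variance s/2 explains 3/4 = 3 * (1/2)^2.\<close>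

lemma linear_facts:
  fixes c :: "nat \<times> nat \<times> nat \<Rightarrow> real"
  assumes J: "J \<subseteq> gauss_index m n"
  defines "s \<equiv> \<Sum>i\<in>J. (c i)\<^sup>2"
  shows "has_bochner_integral (gauss_space m n) (\<lambda>\<omega>. (\<Sum>i\<in>J. c i * \<omega> i) ^ 2) (s / 2)"
    and "has_bochner_integral (gauss_space m n) (\<lambda>\<omega>. (\<Sum>i\<in>J. c i * \<omega> i) ^ 4) (3/4 * s\<^sup>2)"
    and "s \<le> 1 \<Longrightarrow> integrable (gauss_space m n) (\<lambda>\<omega>. exp ((\<Sum>i\<in>J. c i * \<omega> i)\<^sup>2 / 2))"
    and "s \<le> 1 \<Longrightarrow> integral\<^sup>L (gauss_space m n) (\<lambda>\<omega>. exp ((\<Sum>i\<in>J. c i * \<omega> i)\<^sup>2 / 2)) \<le> sqrt 2"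
proof -
  interpret prob_space "gauss_space m n" by (rule prob_space_gauss_space)
  let ?X = "\<lambda>\<omega>. \<Sum>i\<in>J. c i * \<omega> i"
  have "has_bochner_integral (gauss_space m n) (\<lambda>\<omega>. ?X \<omega> ^ 2) (s / 2) \<and>
    has_bochner_integral (gauss_space m n) (\<lambda>\<omega>. ?X \<omega> ^ 4) (3/4 * s\<^sup>2) \<and>
    (s \<le> 1 \<longrightarrow> integrable (gauss_space m n) (\<lambda>\<omega>. exp ((?X \<omega>)\<^sup>2 / 2)) \<and> expectation (\<lambda>\<omega>. exp ((?X \<omega>)\<^sup>2 / 2)) \<le> sqrt 2)"
  proof (cases "s > 0")
    case True
    have "(sqrt (s / 2)) ^ 4 = ((sqrt (s / 2))\<^sup>2)\<^sup>2" by (simp only: power_mult[symmetric]) simp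
    then have "3 * (sqrt (s / 2)) ^ 4 = 3/4 * s\<^sup>2" using True by (simp add: power_divide)
    with normal_facts[OF linear_distributed[OF J True[unfolded s_def]]] True show ?thesis
      unfolding s_def[symmetric] by simp
  next
    case False
    moreover have "0 \<le> s" unfolding s_def by (intro sum_nonneg) simp
    ultimately have s0: "s = 0" by simp
    have finJ: "finite J" using J finite_gauss_index by (rule finite_subset)
    have "\<forall>i\<in>J. (c i)\<^sup>2 = 0" using s0 finJ unfolding s_def by (subst (asm) sum_nonneg_eq_0_iff) auto
    then have "?X \<omega> = 0" for \<omega> by (intro sum.neutral) auto
    then show ?thesis using s0 by (simp add: prob_space has_bochner_integral_zero)
  qed
  then show "has_bochner_integral (gauss_space m n) (\<lambda>\<omega>. ?X \<omega> ^ 2) (s / 2)"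
    "has_bochner_integral (gauss_space m n) (\<lambda>\<omega>. ?X \<omega> ^ 4) (3/4 * s\<^sup>2)"
    "s \<le> 1 \<Longrightarrow> integrable (gauss_space m n) (\<lambda>\<omega>. exp ((?X \<omega>)\<^sup>2 / 2))"
    "s \<le> 1 \<Longrightarrow> expectation (\<lambda>\<omega>. exp ((?X \<omega>)\<^sup>2 / 2)) \<le> sqrt 2"
    by auto
qed

section \<open>Moments and independence of the rows\<close>

definition row_index :: "nat \<Rightarrow> nat \<Rightarrow> (nat \<times> nat \<times> nat) set" where
  "row_index n r = {r} \<times> {..<n} \<times> {0, 1}"

lemma row_index_subset: "r < m \<Longrightarrow> row_index n r \<subseteq> gauss_index m n"
  by (auto simp: row_index_def gauss_index_def)

lemma finite_row_index: "finite (row_index n r)"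
  by (simp add: row_index_def)

lemma sum_row_index: "(\<Sum>i\<in>row_index n r. f i) = (\<Sum>j<n. f (r, j, 0) + f (r, j, 1))"
  for f :: "_ \<Rightarrow> 'a::comm_monoid_add"
  unfolding row_index_def by (simp add: sum.cartesian_product' )

definition coef :: "(nat \<Rightarrow> complex) \<Rightarrow> nat \<times> nat \<times> nat \<Rightarrow> real" where
  "coef v i = (case i of (r, j, k) \<Rightarrow> if k = 0 then Re (v j) else Im (v j))"

lemma Re_az: "Re (az n \<omega> r v) = (\<Sum>i\<in>row_index n r. coef v i * \<omega> i)"
  unfolding sum_row_index az_def by (simp add: samp_def coef_def algebra_simps)

lemma sum_coef_sq: "(\<Sum>i\<in>row_index n r. (coef v i)\<^sup>2) = (vnorm n v)\<^sup>2"
  unfolding sum_row_index vnorm_sq cmod_power2 by (simp add: coef_def)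

lemma Re_az_facts:
  assumes r: "r < m"
  shows "has_bochner_integral (gauss_space m n) (\<lambda>\<omega>. (Re (az n \<omega> r v)) ^ 2) ((vnorm n v)\<^sup>2 / 2)"
    and "has_bochner_integral (gauss_space m n) (\<lambda>\<omega>. (Re (az n \<omega> r v)) ^ 4) (3/4 * (vnorm n v) ^ 4)"
    and "vnorm n v \<le> 1 \<Longrightarrow> integrable (gauss_space m n) (\<lambda>\<omega>. exp ((Re (az n \<omega> r v))\<^sup>2 / 2))"
    and "vnorm n v \<le> 1 \<Longrightarrow> integral\<^sup>L (gauss_space m n) (\<lambda>\<omega>. exp ((Re (az n \<omega> r v))\<^sup>2 / 2)) \<le> sqrt 2"
proof -
  have p4: "((vnorm n v)\<^sup>2)\<^sup>2 = (vnorm n v) ^ 4" by (simp flip: power_mult)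
  note l = linear_facts[OF row_index_subset[OF r], where c = "coef v" and n = n, folded Re_az, unfolded sum_coef_sq p4]
  show "has_bochner_integral (gauss_space m n) (\<lambda>\<omega>. (Re (az n \<omega> r v)) ^ 2) ((vnorm n v)\<^sup>2 / 2)"
    "has_bochner_integral (gauss_space m n) (\<lambda>\<omega>. (Re (az n \<omega> r v)) ^ 4) (3/4 * (vnorm n v) ^ 4)"
    by (rule l)+
  assume "vnorm n v \<le> 1"
  then have "(vnorm n v)\<^sup>2 \<le> 1" by (simp add: abs_square_le_1)
  then show "integrable (gauss_space m n) (\<lambda>\<omega>. exp ((Re (az n \<omega> r v))\<^sup>2 / 2))"
    "integral\<^sup>L (gauss_space m n) (\<lambda>\<omega>. exp ((Re (az n \<omega> r v))\<^sup>2 / 2)) \<le> sqrt 2"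
    by (rule l)+
qed

text \<open>Carries facts about real parts over to imaginary parts, since multiplication by -i
  preserves the norm.\<close>

lemma Im_az: "Im (az n \<omega> r v) = Re (az n \<omega> r (\<lambda>j. - \<i> * v j))"
  unfolding az_scale by simp

lemma az_moment2:
  assumes r: "r < m"
  shows "has_bochner_integral (gauss_space m n) (\<lambda>\<omega>. (cmod (az n \<omega> r v)) ^ 2) ((vnorm n v)\<^sup>2)"
  unfolding cmod_power2 Im_az
  using has_bochner_integral_add[OF Re_az_facts(1)[OF r, of n v] Re_az_facts(1)[OF r, of n "\<lambda>j. - \<i> * v j"]]
  by (simp add: vnorm_scale[of n "- \<i>", simplified])

lemma az_moment4:
  assumes r: "r < m"
  shows "has_bochner_integral (gauss_space m n) (\<lambda>\<omega>. (cmod (az n \<omega> r v)) ^ 4) (2 * (vnorm n v) ^ 4)"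
proof -
  \<comment> \<open>The average of \<open>Re (e\<^sup>i\<^sup>\<phi> b)\<^sup>4\<close> over four equispaced phases is a multiple of \<open>|b|\<^sup>4\<close>, so that only
    one-dimensional normal laws are needed.\<close>
  let ?R = "\<lambda>c \<omega>. Re (az n \<omega> r (\<lambda>j. c * v j))"
  note F = Re_az_facts(2)[OF r, of n]
  have I: "has_bochner_integral (gauss_space m n)
      (\<lambda>\<omega>. 2/3 * ((?R 1 \<omega>) ^ 4 + (?R (- \<i>) \<omega>) ^ 4 + (1/4 * (?R (1 - \<i>) \<omega>) ^ 4 + 1/4 * (?R (1 + \<i>) \<omega>) ^ 4)))
      (2/3 * (3/4 * (vnorm n (\<lambda>j. 1 * v j)) ^ 4 + 3/4 * (vnorm n (\<lambda>j. - \<i> * v j)) ^ 4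
         + (1/4 * (3/4 * (vnorm n (\<lambda>j. (1 - \<i>) * v j)) ^ 4) + 1/4 * (3/4 * (vnorm n (\<lambda>j. (1 + \<i>) * v j)) ^ 4))))"
    by (intro has_bochner_integral_add has_bochner_integral_mult_right F)
  have fn: "2/3 * ((?R 1 \<omega>) ^ 4 + (?R (- \<i>) \<omega>) ^ 4 + (1/4 * (?R (1 - \<i>) \<omega>) ^ 4 + 1/4 * (?R (1 + \<i>) \<omega>) ^ 4))
     = (cmod (az n \<omega> r v)) ^ 4" for \<omega>
  proof -
    define a b where "a = Re (az n \<omega> r v)" and "b = Im (az n \<omega> r v)"
    have "(cmod (az n \<omega> r v)) ^ 4 = (a\<^sup>2 + b\<^sup>2)\<^sup>2"
      unfolding a_def b_def cmod_power2[symmetric] by (simp flip: power_mult)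
    moreover have "?R 1 \<omega> = a" "?R (- \<i>) \<omega> = b" "?R (1 - \<i>) \<omega> = a + b" "?R (1 + \<i>) \<omega> = a - b"
      unfolding az_scale by (auto simp: a_def b_def)
    ultimately show ?thesis by (simp only:) (simp add: power2_eq_square power4_eq_xxxx algebra_simps)
  qed
  have c: "cmod (1 - \<i>) ^ 4 = 4" "cmod (1 + \<i>) ^ 4 = 4"
    by (simp_all add: cmod_def power4_eq_xxxx)
  show ?thesis
    using I unfolding fn vnorm_scale power_mult_distrib c by simp
qed

text \<open>The exponent 1/4 is half of the one available for real and imaginary part, so the
  inequality of arithmetic and geometric means separates the two without their independence.\<close>

lemma az_exp:
  assumes r: "r < m" and v: "vnorm n v \<le> 1"
  shows "integrable (gauss_space m n) (\<lambda>\<omega>. exp ((cmod (az n \<omega> r v))\<^sup>2 / 4))"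
    and "integral\<^sup>L (gauss_space m n) (\<lambda>\<omega>. exp ((cmod (az n \<omega> r v))\<^sup>2 / 4)) \<le> 2"
proof -
  let ?G = "gauss_space m n"
  let ?A = "\<lambda>\<omega>. exp ((Re (az n \<omega> r v))\<^sup>2 / 2)" and ?B = "\<lambda>\<omega>. exp ((Im (az n \<omega> r v))\<^sup>2 / 2)"
  have v': "vnorm n (\<lambda>j. - \<i> * v j) \<le> 1" using v unfolding vnorm_scale by simp
  note A = Re_az_facts(3,4)[OF r v]
  note B = Re_az_facts(3,4)[OF r v', folded Im_az]
  have le: "exp ((cmod (az n \<omega> r v))\<^sup>2 / 4) \<le> (?A \<omega> + ?B \<omega>) / 2" for \<omega>
  proof -
    define a b where "a = exp ((Re (az n \<omega> r v))\<^sup>2 / 4)" and "b = exp ((Im (az n \<omega> r v))\<^sup>2 / 4)"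
    have "?A \<omega> = a * a" "?B \<omega> = b * b" unfolding a_def b_def by (simp_all flip: exp_add)
    moreover have "exp ((cmod (az n \<omega> r v))\<^sup>2 / 4) = a * b"
      unfolding a_def b_def cmod_power2 by (simp add: add_divide_distrib exp_add)
    moreover have "0 \<le> (a - b)\<^sup>2" by simp
    ultimately show ?thesis by (simp add: power2_eq_square algebra_simps)
  qed
  have int2: "integrable ?G (\<lambda>\<omega>. (?A \<omega> + ?B \<omega>) / 2)" using A(1) B(1) by simp
  have meas: "(\<lambda>\<omega>. (cmod (az n \<omega> r v))\<^sup>2) \<in> borel_measurable ?G"
    using az_moment2[OF r, of n v] by (intro borel_measurable_integrable integrable.intros)
  show int: "integrable ?G (\<lambda>\<omega>. exp ((cmod (az n \<omega> r v))\<^sup>2 / 4))"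
    by (rule Bochner_Integration.integrable_bound[OF int2])
       (use meas le in \<open>auto intro!: AE_I2 order_trans[OF _ abs_ge_self]\<close>)
  have "integral\<^sup>L ?G (\<lambda>\<omega>. exp ((cmod (az n \<omega> r v))\<^sup>2 / 4)) \<le> integral\<^sup>L ?G (\<lambda>\<omega>. (?A \<omega> + ?B \<omega>) / 2)"
    by (intro integral_mono int int2 le)
  also have "\<dots> \<le> sqrt 2" using A B by simp
  also have "sqrt 2 \<le> 2" by (simp add: real_le_lsqrt)
  finally show "integral\<^sup>L ?G (\<lambda>\<omega>. exp ((cmod (az n \<omega> r v))\<^sup>2 / 4)) \<le> 2" .
qed

lemma vnorm_add_scale_sq:
  "(vnorm n (\<lambda>j. x j + c * v j))\<^sup>2 = (vnorm n x)\<^sup>2 + (cmod c)\<^sup>2 * (vnorm n v)\<^sup>2 + 2 * Re (c * cip n x v)"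
proof -
  have "Re (cip n (\<lambda>j. c * v j) x) = Re (c * cip n x v)"
    using cnj_cip[of n x "\<lambda>j. c * v j"] by (simp add: cip_scale_right flip: cnj_cip[of n x "\<lambda>j. c * v j"])
  then show ?thesis by (simp add: vnorm_add_sq vnorm_scale power_mult_distrib)
qed

lemma mixed_moments:
  fixes v x :: "nat \<Rightarrow> complex" and \<sigma> :: real
  assumes r: "r < m" and x: "vnorm n x = 1"
  defines "V \<equiv> (vnorm n v)\<^sup>2" and "a \<equiv> Re (cip n x v)" and "a' \<equiv> Im (cip n x v)"
  shows "has_bochner_integral (gauss_space m n) (\<lambda>\<omega>. (cmod (az n \<omega> r x))\<^sup>2 * (cmod (az n \<omega> r v))\<^sup>2)
      (V + (cmod (cip n x v))\<^sup>2)"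
    and "has_bochner_integral (gauss_space m n)
      (\<lambda>\<omega>. (3/2 * Re (cnj (az n \<omega> r v) * az n \<omega> r x) + \<sigma> * (cmod (az n \<omega> r v))\<^sup>2)\<^sup>2)
      (9/8 * V + 27/8 * a\<^sup>2 - 9/8 * a'\<^sup>2 + 6 * \<sigma> * a * V + 2 * \<sigma>\<^sup>2 * V\<^sup>2)"
proof -
  let ?G = "gauss_space m n"
  \<comment> \<open>Polarization: the mixed moments are combinations of fourth moments of \<open>a\<^sub>r\<^sup>*(x + c v)\<close>.\<close>
  define Q where "Q c \<omega> = (cmod (az n \<omega> r (\<lambda>j. x j + c * v j))) ^ 4" for c \<omega>
  define q where "q c = 2 * (1 + (cmod c)\<^sup>2 * V + 2 * Re (c * cip n x v))\<^sup>2" for c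
  define B where "B \<omega> = (cmod (az n \<omega> r x))\<^sup>2" for \<omega>
  define t where "t \<omega> = (cmod (az n \<omega> r v))\<^sup>2" for \<omega>
  define p where "p \<omega> = Re (cnj (az n \<omega> r v) * az n \<omega> r x)" for \<omega>
  define p' where "p' \<omega> = Im (cnj (az n \<omega> r v) * az n \<omega> r x)" for \<omega>
  have p4: "((u::real)\<^sup>2)\<^sup>2 = u ^ 4" for u by (simp flip: power_mult)
  have Q: "has_bochner_integral ?G (Q c) (q c)" for c
  proof -
    have "2 * (vnorm n (\<lambda>j. x j + c * v j)) ^ 4 = q c"
      unfolding q_def V_def p4[symmetric] vnorm_add_scale_sq x by simp
    then show ?thesis using az_moment4[OF r, of n "\<lambda>j. x j + c * v j"] unfolding Q_def by simp
  qed
  have Bi: "has_bochner_integral ?G (\<lambda>\<omega>. (B \<omega>)\<^sup>2) 2"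
    unfolding B_def p4 using az_moment4[OF r, of n x] x by simp
  have ti: "has_bochner_integral ?G (\<lambda>\<omega>. (t \<omega>)\<^sup>2) (2 * V\<^sup>2)"
    unfolding t_def V_def p4 using az_moment4[OF r, of n v] by simp
  have Qr: "Q (of_real s) \<omega> = (B \<omega> + 2 * s * p \<omega> + s\<^sup>2 * t \<omega>)\<^sup>2" for s \<omega>
  proof -
    have "(cmod (az n \<omega> r (\<lambda>j. x j + of_real s * v j)))\<^sup>2 = B \<omega> + 2 * s * p \<omega> + s\<^sup>2 * t \<omega>"
      unfolding az_add az_scale B_def p_def t_def cmod_power2 by (simp add: power2_eq_square algebra_simps)
    then show ?thesis unfolding Q_def p4[symmetric] by simp
  qed
  have Qi: "Q (of_real s * \<i>) \<omega> = (B \<omega> + 2 * s * p' \<omega> + s\<^sup>2 * t \<omega>)\<^sup>2" for s \<omega>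
  proof -
    have "(cmod (az n \<omega> r (\<lambda>j. x j + of_real s * \<i> * v j)))\<^sup>2 = B \<omega> + 2 * s * p' \<omega> + s\<^sup>2 * t \<omega>"
      unfolding az_add az_scale B_def p'_def t_def cmod_power2 by (simp add: power2_eq_square algebra_simps)
    then show ?thesis unfolding Q_def p4[symmetric] by simp
  qed
  have pp: "(p \<omega>)\<^sup>2 + (p' \<omega>)\<^sup>2 = B \<omega> * t \<omega>" for \<omega>
    unfolding p_def p'_def B_def t_def cmod_power2[symmetric] norm_mult power_mult_distrib by (simp add: mult.commute)
  have cc: "(cmod (cip n x v))\<^sup>2 = a\<^sup>2 + a'\<^sup>2" unfolding a_def a'_def by (rule cmod_power2)
  \<comment> \<open>Over the phases 1, -1, i, -i the odd terms cancel; after subtracting the pure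
    squares, 8 B t + 8 (p^2 + p'^2) = 16 B t remains.\<close>
  have I1: "has_bochner_integral ?G
     (\<lambda>\<omega>. 1/16 * (Q (of_real 1) \<omega> + Q (of_real (-1)) \<omega> + (Q (of_real 1 * \<i>) \<omega> + Q (of_real (-1) * \<i>) \<omega>) - 4 * (B \<omega>)\<^sup>2 - 4 * (t \<omega>)\<^sup>2))
     (1/16 * (q (of_real 1) + q (of_real (-1)) + (q (of_real 1 * \<i>) + q (of_real (-1) * \<i>)) - 4 * 2 - 4 * (2 * V\<^sup>2)))"
    by (intro has_bochner_integral_add has_bochner_integral_diff has_bochner_integral_mult_right Q Bi ti)
  have f1: "1/16 * (Q (of_real 1) \<omega> + Q (of_real (-1)) \<omega> + (Q (of_real 1 * \<i>) \<omega> + Q (of_real (-1) * \<i>) \<omega>) - 4 * (B \<omega>)\<^sup>2 - 4 * (t \<omega>)\<^sup>2)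
     = B \<omega> * t \<omega>" for \<omega>
  proof -
    have "1/16 * (Q (of_real 1) \<omega> + Q (of_real (-1)) \<omega> + (Q (of_real 1 * \<i>) \<omega> + Q (of_real (-1) * \<i>) \<omega>) - 4 * (B \<omega>)\<^sup>2 - 4 * (t \<omega>)\<^sup>2)
      = 1/2 * ((p \<omega>)\<^sup>2 + (p' \<omega>)\<^sup>2) + 1/2 * (B \<omega> * t \<omega>)"
      unfolding Qr Qi by (simp add: power2_eq_square algebra_simps)
    then show ?thesis unfolding pp by simp
  qed
  have v1: "1/16 * (q (of_real 1) + q (of_real (-1)) + (q (of_real 1 * \<i>) + q (of_real (-1) * \<i>)) - 4 * 2 - 4 * (2 * V\<^sup>2))
     = V + (cmod (cip n x v))\<^sup>2"
    unfolding q_def cc by (simp flip: a_def a'_def) (simp add: power2_eq_square algebra_simps)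
  have Bt: "has_bochner_integral ?G (\<lambda>\<omega>. B \<omega> * t \<omega>) (V + (cmod (cip n x v))\<^sup>2)"
    using I1 unfolding f1 v1 .
  then show "has_bochner_integral ?G (\<lambda>\<omega>. (cmod (az n \<omega> r x))\<^sup>2 * (cmod (az n \<omega> r v))\<^sup>2) (V + (cmod (cip n x v))\<^sup>2)"
    unfolding B_def t_def .
  let ?w = "V + (cmod (cip n x v))\<^sup>2"
  \<comment> \<open>\<open>Q\<close> at real s is a quartic polynomial in s: p^2 is extracted from
    the coefficient of s^2 with the nodes 1, -1, and p t from that of s^3 with the nodes 1, -1, 2,
    -2.\<close>
  have I2: "has_bochner_integral ?G
     (\<lambda>\<omega>. 9/4 * (1/8 * (Q (of_real 1) \<omega> + Q (of_real (-1)) \<omega> - 2 * (B \<omega>)\<^sup>2 - 2 * (t \<omega>)\<^sup>2 - 4 * (B \<omega> * t \<omega>)))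
        + 3 * \<sigma> * (1/48 * (Q (of_real 2) \<omega> - Q (of_real (-2)) \<omega> - 2 * Q (of_real 1) \<omega> + 2 * Q (of_real (-1)) \<omega>))
        + \<sigma>\<^sup>2 * (t \<omega>)\<^sup>2)
     (9/4 * (1/8 * (q (of_real 1) + q (of_real (-1)) - 2 * 2 - 2 * (2 * V\<^sup>2) - 4 * ?w))
        + 3 * \<sigma> * (1/48 * (q (of_real 2) - q (of_real (-2)) - 2 * q (of_real 1) + 2 * q (of_real (-1))))
        + \<sigma>\<^sup>2 * (2 * V\<^sup>2))"
    by (intro has_bochner_integral_add has_bochner_integral_diff has_bochner_integral_mult_right Q Bi ti Bt)
  have f2a: "1/8 * (Q (of_real 1) \<omega> + Q (of_real (-1)) \<omega> - 2 * (B \<omega>)\<^sup>2 - 2 * (t \<omega>)\<^sup>2 - 4 * (B \<omega> * t \<omega>)) = (p \<omega>)\<^sup>2" for \<omega>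
    unfolding Qr by (simp add: power2_eq_square algebra_simps)
  have f2b: "1/48 * (Q (of_real 2) \<omega> - Q (of_real (-2)) \<omega> - 2 * Q (of_real 1) \<omega> + 2 * Q (of_real (-1)) \<omega>) = p \<omega> * t \<omega>" for \<omega>
    unfolding Qr by (simp add: power2_eq_square algebra_simps)
  have v2a: "1/8 * (q (of_real 1) + q (of_real (-1)) - 2 * 2 - 2 * (2 * V\<^sup>2) - 4 * ?w) = V/2 + 3/2 * a\<^sup>2 - 1/2 * a'\<^sup>2"
    unfolding q_def cc by (simp flip: a_def a'_def) (simp add: power2_eq_square field_simps)
  have v2b: "1/48 * (q (of_real 2) - q (of_real (-2)) - 2 * q (of_real 1) + 2 * q (of_real (-1))) = 2 * a * V"
    unfolding q_def by (simp flip: a_def) (simp add: power2_eq_square algebra_simps)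
  have e1: "(3/2 * p \<omega> + \<sigma> * t \<omega>)\<^sup>2 = 9/4 * (p \<omega>)\<^sup>2 + 3 * \<sigma> * (p \<omega> * t \<omega>) + \<sigma>\<^sup>2 * (t \<omega>)\<^sup>2" for \<omega>
    by (simp add: power2_eq_square algebra_simps)
  have e2: "9/8 * V + 27/8 * a\<^sup>2 - 9/8 * a'\<^sup>2 + 6 * \<sigma> * a * V + 2 * \<sigma>\<^sup>2 * V\<^sup>2
     = 9/4 * (V/2 + 3/2 * a\<^sup>2 - 1/2 * a'\<^sup>2) + 3 * \<sigma> * (2 * a * V) + \<sigma>\<^sup>2 * (2 * V\<^sup>2)"
    by (simp add: algebra_simps)
  show "has_bochner_integral ?G
      (\<lambda>\<omega>. (3/2 * Re (cnj (az n \<omega> r v) * az n \<omega> r x) + \<sigma> * (cmod (az n \<omega> r v))\<^sup>2)\<^sup>2)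
      (9/8 * V + 27/8 * a\<^sup>2 - 9/8 * a'\<^sup>2 + 6 * \<sigma> * a * V + 2 * \<sigma>\<^sup>2 * V\<^sup>2)"
    using I2 unfolding f2a f2b v2a v2b p_def[symmetric] t_def[symmetric] e1 e2 .
qed

text \<open>Stated for any index set containing the row, because it is applied to the whole space
  and to a single row.\<close>

lemma borel_measurable_az:
  assumes "row_index n r \<subseteq> I"
  shows "(\<lambda>\<omega>. az n \<omega> r v) \<in> borel_measurable (PiM I (\<lambda>_. borel))"
proof -
  have c: "(\<lambda>\<omega>. \<omega> (r, j, k)) \<in> borel_measurable (PiM I (\<lambda>_. borel :: real measure))" if "j < n" "k \<in> {0, 1}" for j k
    using assms that by (intro measurable_component_singleton) (auto simp: row_index_def)
  have c': "(\<lambda>\<omega>. complex_of_real (\<omega> (r, j, k))) \<in> borel_measurable (PiM I (\<lambda>_. borel :: real measure))" if "j < n" "k \<in> {0, 1}" for j k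
    by (rule borel_measurable_continuous_on[OF _ c[OF that]]) (intro continuous_intros)
  have "(\<lambda>\<omega>. samp \<omega> r j) \<in> borel_measurable (PiM I (\<lambda>_. borel))" if "j < n" for j
    unfolding samp_def Complex_eq using that
    by (intro borel_measurable_add borel_measurable_times borel_measurable_const c') auto
  then have "(\<lambda>\<omega>. cnj (samp \<omega> r j) * v j) \<in> borel_measurable (PiM I (\<lambda>_. borel))" if "j < n" for j
    using that by (intro borel_measurable_times borel_measurable_const)
      (auto intro!: borel_measurable_continuous_on[of cnj] continuous_intros)
  then show ?thesis unfolding az_def by (intro borel_measurable_sum) auto
qed

lemma az_restrict: "az n (restrict \<omega> (row_index n r)) r v = az n \<omega> r v"
  unfolding az_def samp_def by (intro sum.cong) (auto simp: row_index_def)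

text \<open>Rows read disjoint blocks of independent coordinates, and a_r^*v factors through the
  restriction to its block. \<open>F\<close> takes two arguments since the summands depend jointly
  on a_r^*x and a_r^*v.\<close>

lemma rows_indep:
  fixes F :: "complex \<Rightarrow> complex \<Rightarrow> real"
  assumes F: "case_prod F \<in> borel_measurable (borel \<Otimes>\<^sub>M borel)"
  shows "prob_space.indep_vars (gauss_space m n) (\<lambda>_. borel) (\<lambda>r \<omega>. F (az n \<omega> r x) (az n \<omega> r v)) {..<m}"
proof -
  interpret prob_space "gauss_space m n" by (rule prob_space_gauss_space)
  have "indep_vars (\<lambda>r. PiM (row_index n r) (\<lambda>_. borel)) (\<lambda>r \<omega>. restrict (\<lambda>i. \<omega> i) (row_index n r)) {..<m}"
    by (rule indep_vars_restrict[OF coord_indep])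
       (auto intro: row_index_subset[THEN subsetD] simp: disjoint_family_on_def row_index_def)
  then have "indep_vars (\<lambda>_. borel)
      (\<lambda>r \<omega>. F (az n (restrict \<omega> (row_index n r)) r x) (az n (restrict \<omega> (row_index n r)) r v)) {..<m}"
  proof (rule indep_vars_compose2[where Y = "\<lambda>r \<omega>. F (az n \<omega> r x) (az n \<omega> r v)"])
    fix r
    have "(\<lambda>\<omega>. case_prod F (az n \<omega> r x, az n \<omega> r v)) \<in> borel_measurable (PiM (row_index n r) (\<lambda>_. borel))"
      by (intro measurable_compose[OF _ F] measurable_Pair borel_measurable_az) auto
    then show "(\<lambda>\<omega>. F (az n \<omega> r x) (az n \<omega> r v)) \<in> borel_measurable (PiM (row_index n r) (\<lambda>_. borel))" by simp
  qed
  then show ?thesis unfolding az_restrict .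
qed

lemma borel_measurable_az_gauss: "r < m \<Longrightarrow> (\<lambda>\<omega>. az n \<omega> r v) \<in> borel_measurable (gauss_space m n)"
  unfolding measurable_cong_sets[OF sets_gauss_space refl] by (intro borel_measurable_az row_index_subset)

section \<open>Tail bounds for a single net point\<close>

text \<open>A single term of the exponential series; \<open>s\<close> apportions the available
  exponent 1/4 among several factors.\<close>

lemma power_le_fact_exp:
  fixes y s :: real
  assumes "0 \<le> y" "0 < s"
  shows "y ^ k \<le> fact k * s ^ k * exp (y / s)"
proof -
  have "(y / s) ^ k / fact k \<le> exp (y / s)"
  proof -
    have "(\<Sum>i\<in>{k}. (y / s) ^ i /\<^sub>R fact i) \<le> (\<Sum>i. (y / s) ^ i /\<^sub>R fact i)"
      using assms by (intro sum_le_suminf summable_exp_generic) auto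
    then show ?thesis by (simp add: exp_def divide_inverse mult.commute)
  qed
  then show ?thesis using assms by (simp add: power_divide field_simps)
qed

text \<open>Separates a product of exponentials into a sum, so that no joint law of a_r^*x and
  a_r^*v enters.\<close>

lemma exp_eighth_le:
  fixes B t :: real
  shows "exp (B / 8) * exp (t / 8) \<le> (exp (B / 4) + exp (t / 4)) / 2"
proof -
  have "0 \<le> (exp (B / 8) - exp (t / 8))\<^sup>2" by simp
  moreover have "exp (B / 4) = exp (B / 8) * exp (B / 8)" "exp (t / 4) = exp (t / 8) * exp (t / 8)"
    by (simp_all flip: exp_add)
  ultimately show ?thesis by (simp add: power2_eq_square algebra_simps)
qed

lemma le_exp_sum: "u \<le> K * exp c \<Longrightarrow> 0 \<le> K \<Longrightarrow> u \<le> K * (exp b + exp c)"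
  for u K b c :: real
  by (simp add: distrib_left add_increasing)

context
  fixes m n :: nat
  assumes m0: "m > 0"
begin

interpretation G: prob_space "gauss_space m n" by (rule prob_space_gauss_space)

text \<open>The majorant has mean at most 4K by \<open>az_exp\<close>, so each deviation bound
  reduces to an expectation and a pointwise inequality in two complex numbers. Most callers take
  \<open>\<theta>\<close> equal or close to d/(4K).\<close>

lemma chernoff_az:
  fixes F :: "complex \<Rightarrow> complex \<Rightarrow> real"
  assumes F: "case_prod F \<in> borel_measurable (borel \<Otimes>\<^sub>M borel)"
    and x: "vnorm n x \<le> 1" and v: "vnorm n v \<le> 1"
    and int: "\<And>r. r < m \<Longrightarrow> integrable (gauss_space m n) (\<lambda>\<omega>. F (az n \<omega> r x) (az n \<omega> r v))"
    and A: "\<And>r. r < m \<Longrightarrow> G.expectation (\<lambda>\<omega>. F (az n \<omega> r x) (az n \<omega> r v)) \<le> A"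
    and le: "\<And>b c. (F b c)\<^sup>2 * exp (\<theta> * max (F b c) 0) \<le> K * (exp ((cmod b)\<^sup>2 / 4) + exp ((cmod c)\<^sup>2 / 4))"
    and th: "0 < \<theta>" "\<theta> * (4 * K) \<le> d" and K: "K \<ge> 0"
  defines "E \<equiv> {\<omega> \<in> space (gauss_space m n). A + d \<le> avg m (\<lambda>r. F (az n \<omega> r x) (az n \<omega> r v))}"
  shows "E \<in> G.events" and "G.prob E \<le> exp (- (real m * \<theta> * d / 2))"
proof -
  let ?D = "\<lambda>r \<omega>. K * (exp ((cmod (az n \<omega> r x))\<^sup>2 / 4) + exp ((cmod (az n \<omega> r v))\<^sup>2 / 4))"
  have D: "integrable (gauss_space m n) (?D r)" "G.expectation (?D r) \<le> 4 * K" if r: "r < m" for r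
  proof -
    note a = az_exp[OF r x] az_exp[OF r v]
    show "integrable (gauss_space m n) (?D r)" using a by simp
    have "G.expectation (?D r) = K * (G.expectation (\<lambda>\<omega>. exp ((cmod (az n \<omega> r x))\<^sup>2 / 4)) + G.expectation (\<lambda>\<omega>. exp ((cmod (az n \<omega> r v))\<^sup>2 / 4)))"
      using a by simp
    also have "\<dots> \<le> K * (2 + 2)" using a K by (intro mult_left_mono add_mono)
    finally show "G.expectation (?D r) \<le> 4 * K" by simp
  qed
  show "E \<in> G.events" "G.prob E \<le> exp (- (real m * \<theta> * d / 2))"
    unfolding E_def
    using G.chernoff_avg[where Z = "\<lambda>r \<omega>. F (az n \<omega> r x) (az n \<omega> r v)" and D = ?D, OF rows_indep[OF F] int A D le th m0]
    by blast+
qed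

text \<open>Here K = 64 and \<open>\<theta>\<close> is d/256. The exponent 1/4 is split as 1/5 for
  the factor t^2 and 1/20 for the exponential weight.\<close>

lemma prob_avg_az_sq_upper:
  assumes v: "vnorm n v \<le> 1" and d: "0 < d" "d \<le> 1"
  defines "E \<equiv> {\<omega> \<in> space (gauss_space m n). 1 + d \<le> avg m (\<lambda>r. (cmod (az n \<omega> r v))\<^sup>2)}"
  shows "E \<in> G.events" and "G.prob E \<le> exp (- (real m * d\<^sup>2 / 512))"
proof -
  define F :: "complex \<Rightarrow> complex \<Rightarrow> real" where "F = (\<lambda>b c. (cmod c)\<^sup>2)"
  have le: "(F b c)\<^sup>2 * exp (d/256 * max (F b c) 0) \<le> 64 * (exp ((cmod b)\<^sup>2 / 4) + exp ((cmod c)\<^sup>2 / 4))" for b c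
  proof -
    define t where "t = (cmod c)\<^sup>2"
    have t: "t \<ge> 0" by (simp add: t_def)
    have "t\<^sup>2 * exp (d/256 * max t 0) \<le> 64 * exp (t / 4)"
    proof -
      have mx: "max t 0 = t" using t by simp
      have "d / 256 * t \<le> 1/20 * t" using d t by (intro mult_right_mono) auto
      then have "exp (d/256 * t) \<le> exp (t / 20)" by simp
      then have "t\<^sup>2 * exp (d/256 * max t 0) \<le> (2 * 5\<^sup>2 * exp (t / 5)) * exp (t / 20)"
        unfolding mx using power_le_fact_exp[OF t, of 5 2]
        by (intro mult_mono) (simp_all add: fact_numeral)
      also have "\<dots> = 50 * exp (t / 4)" by (simp add: power2_eq_square flip: exp_add)
      finally show ?thesis using exp_gt_zero[of "t/4"] by linarith
    qed
    then show ?thesis unfolding F_def t_def[symmetric] by (intro le_exp_sum) simp_all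
  qed
  have m2: "\<And>r. r < m \<Longrightarrow> has_bochner_integral (gauss_space m n) (\<lambda>\<omega>. F (az n \<omega> r v) (az n \<omega> r v)) ((vnorm n v)\<^sup>2)"
    unfolding F_def by (rule az_moment2)
  have "(vnorm n v)\<^sup>2 \<le> 1" using v by (simp add: abs_square_le_1)
  then have m1: "G.expectation (\<lambda>\<omega>. F (az n \<omega> r v) (az n \<omega> r v)) \<le> 1" if "r < m" for r
    using has_bochner_integral_integral_eq[OF m2[OF that]] by simp
  have "case_prod F \<in> borel_measurable (borel \<Otimes>\<^sub>M borel)" unfolding F_def by measurable
  note C = chernoff_az[OF this v v integrable.intros[OF m2] m1 le]
  show "E \<in> G.events" unfolding E_def using C(1)[of d] d unfolding F_def by simp
  have "G.prob E \<le> exp (- (real m * (d/256) * d / 2))"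
    unfolding E_def using C(2)[of d] d unfolding F_def by simp
  then show "G.prob E \<le> exp (- (real m * d\<^sup>2 / 512))" by (simp add: power2_eq_square mult.assoc)
qed

text \<open>The negated square is nonpositive, so its exponential weight is 1 and a bound on t^2
  suffices.\<close>

lemma prob_avg_az_sq_lower:
  assumes x: "vnorm n x = 1" and d: "0 < d"
  defines "E \<equiv> {\<omega> \<in> space (gauss_space m n). - 1 + d \<le> avg m (\<lambda>r. - (cmod (az n \<omega> r x))\<^sup>2)}"
  shows "E \<in> G.events" and "G.prob E \<le> exp (- (real m * d\<^sup>2 / 512))"
proof -
  define F :: "complex \<Rightarrow> complex \<Rightarrow> real" where "F = (\<lambda>b c. - (cmod c)\<^sup>2)"
  have le: "(F b c)\<^sup>2 * exp (d/256 * max (F b c) 0) \<le> 64 * (exp ((cmod b)\<^sup>2 / 4) + exp ((cmod c)\<^sup>2 / 4))" for b c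
  proof -
    define t where "t = (cmod c)\<^sup>2"
    have t: "t \<ge> 0" by (simp add: t_def)
    have "t\<^sup>2 \<le> 32 * exp (t / 4)" using power_le_fact_exp[OF t, of 4 2] by (simp add: fact_numeral)
    then have "t\<^sup>2 \<le> 64 * exp (t / 4)" using exp_gt_zero[of "t/4"] by linarith
    then show ?thesis unfolding F_def t_def[symmetric] using t by (intro le_exp_sum) (simp_all add: max_def)
  qed
  have m2: "has_bochner_integral (gauss_space m n) (\<lambda>\<omega>. F (az n \<omega> r x) (az n \<omega> r x)) (- 1)" if "r < m" for r
    unfolding F_def using has_bochner_integral_minus[OF az_moment2[OF that, of n x]] x by simp
  have m1: "G.expectation (\<lambda>\<omega>. F (az n \<omega> r x) (az n \<omega> r x)) \<le> - 1" if "r < m" for r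
    using has_bochner_integral_integral_eq[OF m2[OF that]] by simp
  have "case_prod F \<in> borel_measurable (borel \<Otimes>\<^sub>M borel)" unfolding F_def by measurable
  note C = chernoff_az[OF this _ _ integrable.intros[OF m2] m1 le]
  show "E \<in> G.events" unfolding E_def using C(1)[of d] d x unfolding F_def by simp
  have "G.prob E \<le> exp (- (real m * (d/256) * d / 2))"
    unfolding E_def using C(2)[of d] d x unfolding F_def by simp
  then show "G.prob E \<le> exp (- (real m * d\<^sup>2 / 512))" by (simp add: power2_eq_square mult.assoc)
qed

text \<open>Fourth powers have an exponential bound on this side only. Here K = 4! * 4^4 = 6144 and
  \<open>\<theta>\<close> is d/(4K).\<close>

lemma prob_avg_az_4_lower:
  assumes x: "vnorm n x = 1" and d: "0 < d"
  defines "E \<equiv> {\<omega> \<in> space (gauss_space m n). - 2 + d \<le> avg m (\<lambda>r. - ((cmod (az n \<omega> r x)) ^ 4))}"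
  shows "E \<in> G.events" and "G.prob E \<le> exp (- (real m * d\<^sup>2 / 49152))"
proof -
  define F :: "complex \<Rightarrow> complex \<Rightarrow> real" where "F = (\<lambda>b c. - ((cmod c) ^ 4))"
  have le: "(F b c)\<^sup>2 * exp (d/24576 * max (F b c) 0) \<le> 6144 * (exp ((cmod b)\<^sup>2 / 4) + exp ((cmod c)\<^sup>2 / 4))" for b c
  proof -
    define t where "t = (cmod c)\<^sup>2"
    have t: "t \<ge> 0" by (simp add: t_def)
    have "t ^ 4 \<le> 6144 * exp (t / 4)" using power_le_fact_exp[OF t, of 4 4] by (simp add: fact_numeral)
    moreover have "(F b c)\<^sup>2 = t ^ 4" unfolding F_def t_def by (simp flip: power_mult)
    moreover have "max (F b c) 0 = 0" unfolding F_def by simp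
    ultimately show ?thesis unfolding t_def by (intro le_exp_sum) simp_all
  qed
  have m2: "has_bochner_integral (gauss_space m n) (\<lambda>\<omega>. F (az n \<omega> r x) (az n \<omega> r x)) (- 2)" if "r < m" for r
    unfolding F_def using has_bochner_integral_minus[OF az_moment4[OF that, of n x]] x by simp
  have m1: "G.expectation (\<lambda>\<omega>. F (az n \<omega> r x) (az n \<omega> r x)) \<le> - 2" if "r < m" for r
    using has_bochner_integral_integral_eq[OF m2[OF that]] by simp
  have "case_prod F \<in> borel_measurable (borel \<Otimes>\<^sub>M borel)" unfolding F_def by measurable
  note C = chernoff_az[OF this _ _ integrable.intros[OF m2] m1 le]
  show "E \<in> G.events" unfolding E_def using C(1)[of d] d x unfolding F_def by simp
  have "G.prob E \<le> exp (- (real m * (d/24576) * d / 2))"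
    unfolding E_def using C(2)[of d] d x unfolding F_def by simp
  then show "G.prob E \<le> exp (- (real m * d\<^sup>2 / 49152))" by (simp add: power2_eq_square mult.assoc)
qed

text \<open>Truncation creates an exponential moment: where |a_r^*x|^2 is at most T, the choice
  \<open>\<theta>\<close> = 1/(16T) keeps the exponent below |a_r^*v|^2/16. The lower limit on
  \<open>T\<close> is the condition \<open>\<theta> * (4 * K) \<le> 0.001\<close> with K =
  32768.\<close>

lemma prob_truncated_Y_upper:
  assumes x: "vnorm n x = 1" and v: "vnorm n v \<le> 1" and T: "T \<ge> 8192000"
  defines "E \<equiv> {\<omega> \<in> space (gauss_space m n). (1 + (cmod (cip n x v))\<^sup>2) + 0.001 \<le>
     avg m (\<lambda>r. if (cmod (az n \<omega> r x))\<^sup>2 \<le> T then (cmod (az n \<omega> r x))\<^sup>2 * (cmod (az n \<omega> r v))\<^sup>2 else 0)}"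
  shows "E \<in> G.events" and "G.prob E \<le> exp (- (real m / (32000 * T)))"
proof -
  define F :: "complex \<Rightarrow> complex \<Rightarrow> real" where "F = (\<lambda>b c. if (cmod b)\<^sup>2 \<le> T then (cmod b)\<^sup>2 * (cmod c)\<^sup>2 else 0)"
  have Tpos: "T > 0" using T by simp
  have le: "(F b c)\<^sup>2 * exp (1/(16*T) * max (F b c) 0) \<le> 32768 * (exp ((cmod b)\<^sup>2 / 4) + exp ((cmod c)\<^sup>2 / 4))" for b c
  proof (cases "(cmod b)\<^sup>2 \<le> T")
    case False
    then show ?thesis by (simp add: F_def add_nonneg_nonneg)
  next
    case True
    define B t where "B = (cmod b)\<^sup>2" and "t = (cmod c)\<^sup>2"
    have t: "t \<ge> 0" "B \<ge> 0" "B \<le> T" using True by (auto simp: t_def B_def)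
    have Fe: "F b c = B * t" using True by (simp add: F_def B_def t_def)
    have "1/(16*T) * (B * t) \<le> 1/(16*T) * (T * t)"
      using t Tpos by (intro mult_left_mono mult_right_mono) auto
    then have e: "exp (1/(16*T) * max (B * t) 0) \<le> exp (t/16)" using t Tpos by (simp add: max_def)
    have "(B * t)\<^sup>2 * exp (1/(16*T) * max (B * t) 0) = B\<^sup>2 * (t\<^sup>2 * exp (1/(16*T) * max (B * t) 0))"
      by (simp add: power_mult_distrib)
    also have "\<dots> \<le> (128 * exp (B/8)) * ((512 * exp (t/16)) * exp (t/16))"
      using power_le_fact_exp[OF t(2), of 8 2] power_le_fact_exp[OF t(1), of 16 2] e
      by (intro mult_mono) (auto simp: fact_numeral)
    also have "\<dots> = 65536 * (exp (B/8) * exp (t/8))" by (simp flip: exp_add)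
    also have "\<dots> \<le> 65536 * ((exp (B / 4) + exp (t / 4)) / 2)" by (intro mult_left_mono exp_eighth_le) auto
    finally show ?thesis unfolding Fe B_def t_def by simp
  qed
  have F: "case_prod F \<in> borel_measurable (borel \<Otimes>\<^sub>M borel)" unfolding F_def by measurable
  have int: "integrable (gauss_space m n) (\<lambda>\<omega>. F (az n \<omega> r x) (az n \<omega> r v))"
    and A: "G.expectation (\<lambda>\<omega>. F (az n \<omega> r x) (az n \<omega> r v)) \<le> 1 + (cmod (cip n x v))\<^sup>2" if r: "r < m" for r
  proof -
    let ?H = "\<lambda>\<omega>. (cmod (az n \<omega> r x))\<^sup>2 * (cmod (az n \<omega> r v))\<^sup>2"
    note H = mixed_moments(1)[OF r x, of v]
    have le: "F (az n \<omega> r x) (az n \<omega> r v) \<le> ?H \<omega>" "0 \<le> F (az n \<omega> r x) (az n \<omega> r v)" for \<omega>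
      by (auto simp: F_def)
    have meas: "(\<lambda>\<omega>. F (az n \<omega> r x) (az n \<omega> r v)) \<in> borel_measurable (gauss_space m n)"
      using measurable_compose[OF measurable_Pair[OF borel_measurable_az_gauss[OF r] borel_measurable_az_gauss[OF r]] F, of n x v]
      by simp
    show int: "integrable (gauss_space m n) (\<lambda>\<omega>. F (az n \<omega> r x) (az n \<omega> r v))"
      by (rule Bochner_Integration.integrable_bound[OF integrable.intros[OF H] meas])
         (use le in \<open>auto intro!: AE_I2 order_trans[OF _ abs_ge_self]\<close>)
    have "G.expectation (\<lambda>\<omega>. F (az n \<omega> r x) (az n \<omega> r v)) \<le> G.expectation ?H"
      using le by (intro integral_mono int integrable.intros[OF H]) auto
    also have "\<dots> = (vnorm n v)\<^sup>2 + (cmod (cip n x v))\<^sup>2" by (rule has_bochner_integral_integral_eq[OF H])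
    also have "\<dots> \<le> 1 + (cmod (cip n x v))\<^sup>2" using v by (simp add: abs_square_le_1)
    finally show "G.expectation (\<lambda>\<omega>. F (az n \<omega> r x) (az n \<omega> r v)) \<le> 1 + (cmod (cip n x v))\<^sup>2" .
  qed
  have x': "vnorm n x \<le> 1" using x by simp
  note C = chernoff_az[OF F x' v int A le, of "0.001"]
  have th: "0 < 1/(16*T)" "1/(16*T) * (4 * 32768) \<le> 0.001" using T by (auto simp: field_simps)
  show "E \<in> G.events" unfolding E_def using C(1)[OF _ _ th] unfolding F_def by simp
  have "G.prob E \<le> exp (- (real m * (1/(16*T)) * 0.001 / 2))"
    unfolding E_def using C(2)[OF _ _ th] unfolding F_def by simp
  then show "G.prob E \<le> exp (- (real m / (32000 * T)))" by (simp add: field_simps)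
qed

text \<open>The averaged square is of degree four in the samples, but being nonnegative it has a
  good lower tail. The mean is bounded from below uniformly in Re (x^*v), at the cost of
  1/24.\<close>

lemma prob_curvature_lower:
  assumes x: "vnorm n x = 1" and v: "vnorm n v \<le> 1" and s: "0 \<le> \<sigma>" "\<sigma> \<le> 1/8"
  defines "E \<equiv> {\<omega> \<in> space (gauss_space m n).
     - (9/8 * (vnorm n v)\<^sup>2 - 9/8 * (Im (cip n x v))\<^sup>2 - 1/24) + 1/100 \<le>
     avg m (\<lambda>r. - (3/2 * Re (cnj (az n \<omega> r v) * az n \<omega> r x) + \<sigma> * (cmod (az n \<omega> r v))\<^sup>2)\<^sup>2)}"
  shows "E \<in> G.events" and "G.prob E \<le> exp (- (real m / 4000000000))"
proof -
  define F :: "complex \<Rightarrow> complex \<Rightarrow> real" where "F = (\<lambda>b c. - (3/2 * Re (cnj c * b) + \<sigma> * (cmod c)\<^sup>2)\<^sup>2)"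
  have le: "(F b c)\<^sup>2 * exp (1/20000000 * max (F b c) 0) \<le> 49152 * (exp ((cmod b)\<^sup>2 / 4) + exp ((cmod c)\<^sup>2 / 4))" for b c
  proof -
    define B t where "B = (cmod b)\<^sup>2" and "t = (cmod c)\<^sup>2"
    define y where "y = 3/2 * Re (cnj c * b) + \<sigma> * t"
    have t: "t \<ge> 0" "B \<ge> 0" by (auto simp: t_def B_def)
    have "\<bar>Re (cnj c * b)\<bar> \<le> cmod c * cmod b" using abs_Re_le_cmod[of "cnj c * b"] by (simp add: norm_mult)
    moreover have "2 * (cmod c * cmod b) \<le> B + t"
      using zero_le_power2[of "cmod c - cmod b"] unfolding B_def t_def by (simp add: power2_eq_square algebra_simps)
    moreover have "0 \<le> \<sigma> * t" "\<sigma> * t \<le> 1/8 * t" using s t by (simp, intro mult_right_mono)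
    ultimately have "\<bar>y\<bar> \<le> B + t" unfolding y_def using t by linarith
    then have "\<bar>y\<bar> ^ 4 \<le> (B + t) ^ 4" by (intro power_mono) auto
    also have "\<dots> \<le> 98304 * exp ((B + t) / 8)"
      using power_le_fact_exp[of "B + t" 8 4] t by (simp add: fact_numeral)
    also have "\<dots> = 98304 * (exp (B / 8) * exp (t / 8))" by (simp add: add_divide_distrib exp_add)
    also have "\<dots> \<le> 98304 * ((exp (B / 4) + exp (t / 4)) / 2)" by (intro mult_left_mono exp_eighth_le) auto
    finally have "y ^ 4 \<le> 49152 * (exp (B / 4) + exp (t / 4))" by (simp add: power_even_abs)
    moreover have "(F b c)\<^sup>2 = y ^ 4" unfolding F_def y_def t_def by (simp flip: power_mult)
    moreover have "max (F b c) 0 = 0" unfolding F_def by simp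
    ultimately show ?thesis unfolding B_def t_def by simp
  qed
  have F: "case_prod F \<in> borel_measurable (borel \<Otimes>\<^sub>M borel)"
  proof -
    have "continuous_on UNIV (case_prod F)" unfolding F_def case_prod_beta by (intro continuous_intros)
    then have "case_prod F \<in> borel_measurable borel" by (rule borel_measurable_continuous_onI)
    then show ?thesis by (simp only: borel_prod)
  qed
  define V where "V = (vnorm n v)\<^sup>2"
  define a where "a = Re (cip n x v)"
  have mm: "has_bochner_integral (gauss_space m n) (\<lambda>\<omega>. F (az n \<omega> r x) (az n \<omega> r v))
     (- (9/8 * V + 27/8 * a\<^sup>2 - 9/8 * (Im (cip n x v))\<^sup>2 + 6 * \<sigma> * a * V + 2 * \<sigma>\<^sup>2 * V\<^sup>2))" if r: "r < m" for r
    unfolding F_def V_def a_def by (intro has_bochner_integral_minus mixed_moments(2) r x)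
  have A: "G.expectation (\<lambda>\<omega>. F (az n \<omega> r x) (az n \<omega> r v)) \<le> - (9/8 * (vnorm n v)\<^sup>2 - 9/8 * (Im (cip n x v))\<^sup>2 - 1/24)" if r: "r < m" for r
  proof -
    have "V \<le> 1" "V \<ge> 0" using v by (auto simp: V_def abs_square_le_1)
    define w where "w = \<sigma> * V"
    have "w \<le> 1/8 * 1" unfolding w_def using s \<open>V \<le> 1\<close> \<open>V \<ge> 0\<close> by (intro mult_mono) auto
    moreover have "0 \<le> w" unfolding w_def using s \<open>V \<ge> 0\<close> by simp
    ultimately have "w\<^sup>2 \<le> (1/8)\<^sup>2" by (intro power_mono) auto
    then have w2: "w\<^sup>2 \<le> 1/64" by (simp add: power_divide)
    \<comment> \<open>The minimum of 27/8 a^2 + 6 a w over a is -8/3 w^2, which is at least -1/24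
      for w at most 1/8.\<close>
    have "0 \<le> 27/8 * (a + 8/9 * w)\<^sup>2" by simp
    also have "(a + 8/9 * w)\<^sup>2 = a\<^sup>2 + 16/9 * (a * w) + 64/81 * w\<^sup>2"
      by (simp add: power2_sum power_mult_distrib power_divide)
    finally have "- (1/24) \<le> 27/8 * a\<^sup>2 + 6 * (a * w)" using w2 by (simp add: field_simps)
    moreover have "6 * (a * w) = 6 * \<sigma> * a * V" by (simp add: w_def)
    ultimately have "- (1/24) \<le> 27/8 * a\<^sup>2 + 6 * \<sigma> * a * V" by simp
    moreover have "0 \<le> 2 * \<sigma>\<^sup>2 * V\<^sup>2" by simp
    ultimately have "- (9/8 * V + 27/8 * a\<^sup>2 - 9/8 * (Im (cip n x v))\<^sup>2 + 6 * \<sigma> * a * V + 2 * \<sigma>\<^sup>2 * V\<^sup>2)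
      \<le> - (9/8 * V - 9/8 * (Im (cip n x v))\<^sup>2 - 1/24)" by linarith
    then show ?thesis
      using has_bochner_integral_integral_eq[OF mm[OF r]] unfolding V_def[symmetric] by simp
  qed
  have x': "vnorm n x \<le> 1" using x by simp
  have E: "E = {\<omega> \<in> space (gauss_space m n). - (9/8 * (vnorm n v)\<^sup>2 - 9/8 * (Im (cip n x v))\<^sup>2 - 1/24) + 1/100
      \<le> avg m (\<lambda>r. F (az n \<omega> r x) (az n \<omega> r v))}"
    unfolding E_def F_def ..
  have th: "0 < 1/(20000000::real)" "1/20000000 * (4 * 49152) \<le> (1/100::real)" "0 \<le> (49152::real)" by simp_all
  note C = chernoff_az[OF F x' v integrable.intros[OF mm] A le th]
  show "E \<in> G.events" unfolding E by (rule C(1))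
  have e: "real m * (1/20000000) * (1/100) / 2 = real m / 4000000000" by simp
  show "G.prob E \<le> exp (- (real m / 4000000000))"
    using C(2) unfolding E e .
qed

section \<open>Exceptional rows: truncation error and long sampling vectors\<close>

lemma vnorm_samp_sq: "(vnorm n (samp \<omega> r))\<^sup>2 = (\<Sum>i\<in>row_index n r. (\<omega> i)\<^sup>2)"
  unfolding sum_row_index vnorm_sq cmod_power2 by (simp add: samp_def)

lemma samp_unit: "j < n \<Longrightarrow> cmod (az n \<omega> r (\<lambda>i. if i = j then 1 else 0)) = cmod (samp \<omega> r j)"
  unfolding az_def by (simp add: if_distrib[of "\<lambda>y. _ * y"] sum.delta cong: if_cong)

lemma vnorm_unit: "j < n \<Longrightarrow> vnorm n (\<lambda>i. if i = j then 1 else 0) = 1"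
  unfolding vnorm_def by (simp add: if_distrib[of cmod] if_distrib[of "\<lambda>y. y\<^sup>2"] sum.delta cong: if_cong)

text \<open>With |a_r|^2 in place of |a_r^*v|^2 a single event serves every v. Splitting |a_r|^2
  over the unit vectors leaves products of two squares, and B > T trades exp (B/16) for exp (-T/16)
  exp (B/8).\<close>

lemma prob_Y_tail:
  fixes T :: real
  assumes x: "vnorm n x = 1" and d: "d > 0"
  defines "E \<equiv> {\<omega> \<in> space (gauss_space m n). d \<le>
     avg m (\<lambda>r. if (cmod (az n \<omega> r x))\<^sup>2 \<le> T then 0 else (cmod (az n \<omega> r x))\<^sup>2 * (vnorm n (samp \<omega> r))\<^sup>2)}"
  shows "E \<in> G.events" and "G.prob E \<le> 256 * real n * exp (- (T / 16)) / d"
proof -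
  define Z where "Z r \<omega> = (if (cmod (az n \<omega> r x))\<^sup>2 \<le> T then 0 else (cmod (az n \<omega> r x))\<^sup>2 * (vnorm n (samp \<omega> r))\<^sup>2)" for r \<omega>
  define e where "e j = (\<lambda>i. if i = j then 1 else 0 :: complex)" for j :: nat
  define D where "D r \<omega> = (\<Sum>j<n. 64 * exp (- (T / 16)) * (exp ((cmod (az n \<omega> r x))\<^sup>2 / 4) + exp ((cmod (az n \<omega> r (e j)))\<^sup>2 / 4)))" for r \<omega>
  have ZD: "0 \<le> Z r \<omega>" "Z r \<omega> \<le> D r \<omega>" for r \<omega>
  proof -
    show "0 \<le> Z r \<omega>" by (simp add: Z_def)
    show "Z r \<omega> \<le> D r \<omega>"
    proof (cases "(cmod (az n \<omega> r x))\<^sup>2 \<le> T")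
      case True
      then show ?thesis by (simp add: Z_def D_def sum_nonneg add_nonneg_nonneg)
    next
      case False
      define B where "B = (cmod (az n \<omega> r x))\<^sup>2"
      have B: "B \<ge> 0" "B > T" using False by (auto simp: B_def)
      have "Z r \<omega> = (\<Sum>j<n. B * (cmod (az n \<omega> r (e j)))\<^sup>2)"
        using False unfolding Z_def B_def vnorm_sq sum_distrib_left by (simp add: e_def samp_unit)
      also have "\<dots> \<le> D r \<omega>" unfolding D_def B_def[symmetric]
      proof (intro sum_mono)
        fix j
        define t where "t = (cmod (az n \<omega> r (e j)))\<^sup>2"
        have t: "t \<ge> 0" by (simp add: t_def)
        have "B * t \<le> (16 * exp (B/16)) * (8 * exp (t/8))"
          using power_le_fact_exp[OF B(1), of 16 1] power_le_fact_exp[OF t, of 8 1] t B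
          by (intro mult_mono) auto
        also have "\<dots> \<le> 128 * exp (- (T/16)) * (exp (B/8) * exp (t/8))"
        proof -
          have "exp (B/16) \<le> exp (- (T/16)) * exp (B/8)"
            using B by (simp flip: exp_add)
          then have "(16 * exp (B/16)) * (8 * exp (t/8)) \<le> (16 * (exp (- (T/16)) * exp (B/8))) * (8 * exp (t/8))"
            by (intro mult_right_mono mult_left_mono) auto
          then show ?thesis by (simp add: mult_ac)
        qed
        also have "\<dots> \<le> 128 * exp (- (T/16)) * ((exp (B / 4) + exp (t / 4)) / 2)"
          by (intro mult_left_mono exp_eighth_le) auto
        finally show "B * (cmod (az n \<omega> r (e j)))\<^sup>2 \<le> 64 * exp (- (T/16)) * (exp (B / 4) + exp ((cmod (az n \<omega> r (e j)))\<^sup>2 / 4))"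
          unfolding t_def by simp
      qed
      finally show ?thesis .
    qed
  qed
  have xl: "vnorm n x \<le> 1" using x by simp
  have intD: "integrable (gauss_space m n) (D r)" and ED: "G.expectation (D r) \<le> 256 * real n * exp (- (T / 16))" if r: "r < m" for r
  proof -
    have ej: "vnorm n (e j) \<le> 1" if "j < n" for j using that by (simp add: e_def vnorm_unit)
    note a = az_exp[OF r xl] and b = az_exp[OF r ej]
    let ?S = "\<lambda>j \<omega>. 64 * exp (- (T / 16)) * (exp ((cmod (az n \<omega> r x))\<^sup>2 / 4) + exp ((cmod (az n \<omega> r (e j)))\<^sup>2 / 4))"
    have i: "integrable (gauss_space m n) (?S j)" if "j < n" for j using a b[OF that] by simp
    then show "integrable (gauss_space m n) (D r)" unfolding D_def by (intro Bochner_Integration.integrable_sum) auto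
    have "G.expectation (D r) = (\<Sum>j<n. G.expectation (?S j))"
      unfolding D_def using i by (intro Bochner_Integration.integral_sum) auto
    also have "\<dots> \<le> (\<Sum>j<n. 256 * exp (- (T / 16)))"
    proof (intro sum_mono)
      fix j assume j: "j \<in> {..<n}"
      then have "G.expectation (?S j) = 64 * exp (- (T / 16)) * (G.expectation (\<lambda>\<omega>. exp ((cmod (az n \<omega> r x))\<^sup>2 / 4)) + G.expectation (\<lambda>\<omega>. exp ((cmod (az n \<omega> r (e j)))\<^sup>2 / 4)))"
        using a b[of j] by simp
      also have "\<dots> \<le> 64 * exp (- (T / 16)) * (2 + 2)"
        using a b[of j] j by (intro mult_left_mono add_mono) auto
      finally show "G.expectation (?S j) \<le> 256 * exp (- (T / 16))" by simp
    qed
    finally show "G.expectation (D r) \<le> 256 * real n * exp (- (T / 16))" by simp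
  qed
  have intZ: "integrable (gauss_space m n) (Z r)" if r: "r < m" for r
  proof (rule Bochner_Integration.integrable_bound[OF intD[OF r]])
    have c[measurable]: "(\<lambda>\<omega>. \<omega> i) \<in> borel_measurable (gauss_space m n)" if "i \<in> row_index n r" for i
      using that row_index_subset[OF r] by (intro measurable_coord) auto
    have s: "(\<lambda>\<omega>. \<Sum>i\<in>row_index n r. (\<omega> i)\<^sup>2) \<in> borel_measurable (gauss_space m n)"
      by (intro borel_measurable_sum borel_measurable_power c)
    note [measurable] = borel_measurable_az_gauss[OF r, of n x] s
    show "Z r \<in> borel_measurable (gauss_space m n)" unfolding Z_def vnorm_samp_sq by measurable
  qed (use ZD in \<open>auto intro!: AE_I2 order_trans[OF _ abs_ge_self]\<close>)
  have EZ: "G.expectation (Z r) \<le> 256 * real n * exp (- (T / 16))" if "r < m" for r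
    using integral_mono[OF intZ[OF that] intD[OF that] ZD(2)] ED[OF that] by simp
  show "E \<in> G.events" "G.prob E \<le> 256 * real n * exp (- (T / 16)) / d"
    unfolding E_def Z_def[symmetric] by (rule G.markov_avg[OF intZ EZ ZD(1) m0 d]; assumption)+
qed

text \<open>|a_r|^2 is a sum of 2n independent squares, so exp (|a_r|^2/2) has mean at most (sqrt
  2)^(2n) = 2^n. Beyond 8n the fourth power of |a_r| is below 32 exp (-2n) exp (|a_r|^2/2), and exp
  (-2n) beats 2^n.\<close>

lemma prob_samp_tail:
  defines "E \<equiv> {\<omega> \<in> space (gauss_space m n). 1 \<le>
     avg m (\<lambda>r. if (vnorm n (samp \<omega> r))\<^sup>2 > 8 * real n then (vnorm n (samp \<omega> r)) ^ 4 else 0)}"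
  shows "E \<in> G.events" and "G.prob E \<le> 32 * 2 ^ n * exp (- (2 * real n))"
proof -
  define Z where "Z r \<omega> = (if (vnorm n (samp \<omega> r))\<^sup>2 > 8 * real n then (vnorm n (samp \<omega> r)) ^ 4 else 0)" for r \<omega>
  define D where "D r \<omega> = 32 * exp (- (2 * real n)) * (\<Prod>i\<in>row_index n r. exp ((\<omega> i)\<^sup>2 / 2))" for r \<omega>
  have p4: "((u::real)\<^sup>2)\<^sup>2 = u ^ 4" for u by (simp flip: power_mult)
  have ZD: "0 \<le> Z r \<omega>" "Z r \<omega> \<le> D r \<omega>" for r \<omega>
  proof -
    show "0 \<le> Z r \<omega>" by (simp add: Z_def)
    define y where "y = (vnorm n (samp \<omega> r))\<^sup>2"
    have "(\<Prod>i\<in>row_index n r. exp ((\<omega> i)\<^sup>2 / 2)) = exp (y / 2)"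
      unfolding y_def vnorm_samp_sq by (simp add: exp_sum[OF finite_row_index] sum_divide_distrib)
    then have D: "D r \<omega> = 32 * exp (- (2 * real n)) * exp (y / 2)" by (simp add: D_def)
    show "Z r \<omega> \<le> D r \<omega>"
    proof (cases "y > 8 * real n")
      case False
      then show ?thesis unfolding D by (simp add: Z_def y_def)
    next
      case True
      have "Z r \<omega> = y\<^sup>2" using True unfolding Z_def y_def p4 by simp
      also have "\<dots> \<le> 32 * exp (y / 4)" using power_le_fact_exp[of y 4 2] by (simp add: y_def fact_numeral)
      also have "\<dots> \<le> 32 * (exp (- (2 * real n)) * exp (y / 2))" using True by (simp flip: exp_add)
      finally show ?thesis unfolding D by simp
    qed
  qed
  have intD: "integrable (gauss_space m n) (D r)" and ED: "G.expectation (D r) \<le> 32 * 2 ^ n * exp (- (2 * real n))" if r: "r < m" for r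
  proof -
    have "G.indep_vars (\<lambda>_. borel) (\<lambda>i \<omega>. \<omega> i) (row_index n r)"
      using coord_indep by (rule G.indep_vars_subset) (rule row_index_subset[OF r])
    then have ind: "G.indep_vars (\<lambda>_. borel) (\<lambda>i \<omega>. exp ((\<omega> i)\<^sup>2 / 2)) (row_index n r)"
      by (rule G.indep_vars_compose2[where Y = "\<lambda>i y. exp (y\<^sup>2 / 2)"]) simp
    have one: "integrable (gauss_space m n) (\<lambda>\<omega>. exp ((\<omega> i)\<^sup>2 / 2))" "G.expectation (\<lambda>\<omega>. exp ((\<omega> i)\<^sup>2 / 2)) \<le> sqrt 2"
      if "i \<in> row_index n r" for i
      using linear_facts(3,4)[of "{i}" m n "\<lambda>_. 1"] that row_index_subset[OF r] by auto
    have intP: "integrable (gauss_space m n) (\<lambda>\<omega>. \<Prod>i\<in>row_index n r. exp ((\<omega> i)\<^sup>2 / 2))"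
      using one(1) by (intro G.indep_vars_integrable finite_row_index ind)
    then show "integrable (gauss_space m n) (D r)" unfolding D_def by simp
    have "G.expectation (\<lambda>\<omega>. \<Prod>i\<in>row_index n r. exp ((\<omega> i)\<^sup>2 / 2)) = (\<Prod>i\<in>row_index n r. G.expectation (\<lambda>\<omega>. exp ((\<omega> i)\<^sup>2 / 2)))"
      using one(1) by (intro G.indep_vars_lebesgue_integral finite_row_index ind)
    also have "\<dots> \<le> (\<Prod>i\<in>row_index n r. sqrt 2)"
      using one(2) by (intro prod_mono) (auto intro!: integral_nonneg)
    also have "\<dots> = 2 ^ n" by (simp add: row_index_def card_cartesian_product mult_2_right power_add flip: power_mult_distrib)
    finally show "G.expectation (D r) \<le> 32 * 2 ^ n * exp (- (2 * real n))"
      unfolding D_def using intP by (simp add: mult_ac)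
  qed
  have intZ: "integrable (gauss_space m n) (Z r)" if r: "r < m" for r
  proof (rule Bochner_Integration.integrable_bound[OF intD[OF r]])
    have c: "(\<lambda>\<omega>. \<omega> i) \<in> borel_measurable (gauss_space m n)" if "i \<in> row_index n r" for i
      using that row_index_subset[OF r] by (intro measurable_coord) auto
    have [measurable]: "(\<lambda>\<omega>. \<Sum>i\<in>row_index n r. (\<omega> i)\<^sup>2) \<in> borel_measurable (gauss_space m n)"
      by (intro borel_measurable_sum borel_measurable_power c)
    show "Z r \<in> borel_measurable (gauss_space m n)" unfolding Z_def p4[symmetric] vnorm_samp_sq by measurable
  qed (use ZD in \<open>auto intro!: AE_I2 order_trans[OF _ abs_ge_self]\<close>)
  have EZ: "G.expectation (Z r) \<le> 32 * 2 ^ n * exp (- (2 * real n))" if "r < m" for r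
    using integral_mono[OF intZ[OF that] intD[OF that] ZD(2)] ED[OF that] by simp
  have "{\<omega> \<in> space (gauss_space m n). 1 \<le> avg m (\<lambda>r. Z r \<omega>)} \<in> G.events"
    "G.prob {\<omega> \<in> space (gauss_space m n). 1 \<le> avg m (\<lambda>r. Z r \<omega>)} \<le> 32 * 2 ^ n * exp (- (2 * real n)) / 1"
    by (rule G.markov_avg[OF intZ EZ ZD(1) m0 zero_less_one]; assumption)+
  then show "E \<in> G.events" "G.prob E \<le> 32 * 2 ^ n * exp (- (2 * real n))"
    unfolding E_def Z_def by simp_all
qed

end

section \<open>The good event\<close>

lemma (in prob_space) prob_UN_le_card:
  assumes "finite N" and E: "\<And>v. v \<in> N \<Longrightarrow> E v \<in> events" "\<And>v. v \<in> N \<Longrightarrow> prob (E v) \<le> p"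
  shows "(\<Union>v\<in>N. E v) \<in> events" and "prob (\<Union>v\<in>N. E v) \<le> real (card N) * p"
proof -
  show "(\<Union>v\<in>N. E v) \<in> events" using assms by auto
  have "prob (\<Union>v\<in>N. E v) \<le> (\<Sum>v\<in>N. prob (E v))"
    using assms by (intro finite_measure_subadditive_finite) auto
  also have "\<dots> \<le> real (card N) * p" using E(2) by (rule sum_bounded_above)
  finally show "prob (\<Union>v\<in>N. E v) \<le> real (card N) * p" .
qed

lemma (in prob_space) prob_Diff_UN:
  assumes B: "\<And>i. i < (k::nat) \<Longrightarrow> B i \<in> events" "\<And>i. i < k \<Longrightarrow> prob (B i) \<le> p"
  shows "space M - (\<Union>i<k. B i) \<in> events" and "prob (space M - (\<Union>i<k. B i)) \<ge> 1 - real k * p"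
proof -
  note U = prob_UN_le_card[of "{..<k}" B p]
  show "space M - (\<Union>i<k. B i) \<in> events" using U B by auto
  have "prob (\<Union>i<k. B i) \<le> real k * p" using U(2) B by simp
  then show "prob (space M - (\<Union>i<k. B i)) \<ge> 1 - real k * p"
    using prob_compl[OF U(1)] B by simp
qed

text \<open>The mesh is chosen for covering radius 1/2000, whence 1/\<delta>^2 = 8 * 10^6 n in the
  second count of \<open>net_exists\<close>; ln 2 <= 1 and 9 <= e^3 give 8000003.\<close>

lemma coarse_net:
  assumes n: "n > 0"
  obtains N where "finite N" "\<And>v. v \<in> N \<Longrightarrow> vnorm n v \<le> 1"
    "\<And>v. vnorm n v \<le> 1 \<Longrightarrow> \<exists>v'\<in>N. vnorm n (\<lambda>j. v j - v' j) \<le> 1/2000"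
    "real (card N) \<le> exp (8000003 * real n)"
proof -
  define \<delta> where "\<delta> = 1 / (2000 * sqrt (2 * real n))"
  have d: "\<delta> > 0" "\<delta> * sqrt (2 * real n) = 1/2000" "1 / \<delta>\<^sup>2 = 8000000 * real n"
    using n by (auto simp: \<delta>_def power_divide power_mult_distrib)
  obtain N where N: "finite N" "\<And>v. v \<in> N \<Longrightarrow> vnorm n v \<le> 1"
    "\<And>v. vnorm n v \<le> 1 \<Longrightarrow> \<exists>v'\<in>N. vnorm n (\<lambda>j. v j - v' j) \<le> \<delta> * sqrt (2 * real n)"
    "real (card N) \<le> 2 powr (1 / \<delta>\<^sup>2) * 9 ^ n"
    by (rule net_exists[OF d(1), of n], rule that)
  have "2 powr (1 / \<delta>\<^sup>2) \<le> exp (8000000 * real n)"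
    unfolding d(3) powr_def using ln_le_minus_one[of 2] mult_left_mono[of "ln 2" 1 "8000000 * real n"] by simp
  moreover have "(9::real) ^ n \<le> exp (3 * real n)"
  proof -
    have "(5/2) ^ 3 \<le> exp (1::real) ^ 3"
      using exp_lower_Taylor_quadratic[of "1::real"] by (intro power_mono) auto
    moreover have "exp (3::real) = exp 1 ^ 3" by (simp flip: exp_of_nat_mult)
    moreover have "(9::real) \<le> (5/2) ^ 3" by (simp add: power3_eq_cube)
    ultimately have "(9::real) \<le> exp 3" by linarith
    then have "(9::real) ^ n \<le> exp 3 ^ n" by (intro power_mono) auto
    then show ?thesis by (simp add: mult.commute flip: exp_of_nat_mult)
  qed
  ultimately have "2 powr (1 / \<delta>\<^sup>2) * 9 ^ n \<le> exp (8000000 * real n) * exp (3 * real n)"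
    by (intro mult_mono) auto
  also have "\<dots> = exp (8000003 * real n)" by (simp flip: exp_add)
  finally have "real (card N) \<le> exp (8000003 * real n)" using N(4) by simp
  then show ?thesis using N(1-3) unfolding d(2) by (intro that)
qed

text \<open>With grid mesh 1/n^2 the box count (2 n^2 + 1)^(2n) is at most n^(6n). The ln n in its
  exponent is matched by the one in the sample size.\<close>

lemma fine_net:
  assumes n: "n \<ge> 3"
  obtains N where "finite N" "\<And>v. v \<in> N \<Longrightarrow> vnorm n v \<le> 1"
    "\<And>v. vnorm n v \<le> 1 \<Longrightarrow> \<exists>v'\<in>N. vnorm n (\<lambda>j. v j - v' j) \<le> 1 / real n"
    "real (card N) \<le> exp (6 * real n * ln (real n))"
proof -
  define \<delta> where "\<delta> = 1 / (real n)\<^sup>2"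
  have npos: "real n \<ge> 3" using n by simp
  have d: "\<delta> > 0" using n by (simp add: \<delta>_def)
  have "sqrt (2 * real n) \<le> real n"
    using npos by (intro real_le_lsqrt) (auto simp: power2_eq_square)
  then have "\<delta> * sqrt (2 * real n) \<le> \<delta> * real n" using d by (intro mult_left_mono) auto
  also have "\<dots> = 1 / real n" using npos by (simp add: \<delta>_def power2_eq_square)
  finally have d2: "\<delta> * sqrt (2 * real n) \<le> 1 / real n" .
  obtain N where N: "finite N" "\<And>v. v \<in> N \<Longrightarrow> vnorm n v \<le> 1"
    "\<And>v. vnorm n v \<le> 1 \<Longrightarrow> \<exists>v'\<in>N. vnorm n (\<lambda>j. v j - v' j) \<le> \<delta> * sqrt (2 * real n)"
    "real (card N) \<le> (2 / \<delta> + 1) ^ (2 * n)"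
    by (rule net_exists[OF d, of n], rule that)
  have "2 / \<delta> + 1 \<le> real n ^ 3"
  proof -
    have "2 / \<delta> + 1 = 2 * (real n)\<^sup>2 + 1" by (simp add: \<delta>_def)
    also have "\<dots> \<le> 3 * (real n)\<^sup>2" using npos by (simp add: power2_eq_square) (use mult_mono[of 1 "real n" 1 "real n"] in simp)
    also have "\<dots> \<le> real n * (real n)\<^sup>2" using npos by (intro mult_right_mono) auto
    finally show ?thesis by (simp add: power2_eq_square power3_eq_cube)
  qed
  then have "(2 / \<delta> + 1) ^ (2 * n) \<le> (real n ^ 3) ^ (2 * n)" using d by (intro power_mono) auto
  also have "\<dots> = real n ^ (6 * n)" by (simp flip: power_mult)
  also have "\<dots> = exp (6 * real n * ln (real n))"
  proof -
    have "real n ^ (6 * n) = exp (ln (real n)) ^ (6 * n)" using npos by simp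
    then show ?thesis by (simp only: exp_of_nat_mult[symmetric]) simp
  qed
  finally have "real (card N) \<le> exp (6 * real n * ln (real n))" using N(4) by simp
  moreover have "\<exists>v'\<in>N. vnorm n (\<lambda>j. v j - v' j) \<le> 1 / real n" if "vnorm n v \<le> 1" for v
    using N(3)[OF that] d2 order_trans by blast
  ultimately show ?thesis using N(1,2) by (intro that)
qed

text \<open>The threshold for ln n makes T = 80 ln n reach the 8192000 required by
  \<open>prob_truncated_Y_upper\<close>.\<close>

lemma good_samples_event:
  fixes n m :: nat and x :: "nat \<Rightarrow> complex"
  assumes n: "ln (real n) \<ge> 102400" and m: "real m \<ge> 10 ^ 14 * real n * ln (real n)" and x: "vnorm n x = 1"
  shows "\<exists>E\<in>sets (gauss_space m n). measure (gauss_space m n) E \<ge> 1 - 8 / (real n)\<^sup>2 \<and>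
    (\<forall>\<omega>\<in>E. init_samples m n \<omega> x \<and> regular_samples m n \<omega> x 33)"
proof -
  interpret G: prob_space "gauss_space m n" by (rule prob_space_gauss_space)
  let ?S = "space (gauss_space m n)"
  have npos: "n > 0" using n by (cases "n = 0") auto
  have nbig: "real n \<ge> 102400" using ln_le_minus_one[of "real n"] n npos by simp
  have mn: "real m \<ge> 10 ^ 14 * real n"
  proof -
    have "10 ^ 14 * real n * 1 \<le> 10 ^ 14 * real n * ln (real n)" using n by (intro mult_left_mono) auto
    then show ?thesis using m by simp
  qed
  have m0: "m > 0" using mn nbig by (cases "m = 0") auto
  \<comment> \<open>Truncation level: \<open>T\<close> costs a factor \<open>ln n\<close> in the Chernoff exponent, which \<open>m \<ge> c0 n ln n\<close> pays for,
    and leaves a tail of size \<open>n\<^sup>-\<^sup>4\<close> to Markov's inequality, uniformly in \<open>m\<close>.\<close>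
  define T where "T = 80 * ln (real n)"
  have T: "T \<ge> 8192000" using n by (simp add: T_def)
  define p where "p = 1 / (real n)\<^sup>2"
  have expn: "32 * exp (- real n) \<le> p"
  proof -
    have "real n ^ 3 \<le> 6 * exp (real n)" using power_le_fact_exp[of "real n" 1 3] by (simp add: fact_numeral)
    moreover have "192 * (real n)\<^sup>2 \<le> real n * (real n)\<^sup>2" using nbig by (intro mult_right_mono) auto
    ultimately have "32 * (real n)\<^sup>2 \<le> exp (real n)" by (simp add: power2_eq_square power3_eq_cube)
    then show ?thesis unfolding p_def using npos by (simp add: exp_minus field_simps)
  qed
  then have expn1: "exp (- real n) \<le> p" using exp_ge_zero[of "- real n"] by linarith
  have small: "exp (- y) \<le> p" if "y \<ge> real n" for y
    using that expn1 order_trans[of "exp (- y)" "exp (- real n)" p] by simp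
  obtain N1 where N1: "finite N1" "\<And>v. v \<in> N1 \<Longrightarrow> vnorm n v \<le> 1"
    "\<And>v. vnorm n v \<le> 1 \<Longrightarrow> \<exists>v'\<in>N1. vnorm n (\<lambda>j. v j - v' j) \<le> 1/2000"
    "real (card N1) \<le> exp (8000003 * real n)"
    by (rule coarse_net[OF npos], rule that)
  have n3: "n \<ge> 3" using nbig by linarith
  obtain N2 where N2: "finite N2" "\<And>v. v \<in> N2 \<Longrightarrow> vnorm n v \<le> 1"
    "\<And>v. vnorm n v \<le> 1 \<Longrightarrow> \<exists>v'\<in>N2. vnorm n (\<lambda>j. v j - v' j) \<le> 1 / real n"
    "real (card N2) \<le> exp (6 * real n * ln (real n))"
    by (rule fine_net[OF n3], rule that)
  \<comment> \<open>\<open>E1\<close> and \<open>E2\<close> concern the truncated form and its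
    truncation error, \<open>E3\<close> to \<open>E5\<close> the mean values at x, \<open>E6\<close>
    and \<open>E7\<close> the fourth-moment bound, \<open>E8\<close> the curvature at all net
    directions and radii k/(8n). Lower deviations appear as upper deviations of negated
    averages.\<close>
  define E1 where "E1 v = {\<omega> \<in> ?S. (1 + (cmod (cip n x v))\<^sup>2) + 0.001 \<le>
     avg m (\<lambda>r. if (cmod (az n \<omega> r x))\<^sup>2 \<le> T then (cmod (az n \<omega> r x))\<^sup>2 * (cmod (az n \<omega> r v))\<^sup>2 else 0)}" for v
  define E2 where "E2 = {\<omega> \<in> ?S. 0.001 \<le>
     avg m (\<lambda>r. if (cmod (az n \<omega> r x))\<^sup>2 \<le> T then 0 else (cmod (az n \<omega> r x))\<^sup>2 * (vnorm n (samp \<omega> r))\<^sup>2)}"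
  define E3 where "E3 = {\<omega> \<in> ?S. - 2 + 0.003 \<le> avg m (\<lambda>r. - ((cmod (az n \<omega> r x)) ^ 4))}"
  define E4 where "E4 = {\<omega> \<in> ?S. 1 + 0.001 \<le> avg m (\<lambda>r. (cmod (az n \<omega> r x))\<^sup>2)}"
  define E5 where "E5 = {\<omega> \<in> ?S. - 1 + 0.001 \<le> avg m (\<lambda>r. - (cmod (az n \<omega> r x))\<^sup>2)}"
  define E6 where "E6 v = {\<omega> \<in> ?S. 1 + 1 \<le> avg m (\<lambda>r. (cmod (az n \<omega> r v))\<^sup>2)}" for v
  define E7 where "E7 = {\<omega> \<in> ?S. 1 \<le>
     avg m (\<lambda>r. if (vnorm n (samp \<omega> r))\<^sup>2 > 8 * real n then (vnorm n (samp \<omega> r)) ^ 4 else 0)}"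
  define E8 where "E8 vk = {\<omega> \<in> ?S.
     - (9/8 * (vnorm n (fst vk))\<^sup>2 - 9/8 * (Im (cip n x (fst vk)))\<^sup>2 - 1/24) + 1/100 \<le>
     avg m (\<lambda>r. - (3/2 * Re (cnj (az n \<omega> r (fst vk)) * az n \<omega> r x) + (real (snd vk) / (8 * real n)) * (cmod (az n \<omega> r (fst vk)))\<^sup>2)\<^sup>2)}" for vk
  have p1: "(\<Union>v\<in>N1. E1 v) \<in> G.events \<and> G.prob (\<Union>v\<in>N1. E1 v) \<le> p"
  proof -
    have P: "E1 v \<in> G.events" "G.prob (E1 v) \<le> exp (- (real m / (32000 * T)))" if "v \<in> N1" for v
      unfolding E1_def by (rule prob_truncated_Y_upper[OF m0 x N1(2)[OF that] T])+
    note U = G.prob_UN_le_card[where E = E1, OF N1(1) P]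
    have "real (card N1) * exp (- (real m / (32000 * T))) \<le> exp (8000003 * real n) * exp (- (real m / (32000 * T)))"
      using N1(4) by (intro mult_right_mono) auto
    also have "\<dots> = exp (- (real m / (32000 * T) - 8000003 * real n))" by (simp flip: exp_add)
    also have "\<dots> \<le> p"
    proof (rule small)
      \<comment> \<open>2560000 = 32000 * 80 comes from \<open>T\<close>. This is the most demanding
        use of the constant 10^14.\<close>
      have "8000004 * real n * (2560000 * ln (real n)) \<le> real m"
      proof -
        have "8000004 * real n * (2560000 * ln (real n)) = 8000004 * 2560000 * (real n * ln (real n))" by simp
        also have "\<dots> \<le> 10 ^ 14 * (real n * ln (real n))" using n by (intro mult_right_mono) auto
        finally show ?thesis using m by (simp add: mult.assoc)
      qed
      then have "8000004 * real n \<le> real m / (2560000 * ln (real n))" using n by (simp add: pos_le_divide_eq)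
      then show "real n \<le> real m / (32000 * T) - 8000003 * real n" by (simp add: T_def)
    qed
    finally show ?thesis by (intro conjI U(1) order_trans[OF U(2)])
  qed
  have p2: "E2 \<in> G.events \<and> G.prob E2 \<le> p"
  proof -
    have "(0.001::real) > 0" by simp
    note P = prob_Y_tail[OF m0 x this, of T, folded E2_def]
    \<comment> \<open>The 80 in \<open>T\<close> is chosen for n^-5; times n this is n^-4, of which
      n^-2 absorbs the constant 256000.\<close>
    have "exp (- (T / 16)) = 1 / real n ^ 5"
    proof -
      have "exp (T / 16) = exp (ln (real n)) ^ 5" unfolding T_def by (simp flip: exp_of_nat_mult)
      then show ?thesis using npos by (simp add: exp_minus field_simps)
    qed
    then have "256 * real n * exp (- (T / 16)) / 0.001 = 256000 / ((real n)\<^sup>2 * (real n)\<^sup>2)"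
      using npos by (simp add: power2_eq_square field_simps eval_nat_numeral)
    also have "\<dots> \<le> 1 / (real n)\<^sup>2"
    proof -
      have "256000 \<le> real n * real n" using mult_mono[OF nbig nbig] by simp
      then show ?thesis using npos by (simp add: field_simps power2_eq_square)
    qed
    finally show ?thesis using P unfolding p_def by auto
  qed
  have p3: "E3 \<in> G.events \<and> G.prob E3 \<le> p"
  proof -
    have "(0.003::real) > 0" by simp
    note P = prob_avg_az_4_lower[OF m0 x this, folded E3_def]
    have "exp (- (real m * 0.003\<^sup>2 / 49152)) \<le> p" by (rule small) (use mn in \<open>simp add: power2_eq_square\<close>)
    then show ?thesis using P by auto
  qed
  have p4: "E4 \<in> G.events \<and> G.prob E4 \<le> p"
  proof -
    have "(0.001::real) > 0" "(0.001::real) \<le> 1" "vnorm n x \<le> 1" using x by auto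
    note P = prob_avg_az_sq_upper[OF m0 this(3,1,2), folded E4_def]
    have "exp (- (real m * 0.001\<^sup>2 / 512)) \<le> p" by (rule small) (use mn in \<open>simp add: power2_eq_square\<close>)
    then show ?thesis using P by auto
  qed
  have p5: "E5 \<in> G.events \<and> G.prob E5 \<le> p"
  proof -
    have "(0.001::real) > 0" by simp
    note P = prob_avg_az_sq_lower[OF m0 x this, folded E5_def]
    have "exp (- (real m * 0.001\<^sup>2 / 512)) \<le> p" by (rule small) (use mn in \<open>simp add: power2_eq_square\<close>)
    then show ?thesis using P by auto
  qed
  have p6: "(\<Union>v\<in>N1. E6 v) \<in> G.events \<and> G.prob (\<Union>v\<in>N1. E6 v) \<le> p"
  proof -
    have P: "E6 v \<in> G.events" "G.prob (E6 v) \<le> exp (- (real m * 1\<^sup>2 / 512))" if "v \<in> N1" for v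
      unfolding E6_def by (rule prob_avg_az_sq_upper[OF m0 N1(2)[OF that] zero_less_one order_refl])+
    note U = G.prob_UN_le_card[where E = E6, OF N1(1) P]
    have "real (card N1) * exp (- (real m * 1\<^sup>2 / 512)) \<le> exp (8000003 * real n) * exp (- (real m * 1\<^sup>2 / 512))"
      using N1(4) by (intro mult_right_mono) auto
    also have "\<dots> = exp (- (real m / 512 - 8000003 * real n))" by (simp flip: exp_add)
    also have "\<dots> \<le> p" by (rule small) (use mn in simp)
    finally show ?thesis by (intro conjI U(1) order_trans[OF U(2)])
  qed
  have p7: "E7 \<in> G.events \<and> G.prob E7 \<le> p"
  proof -
    note P = prob_samp_tail[OF m0, of n, folded E7_def]
    have "(2::real) ^ n \<le> exp 1 ^ n" using exp_ge_add_one_self[of "1::real"] by (intro power_mono) auto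
    then have "(2::real) ^ n \<le> exp (real n)" by (simp flip: exp_of_nat_mult)
    then have "32 * 2 ^ n * exp (- (2 * real n)) \<le> 32 * exp (real n) * exp (- (2 * real n))"
      by (intro mult_right_mono mult_left_mono) auto
    also have "\<dots> = 32 * exp (- real n)" by (simp flip: exp_add)
    also note expn
    finally show ?thesis using P by auto
  qed
  have p8: "(\<Union>vk\<in>N2 \<times> {..n}. E8 vk) \<in> G.events \<and> G.prob (\<Union>vk\<in>N2 \<times> {..n}. E8 vk) \<le> p"
  proof -
    have fin: "finite (N2 \<times> {..n})" using N2(1) by simp
    have P: "E8 vk \<in> G.events" "G.prob (E8 vk) \<le> exp (- (real m / 4000000000))" if "vk \<in> N2 \<times> {..n}" for vk
    proof -
      have v: "vnorm n (fst vk) \<le> 1" using that N2(2) by auto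
      have s: "0 \<le> real (snd vk) / (8 * real n)" "real (snd vk) / (8 * real n) \<le> 1/8"
        using that npos by (auto simp: field_simps)
      show "E8 vk \<in> G.events" "G.prob (E8 vk) \<le> exp (- (real m / 4000000000))"
        unfolding E8_def by (rule prob_curvature_lower[OF m0 x v s])+
    qed
    note U = G.prob_UN_le_card[where E = E8, OF fin P]
    \<comment> \<open>The radii contribute only a factor n + 1; the size n^(6n) of the fine net is
      what calls for n ln n samples here.\<close>
    have "real (card (N2 \<times> {..n})) = real (card N2) * (real n + 1)" using N2(1) by (simp add: card_cartesian_product algebra_simps)
    also have "\<dots> \<le> exp (6 * real n * ln (real n)) * exp (real n)"
      using N2(4) exp_ge_add_one_self[of "real n"] by (intro mult_mono) (auto simp: add.commute)
    finally have "real (card (N2 \<times> {..n})) * exp (- (real m / 4000000000))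
       \<le> exp (6 * real n * ln (real n)) * exp (real n) * exp (- (real m / 4000000000))"
      by (intro mult_right_mono) auto
    also have "\<dots> = exp (- (real m / 4000000000 - 6 * real n * ln (real n) - real n))" by (simp flip: exp_add)
    also have "\<dots> \<le> p"
    proof (rule small)
      have "1 * real n \<le> ln (real n) * real n" using n by (intro mult_right_mono) auto
      then show "real n \<le> real m / 4000000000 - 6 * real n * ln (real n) - real n"
        using m by (simp add: mult_ac)
    qed
    finally show ?thesis by (intro conjI U(1) order_trans[OF U(2)])
  qed
  define Bad where "Bad = (\<lambda>i. [(\<Union>v\<in>N1. E1 v), E2, E3, E4, E5, (\<Union>v\<in>N1. E6 v), E7, (\<Union>vk\<in>N2 \<times> {..n}. E8 vk)] ! i)"
  have Bad: "Bad i \<in> G.events" "G.prob (Bad i) \<le> p" if "i < 8" for i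
  proof -
    have "i \<in> {0, 1, 2, 3, 4, 5, 6, 7}" using that by auto
    then show "Bad i \<in> G.events" "G.prob (Bad i) \<le> p"
      unfolding Bad_def using p1 p2 p3 p4 p5 p6 p7 p8 by auto
  qed
  define E where "E = ?S - (\<Union>i<8. Bad i)"
  have E: "E \<in> G.events" "G.prob E \<ge> 1 - real 8 * p"
    unfolding E_def using G.prob_Diff_UN[of 8 Bad p] Bad by auto
  have good: "init_samples m n \<omega> x \<and> regular_samples m n \<omega> x 33" if w: "\<omega> \<in> E" for \<omega>
  proof -
    have wS: "\<omega> \<in> ?S" using w by (simp add: E_def)
    have notbad: "\<omega> \<notin> Bad i" if "i < 8" for i using w that by (auto simp: E_def)
    have n1: "\<omega> \<notin> E1 v" if "v \<in> N1" for v using notbad[of 0] that by (auto simp: Bad_def)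
    have n2: "\<omega> \<notin> E2" using notbad[of 1] by (simp add: Bad_def)
    have n3: "\<omega> \<notin> E3" using notbad[of 2] by (simp add: Bad_def)
    have n4: "\<omega> \<notin> E4" using notbad[of 3] by (simp add: Bad_def)
    have n5: "\<omega> \<notin> E5" using notbad[of 4] by (simp add: Bad_def)
    have n6: "\<omega> \<notin> E6 v" if "v \<in> N1" for v using notbad[of 5] that by (auto simp: Bad_def)
    have n7: "\<omega> \<notin> E7" using notbad[of 6] by (simp add: Bad_def)
    have n8: "\<omega> \<notin> E8 (v, k)" if "v \<in> N2" "k \<le> n" for v k using notbad[of 7] that by (auto simp: Bad_def)
    have Ynet: "Yform m n \<omega> x v \<le> 1 + (cmod (cip n x v))\<^sup>2 + 0.002" if v: "v \<in> N1" for v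
    proof -
      have "Yform m n \<omega> x v \<le>
         avg m (\<lambda>r. (if (cmod (az n \<omega> r x))\<^sup>2 \<le> T then (cmod (az n \<omega> r x))\<^sup>2 * (cmod (az n \<omega> r v))\<^sup>2 else 0)
           + (if (cmod (az n \<omega> r x))\<^sup>2 \<le> T then 0 else (cmod (az n \<omega> r x))\<^sup>2 * (vnorm n (samp \<omega> r))\<^sup>2))"
        unfolding Yform_def meas_def
      proof (intro avg_mono)
        fix r
        have "cmod (az n \<omega> r v) \<le> vnorm n (samp \<omega> r) * vnorm n v"
          unfolding az_eq_cip by (rule cip_Cauchy_Schwarz)
        also have "\<dots> \<le> vnorm n (samp \<omega> r) * 1" using N1(2)[OF v] by (intro mult_left_mono) auto
        finally have "(cmod (az n \<omega> r v))\<^sup>2 \<le> (vnorm n (samp \<omega> r))\<^sup>2" by (intro power_mono) auto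
        then show "(cmod (az n \<omega> r x))\<^sup>2 * (cmod (az n \<omega> r v))\<^sup>2 \<le>
          (if (cmod (az n \<omega> r x))\<^sup>2 \<le> T then (cmod (az n \<omega> r x))\<^sup>2 * (cmod (az n \<omega> r v))\<^sup>2 else 0)
           + (if (cmod (az n \<omega> r x))\<^sup>2 \<le> T then 0 else (cmod (az n \<omega> r x))\<^sup>2 * (vnorm n (samp \<omega> r))\<^sup>2)"
          by (simp add: mult_left_mono)
      qed
      also have "\<dots> \<le> (1 + (cmod (cip n x v))\<^sup>2) + 0.001 + 0.001"
        unfolding avg_add using n1[OF v] n2 wS unfolding E1_def E2_def by (intro add_mono) auto
      finally show ?thesis by simp
    qed
    have Yup: "Yform m n \<omega> x v \<le> 1 + (cmod (cip n x v))\<^sup>2 + 0.01" if "vnorm n v = 1" for v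
      by (rule Yform_net[OF x N1(2,3) Ynet that])
    have Y: "Yform m n \<omega> x v \<le> 2.1 * (vnorm n v)\<^sup>2" for v
      unfolding Yform_wform
    proof (rule wform_le_unit)
      fix v assume v: "vnorm n v = 1"
      have "cmod (cip n x v) \<le> 1" using cip_Cauchy_Schwarz[of n x v] x v by simp
      then have "(cmod (cip n x v))\<^sup>2 \<le> 1" by (simp add: abs_square_le_1)
      then show "wform m n \<omega> (meas n \<omega> x) v \<le> 2.1" using Yup[OF v] by (simp add: Yform_wform)
    qed
    have S: "avg m (\<lambda>r. (cmod (az n \<omega> r v))\<^sup>2 * (cmod (az n \<omega> r w))\<^sup>2) \<le> 33 * real n * (vnorm n v)\<^sup>2 * (vnorm n w)\<^sup>2" for v w
    proof (rule fourth_moment_from_net[OF npos N1(3)])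
      show "avg m (\<lambda>r. (cmod (az n \<omega> r v'))\<^sup>2) \<le> 2" if "v' \<in> N1" for v'
        using n6[OF that] wS by (simp add: E6_def)
      show "avg m (\<lambda>r. if (vnorm n (samp \<omega> r))\<^sup>2 > 8 * real n then (vnorm n (samp \<omega> r)) ^ 4 else 0) \<le> 1"
        using n7 wS by (simp add: E7_def)
    qed
    have neg: "avg m (\<lambda>r. - f r) = - avg m f" for f
      using avg_cmult[of m "-1" f] by simp
    have n4': "n \<ge> 10000" using nbig by linarith
    have L: "0.9 \<le> avg m (\<lambda>r. (3/2 * Re (cnj (az n \<omega> r g) * az n \<omega> r x) + \<sigma> * (cmod (az n \<omega> r g))\<^sup>2)\<^sup>2)"
      if "vnorm n g = 1" "Im (cip n x g) = 0" "0 \<le> \<sigma>" "\<sigma> \<le> 1/8" for g \<sigma>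
    proof (rule curvature_from_net[OF x n4' N2(2,3) Y S _ that])
      fix g k assume "g \<in> N2" "k \<le> n"
      from n8[OF this] wS
      show "9/8 * (vnorm n g)\<^sup>2 - 9/8 * (Im (cip n x g))\<^sup>2 - 1/24 - 1/100 \<le>
         avg m (\<lambda>r. (3/2 * Re (cnj (az n \<omega> r g) * az n \<omega> r x) + (real k / (8 * real n)) * (cmod (az n \<omega> r g))\<^sup>2)\<^sup>2)"
        unfolding E8_def fst_conv snd_conv neg mem_Collect_eq by linarith
    qed
    have i3: "1.997 \<le> Yform m n \<omega> x x"
    proof -
      have "Yform m n \<omega> x x = avg m (\<lambda>r. (cmod (az n \<omega> r x)) ^ 4)"
        unfolding Yform_def meas_def by (simp flip: power_add)
      then show ?thesis using n3 wS unfolding E3_def neg by simp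
    qed
    have i4: "avg m (meas n \<omega> x) \<le> 1.001" "0.999 \<le> avg m (meas n \<omega> x)"
    proof -
      have "avg m (meas n \<omega> x) = avg m (\<lambda>r. (cmod (az n \<omega> r x))\<^sup>2)" by (simp add: meas_def avg_def)
      then show "avg m (meas n \<omega> x) \<le> 1.001" "0.999 \<le> avg m (meas n \<omega> x)"
        using n4 n5 wS unfolding E4_def E5_def neg by simp_all
    qed
    have "init_samples m n \<omega> x" unfolding init_samples_def by (intro conjI allI impI Yup i3 i4)
    moreover have "regular_samples m n \<omega> x 33"
      unfolding regular_samples_def by (intro conjI allI impI Y S L)
    ultimately show ?thesis ..
  qed
  show ?thesis using E good unfolding p_def by (intro bexI[of _ E]) auto
qed

text \<open>Transfers the unit case to x = c u by homogeneity; 1650 = 50 * 33 is the step bound of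
  \<open>descent_step\<close> with K = 33.\<close>

lemma good_samples_convergence:
  assumes x: "vnorm n x \<noteq> 0" and n: "n > 0"
    and u: "u = (\<lambda>j. complex_of_real (1 / vnorm n x) * x j)"
    and I: "init_samples m n \<omega> u" and R: "regular_samples m n \<omega> u 33"
  shows "leading_eigvec n (Ymat m n \<omega> x) v \<Longrightarrow>
      pdist n (\<lambda>j. of_real (sqrt ((\<Sum>r<m. meas n \<omega> x r) / real m)) * v j) x \<le> 1/8 * vnorm n x"
    and "0 < \<mu> \<Longrightarrow> \<mu> \<le> 1 / 1650 / real n \<Longrightarrow> pdist n z0 x \<le> 1/8 * vnorm n x \<Longrightarrow>
      pdist n (wf_iter m n \<omega> x \<mu> z0 \<tau>) x \<le> 1/8 * (1 - \<mu>/4) powr (real \<tau> / 2) * vnorm n x"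
proof -
  define c where "c = vnorm n x"
  have c: "c > 0" using x unfolding c_def by (simp add: less_le)
  have u1: "vnorm n u = 1" unfolding u using x by (rule unit_scaling)
  have xu: "x = (\<lambda>j. of_real c * u j)" unfolding u c_def using x by simp
  {
    assume "leading_eigvec n (Ymat m n \<omega> x) v"
    then have v: "leading_eigvec n (Ymat m n \<omega> u) v"
      using leading_eigvec_Ymat_scale[of n m \<omega> c u v] c xu by simp
    have "sqrt ((\<Sum>r<m. meas n \<omega> x r) / real m) = c * sqrt ((\<Sum>r<m. meas n \<omega> u r) / real m)"
      unfolding xu meas_scale sum_distrib_left[symmetric] times_divide_eq_right[symmetric] real_sqrt_mult
      using c by simp
    then have "pdist n (\<lambda>j. of_real (sqrt ((\<Sum>r<m. meas n \<omega> x r) / real m)) * v j) x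
       = pdist n (\<lambda>j. of_real c * (of_real (sqrt ((\<Sum>r<m. meas n \<omega> u r) / real m)) * v j)) (\<lambda>j. of_real c * u j)"
      by (subst (2) xu) (simp add: mult.assoc)
    also have "\<dots> = c * pdist n (\<lambda>j. of_real (sqrt ((\<Sum>r<m. meas n \<omega> u r) / real m)) * v j) u"
      by (rule pdist_scale[OF c])
    also have "\<dots> \<le> c * (1/8)" using c spectral_init_unit[OF u1 I v] by (intro mult_left_mono) auto
    finally show "pdist n (\<lambda>j. of_real (sqrt ((\<Sum>r<m. meas n \<omega> x r) / real m)) * v j) x \<le> 1/8 * vnorm n x"
      unfolding c_def by simp
  next
    assume mu: "0 < \<mu>" "\<mu> \<le> 1 / 1650 / real n" and z: "pdist n z0 x \<le> 1/8 * vnorm n x"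
    define w where "w = (\<lambda>j. of_real (1 / c) * z0 j)"
    have zw: "z0 = (\<lambda>j. of_real c * w j)" unfolding w_def using c by simp
    have "c * pdist n w u \<le> 1/8 * c"
      using z pdist_scale[OF c, of n w u] unfolding zw[symmetric] xu[symmetric] c_def[symmetric] by simp
    then have w8: "pdist n w u \<le> 1/8" using c by simp
    have mu': "\<mu> \<le> 1 / (50 * 33 * real n)" "\<mu> \<le> 1"
    proof -
      show "\<mu> \<le> 1 / (50 * 33 * real n)" using mu by simp
      have "1 / 1650 / real n \<le> 1" using n by (simp add: field_simps)
      then show "\<mu> \<le> 1" using mu by simp
    qed
    have "pdist n (wf_iter m n \<omega> u \<mu> w \<tau>) u \<le> 1/8 * (1 - \<mu>/4) powr (real \<tau> / 2)"
      by (rule wf_iter_converges_unit[OF u1 n R _ mu(1) mu' w8]) simp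
    then have "c * pdist n (wf_iter m n \<omega> u \<mu> w \<tau>) u \<le> c * (1/8 * (1 - \<mu>/4) powr (real \<tau> / 2))"
      using c by (intro mult_left_mono) auto
    moreover have "pdist n (wf_iter m n \<omega> x \<mu> z0 \<tau>) x = c * pdist n (wf_iter m n \<omega> u \<mu> w \<tau>) u"
      using pdist_scale[OF c, of n "wf_iter m n \<omega> u \<mu> w \<tau>" u] wf_iter_scale[OF c, of m n \<omega> u \<mu> w \<tau>]
      unfolding zw[symmetric] xu[symmetric] by simp
    ultimately show "pdist n (wf_iter m n \<omega> x \<mu> z0 \<tau>) x \<le> 1/8 * (1 - \<mu>/4) powr (real \<tau> / 2) * vnorm n x"
      unfolding c_def by (simp add: mult_ac)
  }
qed

lemma pdist_zero:
  assumes "vnorm n x = 0" shows "pdist n z x = vnorm n z"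
proof (rule power2_eq_imp_eq)
  have "cip n x z = 0" using cip_Cauchy_Schwarz[of n x z] assms by simp
  then show "(pdist n z x)\<^sup>2 = (vnorm n z)\<^sup>2" unfolding pdist_sq using assms by simp
qed (simp_all add: pdist_nonneg)

text \<open>The zero signal cannot be normalized. Its measurements vanish, so the scaled initial
  vector is zero; an admissible starting point has norm 0, and so has every iterate because the
  gradient vanishes there.\<close>

lemma zero_signal_convergence:
  assumes x: "vnorm n x = 0"
  shows "pdist n (\<lambda>j. of_real (sqrt ((\<Sum>r<m. meas n \<omega> x r) / real m)) * v j) x \<le> 1/8 * vnorm n x"
    and "pdist n z0 x \<le> 1/8 * vnorm n x \<Longrightarrow>
      pdist n (wf_iter m n \<omega> x \<mu> z0 \<tau>) x \<le> 1/8 * (1 - \<mu>/4) powr (real \<tau> / 2) * vnorm n x"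
proof -
  have az0: "az n \<omega> r z = 0" if "vnorm n z = 0" for r z
    using vnorm_eq_0D[OF that] by (simp add: az_def)
  show "pdist n (\<lambda>j. of_real (sqrt ((\<Sum>r<m. meas n \<omega> x r) / real m)) * v j) x \<le> 1/8 * vnorm n x"
    using x by (simp add: pdist_zero meas_def az0 vnorm_def)
  assume "pdist n z0 x \<le> 1/8 * vnorm n x"
  then have z0: "vnorm n z0 = 0" using x vnorm_nonneg[of n z0] by (simp add: pdist_zero)
  have "vnorm n (wf_iter m n \<omega> x \<mu> z0 t) = 0" for t
    by (induction t) (simp_all add: z0 wgrad_def az0)
  then show "pdist n (wf_iter m n \<omega> x \<mu> z0 \<tau>) x \<le> 1/8 * (1 - \<mu>/4) powr (real \<tau> / 2) * vnorm n x"
    using x by (simp add: pdist_zero)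
qed

theorem theorem3p3:
  "\<exists>c0 > (0::real). \<exists>\<gamma> > (0::real). \<exists>c1 > (0::real).
    \<forall>(n::nat) (m::nat) (x::nat \<Rightarrow> complex).
      real m \<ge> c0 * real n * ln (real n) \<longrightarrow>
      ((\<exists>E \<in> sets (gauss_space m n).
          measure (gauss_space m n) E \<ge> 1 - 10 * exp (- \<gamma> * n) - 8 / (real n)\<^sup>2 \<and>
          (\<forall>\<omega>\<in>E. \<forall>v. leading_eigvec n (Ymat m n \<omega> x) v \<longrightarrow>
             pdist n (\<lambda>j. of_real (sqrt ((\<Sum>r<m. meas n \<omega> x r) / real m)) * v j) x
               \<le> 1/8 * vnorm n x))
       \<and>
       (\<forall>\<mu>::real. 0 < \<mu> \<and> \<mu> \<le> c1 / real n \<longrightarrow>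
          (\<exists>E \<in> sets (gauss_space m n).
             measure (gauss_space m n) E
               \<ge> 1 - 13 * exp (- \<gamma> * n) - real m * exp (- 1.5 * real m) - 8 / (real n)\<^sup>2 \<and>
             (\<forall>\<omega>\<in>E. \<forall>z0. pdist n z0 x \<le> 1/8 * vnorm n x \<longrightarrow>
                (\<forall>\<tau>::nat. pdist n (wf_iter m n \<omega> x \<mu> z0 \<tau>) x
                   \<le> 1/8 * (1 - \<mu>/4) powr (real \<tau> / 2) * vnorm n x)))))"
proof -
  \<comment> \<open>\<open>\<gamma>\<close> is so small that the claim on the probability is void for \<open>n \<le> n0\<close>.\<close>
  define n0 where "n0 = exp (102400::real)"
  define \<gamma> where "\<gamma> = ln 10 / n0"
  have n0: "n0 > 0" by (simp add: n0_def)
  \<comment> \<open>A single event carries both claims, uniformly in \<mu>, the starting point and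
    \<tau>.\<close>
  have main: "(\<exists>E \<in> sets (gauss_space m n).
          measure (gauss_space m n) E \<ge> 1 - 10 * exp (- \<gamma> * n) - 8 / (real n)\<^sup>2 \<and>
          (\<forall>\<omega>\<in>E. (\<forall>v. leading_eigvec n (Ymat m n \<omega> x) v \<longrightarrow>
             pdist n (\<lambda>j. of_real (sqrt ((\<Sum>r<m. meas n \<omega> x r) / real m)) * v j) x \<le> 1/8 * vnorm n x) \<and>
           (\<forall>\<mu> z0 \<tau>. 0 < \<mu> \<longrightarrow> \<mu> \<le> 1 / 1650 / real n \<longrightarrow> pdist n z0 x \<le> 1/8 * vnorm n x \<longrightarrow>
             pdist n (wf_iter m n \<omega> x \<mu> z0 \<tau>) x \<le> 1/8 * (1 - \<mu>/4) powr (real \<tau> / 2) * vnorm n x)))"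
    if m: "real m \<ge> 10 ^ 14 * real n * ln (real n)" for n m :: nat and x
  proof (cases "real n \<le> n0")
    case True
    have "\<gamma> * n \<le> ln 10" using True n0 unfolding \<gamma>_def by (simp add: field_simps)
    then have "exp (- ln 10) \<le> exp (- \<gamma> * n)" by simp
    then have a: "1 \<le> 10 * exp (- \<gamma> * n)" by (simp add: exp_minus)
    have "1 - 10 * exp (- \<gamma> * n) - 8 / (real n)\<^sup>2 \<le> 0"
    proof -
      have "0 \<le> 8 / (real n)\<^sup>2" by simp
      then show ?thesis using a by linarith
    qed
    then show ?thesis by (intro bexI[of _ "{}"]) auto
  next
    case False
    then have n: "n > 0" using n0 by (cases "n = 0") auto
    have ln: "ln (real n) \<ge> 102400" using False n unfolding n0_def by (simp add: ln_ge_iff)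
    interpret G: prob_space "gauss_space m n" by (rule prob_space_gauss_space)
    show ?thesis
    proof (cases "vnorm n x = 0")
      case True
      have "0 \<le> 8 / (real n)\<^sup>2" by simp
      then have "1 - 10 * exp (- \<gamma> * n) - 8 / (real n)\<^sup>2 \<le> measure (gauss_space m n) (space (gauss_space m n))"
        using G.prob_space exp_ge_zero[of "- \<gamma> * n"] by linarith
      then show ?thesis
        using zero_signal_convergence[OF True] by (intro bexI[of _ "space (gauss_space m n)"] conjI ballI allI impI) auto
    next
      case False
      define u where "u = (\<lambda>j. complex_of_real (1 / vnorm n x) * x j)"
      have u1: "vnorm n u = 1" unfolding u_def using False by (rule unit_scaling)
      obtain E where E: "E \<in> sets (gauss_space m n)" "measure (gauss_space m n) E \<ge> 1 - 8 / (real n)\<^sup>2"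
        "\<And>\<omega>. \<omega> \<in> E \<Longrightarrow> init_samples m n \<omega> u \<and> regular_samples m n \<omega> u 33"
        using good_samples_event[OF ln m u1] by blast
      have pE: "1 - 10 * exp (- \<gamma> * n) - 8 / (real n)\<^sup>2 \<le> measure (gauss_space m n) E"
        using E(2) exp_ge_zero[of "- \<gamma> * n"] by linarith
      note conv = good_samples_convergence[OF False n u_def conjunct1[OF E(3)] conjunct2[OF E(3)]]
      show ?thesis
        by (intro bexI[OF _ E(1)] conjI ballI allI impI pE) (rule conv(1), assumption+, rule conv(2), assumption+)
    qed
  qed
  have "\<gamma> > 0" using n0 by (simp add: \<gamma>_def)
  \<comment> \<open>The second probability bound is the weaker of the two, so the event of the first
    is reused.\<close>
  have smaller: "1 - 13 * exp (- \<gamma> * n) - real m * exp (- 1.5 * real m) - 8 / (real n)\<^sup>2 \<le> 1 - 10 * exp (- \<gamma> * n) - 8 / (real n)\<^sup>2"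
    for n m :: nat
    using exp_ge_zero[of "- \<gamma> * n"] mult_nonneg_nonneg[OF of_nat_0_le_iff exp_ge_zero, of m "- 1.5 * real m"] by linarith
  show ?thesis
  proof (rule exI[of _ "10 ^ 14"], rule conjI[rotated], rule exI[of _ \<gamma>], rule conjI[rotated],
      rule exI[of _ "1 / 1650"], rule conjI[rotated], intro allI impI conjI)
    fix n m :: nat and x :: "nat \<Rightarrow> complex"
    assume m: "10 ^ 14 * real n * ln (real n) \<le> real m"
    from main[OF this, of x] obtain E where E: "E \<in> sets (gauss_space m n)"
      "1 - 10 * exp (- \<gamma> * n) - 8 / (real n)\<^sup>2 \<le> measure (gauss_space m n) E"
      and init: "\<And>\<omega> v. \<omega> \<in> E \<Longrightarrow> leading_eigvec n (Ymat m n \<omega> x) v \<Longrightarrow>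
         pdist n (\<lambda>j. of_real (sqrt ((\<Sum>r<m. meas n \<omega> x r) / real m)) * v j) x \<le> 1/8 * vnorm n x"
      and conv: "\<And>\<omega> \<mu> z0 \<tau>. \<omega> \<in> E \<Longrightarrow> 0 < \<mu> \<Longrightarrow> \<mu> \<le> 1 / 1650 / real n \<Longrightarrow> pdist n z0 x \<le> 1/8 * vnorm n x \<Longrightarrow>
         pdist n (wf_iter m n \<omega> x \<mu> z0 \<tau>) x \<le> 1/8 * (1 - \<mu>/4) powr (real \<tau> / 2) * vnorm n x"
      by metis
    show "\<exists>E \<in> sets (gauss_space m n).
          measure (gauss_space m n) E \<ge> 1 - 10 * exp (- \<gamma> * n) - 8 / (real n)\<^sup>2 \<and>
          (\<forall>\<omega>\<in>E. \<forall>v. leading_eigvec n (Ymat m n \<omega> x) v \<longrightarrow>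
             pdist n (\<lambda>j. of_real (sqrt ((\<Sum>r<m. meas n \<omega> x r) / real m)) * v j) x \<le> 1/8 * vnorm n x)"
      by (intro bexI[OF _ E(1)] conjI ballI allI impI E(2) init)
    fix \<mu> :: real
    assume "0 < \<mu> \<and> \<mu> \<le> 1 / 1650 / real n"
    then have mu: "0 < \<mu>" "\<mu> \<le> 1 / 1650 / real n" by auto
    show "\<exists>E \<in> sets (gauss_space m n).
             measure (gauss_space m n) E
               \<ge> 1 - 13 * exp (- \<gamma> * n) - real m * exp (- 1.5 * real m) - 8 / (real n)\<^sup>2 \<and>
             (\<forall>\<omega>\<in>E. \<forall>z0. pdist n z0 x \<le> 1/8 * vnorm n x \<longrightarrow>
                (\<forall>\<tau>::nat. pdist n (wf_iter m n \<omega> x \<mu> z0 \<tau>) x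
                   \<le> 1/8 * (1 - \<mu>/4) powr (real \<tau> / 2) * vnorm n x))"
      by (intro bexI[OF _ E(1)] conjI ballI allI impI order_trans[OF smaller E(2)] conv mu)
  qed (use \<open>\<gamma> > 0\<close> in simp_all)
qed

end
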